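(* Let $d\ge2$, $\alpha>0$ and $\beta\in\mathbb{R}$. Let $\Lambda=\{\lambda_\ell\}_{\ell\ge0}$ be a positive non-increasing sequence with $$\lim_{\ell\to\infty}\lambda_\ell\,\ell^{\alpha}(\ln\ell)^{\beta}=1.$$ Then $$\lim_{n\to\infty}n^{\alpha/d}(\ln n)^\beta\,a_n\big(\mathrm{H}^{\Lambda}(\mathbb{S}^d)\big)=\Big(\frac{2}{d!}\Big)^{\alpha/d}d^{\beta}.$$
   Context: Let $\mathbb{S}^d$ be the unit sphere in $\mathbb{R}^{d+1}$ with normalized surface measure $\sigma_d$, and let $L_2=L_2(\mathbb{S}^d,\sigma_d)$. Let $H_\ell(f)$ be the $L_2$-orthogonal projection of $f$ onto the space of spherical harmonics of degree $\ell$. For a positive non-increasing sequence $\Lambda=\{\lambda_\ell\}$ with $\lambda_\ell\to0$, the multiplier space is $$\mathrm{H}^\Lambda(\mathbb{S}^d)=\Big\{f\in L_2:\ \|f\|^2_{\mathrm{H}^\Lambda}=\sum_{\ell\ge0}\lambda_\ell^{-2}\|H_\ell(f)\|_{L_2}^2<\infty\Big\}.$$ For a Hilbert space $H$ continuously embedded in $L_2$, the approximation numbers are $$a_n(H)=\inf_{L_1,\dots,L_n\in H',\ g_1,\dots,g_n\in L_2}\sup_{\|f\|_H\le1}\Big\|f-\sum_{i=1}^nL_i(f)g_i\Big\|_{L_2}.$$ *)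

theory Defs
  imports "HOL-Analysis.Analysis"
begin

text \<open>Points of R^(d+1) are elements of a Euclidean space 'a with DIM('a) = d+1;
  the unit sphere is sphere 0 1.\<close>

text \<open>Normalized surface measure on the unit sphere: push-forward of the normalized
  Lebesgue measure on the unit ball under the radial projection x / |x|
  (the cone-measure description of the normalized surface measure).\<close>
definition sphere_measure :: "('a::euclidean_space) measure" where
  "sphere_measure = distr (uniform_measure lborel (ball 0 1)) borel (\<lambda>x. x /\<^sub>R norm x)"

definition L2_sphere :: "('a::euclidean_space \<Rightarrow> real) set" where
  "L2_sphere = {f. f \<in> borel_measurable sphere_measure \<and>
                   integrable sphere_measure (\<lambda>x. (f x)\<^sup>2)}"

definition L2_norm_sphere :: "('a::euclidean_space \<Rightarrow> real) \<Rightarrow> real" where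
  "L2_norm_sphere f = sqrt (\<integral>x. (f x)\<^sup>2 \<partial>sphere_measure)"

definition poly_eval :: "(('a::euclidean_space \<Rightarrow> nat) \<Rightarrow> real) \<Rightarrow> 'a \<Rightarrow> real" where
  "poly_eval c x = (\<Sum>\<alpha>\<in>{\<alpha>. c \<alpha> \<noteq> 0}. c \<alpha> * (\<Prod>b\<in>Basis. (x \<bullet> b) ^ \<alpha> b))"

text \<open>Homogeneous polynomial of degree l whose Laplacian vanishes. The coefficient of
  the monomial with exponent beta in the Laplacian is
  sum over b of (beta b + 2)(beta b + 1) * c(beta + 2 e_b).\<close>
definition harmonic_homog_poly :: "nat \<Rightarrow> (('a::euclidean_space \<Rightarrow> nat) \<Rightarrow> real) \<Rightarrow> bool" where
  "harmonic_homog_poly l c \<longleftrightarrow>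
     finite {\<alpha>. c \<alpha> \<noteq> 0} \<and>
     (\<forall>\<alpha>. c \<alpha> \<noteq> 0 \<longrightarrow> (\<forall>i. i \<notin> Basis \<longrightarrow> \<alpha> i = 0) \<and> (\<Sum>b\<in>Basis. \<alpha> b) = l) \<and>
     (\<forall>\<beta>. (\<Sum>b\<in>Basis. real ((\<beta> b + 2) * (\<beta> b + 1)) * c (\<beta>(b := \<beta> b + 2))) = 0)"

text \<open>Spherical harmonics of degree l (as functions; only their values on the sphere matter).\<close>
definition sph_harm :: "nat \<Rightarrow> ('a::euclidean_space \<Rightarrow> real) set" where
  "sph_harm l = {poly_eval c | c. harmonic_homog_poly l c}"

definition sph_proj :: "nat \<Rightarrow> ('a::euclidean_space \<Rightarrow> real) \<Rightarrow> ('a \<Rightarrow> real)" where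
  "sph_proj l f = (SOME g. g \<in> sph_harm l \<and>
      (\<forall>h\<in>sph_harm l. (\<integral>x. (f x - g x) * h x \<partial>sphere_measure) = 0))"

definition HLambda :: "(nat \<Rightarrow> real) \<Rightarrow> ('a::euclidean_space \<Rightarrow> real) set" where
  "HLambda lam = {f \<in> L2_sphere.
      summable (\<lambda>l. (L2_norm_sphere (sph_proj l f) / lam l)\<^sup>2)}"

definition HLambda_norm :: "(nat \<Rightarrow> real) \<Rightarrow> ('a::euclidean_space \<Rightarrow> real) \<Rightarrow> real" where
  "HLambda_norm lam f = sqrt (\<Sum>l. (L2_norm_sphere (sph_proj l f) / lam l)\<^sup>2)"

definition HLambda_dual :: "(nat \<Rightarrow> real) \<Rightarrow> (('a::euclidean_space \<Rightarrow> real) \<Rightarrow> real) set" where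
  "HLambda_dual lam = {L.
      (\<forall>f\<in>HLambda lam. \<forall>g\<in>HLambda lam. \<forall>a b.
          L (\<lambda>x. a * f x + b * g x) = a * L f + b * L g) \<and>
      (\<exists>C. \<forall>f\<in>HLambda lam. \<bar>L f\<bar> \<le> C * HLambda_norm lam f)}"

definition approx_num :: "('a::euclidean_space) itself \<Rightarrow> (nat \<Rightarrow> real) \<Rightarrow> nat \<Rightarrow> real" where
  "approx_num (_ :: 'a itself) lam n =
     (INF (L, g) \<in> {(L, g). (\<forall>i<n. L i \<in> HLambda_dual lam) \<and>
                            (\<forall>i<n. (g i :: 'a \<Rightarrow> real) \<in> L2_sphere)}.
        (SUP f \<in> {f \<in> HLambda lam. HLambda_norm lam f \<le> 1}.
           L2_norm_sphere (\<lambda>x. f x - (\<Sum>i<n. L i f * g i x))))"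

end

theory Submission
  imports Defs
begin

text \<open>
  The approximation numbers of $\mathrm{H}^\Lambda$ are $a_n = \lambda_k$ whenever
  $N(k-1) \le n < N(k)$, where $N(k)$ is the dimension of $V_k$, the span of all spherical harmonics
  of degree at most $k$: the $L_2$-projection onto $V_{k-1}$ has error at most $\lambda_k$ on the unit
  ball of $\mathrm{H}^\Lambda$, while any $n < N(k)$ functionals vanish at some $f \in V_k$ with
  $\|f\|_{L_2} = \lambda_k$, and such an $f$ lies in that unit ball. As functions on the sphere, $V_k$ is
  the direct sum of the homogeneous polynomials of degrees $k$ and $k-1$ in $d+1$ variables, so
  $N(k) = \binom{k+d}{d} + \binom{k-1+d}{d} \sim 2k^d/d!$, and the asymptotics of $\lambda_k$ translate
  into those of $a_n$.
\<close>

section \<open>Finite-dimensional projections in $L_2$\<close>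

text \<open>The dimension of V_k is never computed as such. The count N(k) enters through two facts
  about the monomials of degrees k and k-1: they span V_k on the sphere, which limits the length of
  an orthonormal system in V_k and gives the upper bound; and they are linearly independent on the
  sphere, so n < N(k) linear conditions leave a nonzero element of V_k, which gives the lower bound.
  Both uses rest on \<open>homogeneous_system_nontrivial_solution\<close>.

  The norm of H^Lambda sees f only through its projections, so comparing it with the L_2 norm takes
  Parseval's identity: orthogonality of different degrees, and density. Orthogonality is the
  obstacle, because the surface measure is given as a radial push-forward of Lebesgue measure on the
  ball. The integrals over the sphere are therefore traded for integrals over the ball, where
  homogeneous integrands differ only by an explicit factor, and a bump function removes the boundary
  term of Green's formula.

  The factor d^\<beta> of the limit arises from the logarithm alone: n ~ c k^d gives ln n ~ d ln
  k.\<close>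

lemma homogeneous_system_nontrivial_solution:
  fixes A :: "'i \<Rightarrow> 'j \<Rightarrow> 'k::field"
  assumes "finite I" "finite J" "card I < card J"
  shows "\<exists>x. (\<exists>j\<in>J. x j \<noteq> 0) \<and> (\<forall>i\<in>I. (\<Sum>j\<in>J. A i j * x j) = 0)"
  using assms
proof (induction I arbitrary: J A rule: finite_induct)
  case empty
  then have "J \<noteq> {}" by auto
  then show ?case by (intro exI[of _ "\<lambda>_. 1"]) auto
next
  case (insert r I)
  show ?case
  proof (cases "\<forall>j\<in>J. A r j = 0")
    case True
    have "card I < card J" using insert by simp
    from insert.IH[OF insert.prems(1) this, of A] True show ?thesis by auto
  next
    case False
    then obtain p where p: "p \<in> J" "A r p \<noteq> 0" by auto
    define K where "K = J - {p}"
    have fK: "finite K" "card I < card K" using insert p by (auto simp: K_def)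
    \<comment> \<open>Row reduction: equation \<open>r\<close>, solvable for the pivot unknown
      \<open>p\<close>, is subtracted from the other equations so that \<open>p\<close> drops out of
      them.\<close>
    from insert.IH[OF fK, of "\<lambda>i j. A i j - A i p * A r j / A r p"]
    obtain y where y: "\<exists>j\<in>K. y j \<noteq> 0"
      "\<And>i. i \<in> I \<Longrightarrow> (\<Sum>j\<in>K. (A i j - A i p * A r j / A r p) * y j) = 0" by auto
    define S where "S = (\<Sum>j\<in>K. A r j * y j)"
    define x where "x j = (if j = p then - S / A r p else y j)" for j
    have split: "(\<Sum>j\<in>J. A i j * x j) = A i p * x p + (\<Sum>j\<in>K. A i j * y j)" for i
      using p(1) insert.prems(1) by (auto simp: K_def x_def sum.remove intro!: sum.cong)
    have "(\<Sum>j\<in>J. A i j * x j) = 0" if "i \<in> I" for i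
    proof -
      have "(\<Sum>j\<in>K. (A i j - A i p * A r j / A r p) * y j)
          = (\<Sum>j\<in>K. A i j * y j) - A i p / A r p * S"
        unfolding S_def by (simp add: sum_subtractf sum_distrib_left algebra_simps)
      with y(2)[OF that] show ?thesis unfolding split by (simp add: x_def)
    qed
    moreover have "(\<Sum>j\<in>J. A r j * x j) = 0" using p unfolding split by (simp add: x_def S_def)
    moreover have "\<exists>j\<in>J. x j \<noteq> 0" using y(1) by (auto simp: K_def x_def)
    ultimately show ?thesis by (intro exI[of _ x]) auto
  qed
qed

section \<open>The L_2 inner product on functions\<close>

definition l2 :: "'b measure \<Rightarrow> ('b \<Rightarrow> real) set" where
  "l2 M = {f \<in> borel_measurable M. integrable M (\<lambda>x. (f x)\<^sup>2)}"

text \<open>Elements of \<open>l2 M\<close> are functions, not classes modulo null sets, so this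
  form is only positive semidefinite. \<open>ip_null_right\<close> (null elements are orthogonal to
  everything) does the work of definiteness.\<close>

definition ip :: "'b measure \<Rightarrow> ('b \<Rightarrow> real) \<Rightarrow> ('b \<Rightarrow> real) \<Rightarrow> real" where
  "ip M f g = (\<integral>x. f x * g x \<partial>M)"

lemma l2_measurable [measurable_dest]: "f \<in> l2 M \<Longrightarrow> f \<in> borel_measurable M"
  by (simp add: l2_def)

lemma l2_integrable_mult:
  assumes "f \<in> l2 M" "g \<in> l2 M"
  shows "integrable M (\<lambda>x. f x * g x)"
proof (rule Bochner_Integration.integrable_bound)
  show "integrable M (\<lambda>x. (f x)\<^sup>2 + (g x)\<^sup>2)" using assms by (auto simp: l2_def)
  show "(\<lambda>x. f x * g x) \<in> borel_measurable M" using assms by measurable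
  have "\<bar>a * b\<bar> \<le> a\<^sup>2 + b\<^sup>2" for a b :: real
  proof -
    have "2 * (\<bar>a\<bar> * \<bar>b\<bar>) \<le> a\<^sup>2 + b\<^sup>2"
      using sum_squares_bound[of "\<bar>a\<bar>" "\<bar>b\<bar>"] by simp
    then show ?thesis using mult_nonneg_nonneg[OF abs_ge_zero[of a] abs_ge_zero[of b]]
      unfolding abs_mult by linarith
  qed
  then show "AE x in M. norm (f x * g x) \<le> norm ((f x)\<^sup>2 + (g x)\<^sup>2)" by simp
qed

lemma l2_lincomb:
  assumes "f \<in> l2 M" "g \<in> l2 M"
  shows "(\<lambda>x. a * f x + b * g x) \<in> l2 M"
proof -
  have "(\<lambda>x. (a * f x + b * g x)\<^sup>2) =
      (\<lambda>x. a\<^sup>2 * (f x)\<^sup>2 + 2 * a * b * (f x * g x) + b\<^sup>2 * (g x)\<^sup>2)"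
    by (auto simp: power2_eq_square algebra_simps)
  moreover have "integrable M \<dots>"
    using assms l2_integrable_mult[OF assms] by (auto simp: l2_def)
  moreover have "(\<lambda>x. a * f x + b * g x) \<in> borel_measurable M" using assms by measurable
  ultimately show ?thesis by (simp add: l2_def)
qed

lemma l2_zero [simp]: "(\<lambda>x. 0) \<in> l2 M"
  by (simp add: l2_def)

lemma l2_scale: "f \<in> l2 M \<Longrightarrow> (\<lambda>x. a * f x) \<in> l2 M"
  using l2_lincomb[of f M f a 0] by simp

lemma l2_add: "f \<in> l2 M \<Longrightarrow> g \<in> l2 M \<Longrightarrow> (\<lambda>x. f x + g x) \<in> l2 M"
  using l2_lincomb[of f M g 1 1] by simp

lemma l2_diff: "f \<in> l2 M \<Longrightarrow> g \<in> l2 M \<Longrightarrow> (\<lambda>x. f x - g x) \<in> l2 M"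
  using l2_lincomb[of f M g 1 "-1"] by simp

definition fun_subspace :: "('b \<Rightarrow> real) set \<Rightarrow> bool" where
  "fun_subspace W \<longleftrightarrow> (\<lambda>x. 0) \<in> W \<and> (\<forall>f\<in>W. \<forall>g\<in>W. \<forall>a b. (\<lambda>x. a * f x + b * g x) \<in> W)"

lemma fun_subspaceI:
  assumes "(\<lambda>x. 0) \<in> W"
    and "\<And>f g a b. f \<in> W \<Longrightarrow> g \<in> W \<Longrightarrow> (\<lambda>x. a * f x + b * g x) \<in> W"
  shows "fun_subspace W"
  using assms by (simp add: fun_subspace_def)

lemma fun_subspace_zero: "fun_subspace W \<Longrightarrow> (\<lambda>x. 0) \<in> W"
  by (simp add: fun_subspace_def)

lemma fun_subspace_lincomb:
  "fun_subspace W \<Longrightarrow> f \<in> W \<Longrightarrow> g \<in> W \<Longrightarrow> (\<lambda>x. a * f x + b * g x) \<in> W"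
  by (simp add: fun_subspace_def)

lemma fun_subspace_sum:
  assumes W: "fun_subspace W" and "finite I" "\<And>i. i \<in> I \<Longrightarrow> e i \<in> W"
  shows "(\<lambda>x. \<Sum>i\<in>I. c i * e i x) \<in> W"
  using assms(2,3)
proof (induction I rule: finite_induct)
  case (insert i I)
  then show ?case
    using fun_subspace_lincomb[OF W, of "e i" "\<lambda>x. \<Sum>i\<in>I. c i * e i x" "c i" 1] by simp
qed (use fun_subspace_zero[OF W] in simp)

lemma fun_subspace_l2: "fun_subspace (l2 M)"
  by (intro fun_subspaceI l2_zero l2_lincomb)

lemmas l2_sum = fun_subspace_sum[OF fun_subspace_l2]

lemma ip_commute: "ip M f g = ip M g f"
  by (simp add: ip_def mult.commute)

lemma ip_zero_left [simp]: "ip M (\<lambda>x. 0) h = 0"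
  by (simp add: ip_def)

lemma ip_lincomb_left:
  assumes "f \<in> l2 M" "g \<in> l2 M" "h \<in> l2 M"
  shows "ip M (\<lambda>x. a * f x + b * g x) h = a * ip M f h + b * ip M g h"
proof -
  have "(\<lambda>x. (a * f x + b * g x) * h x) = (\<lambda>x. a * (f x * h x) + b * (g x * h x))"
    by (auto simp: algebra_simps)
  then show ?thesis
    using l2_integrable_mult[OF assms(1,3)] l2_integrable_mult[OF assms(2,3)] by (simp add: ip_def)
qed

lemma ip_scale_left: "f \<in> l2 M \<Longrightarrow> h \<in> l2 M \<Longrightarrow> ip M (\<lambda>x. a * f x) h = a * ip M f h"
  using ip_lincomb_left[of f M f h a 0] by simp

lemma ip_add_left:
  "f \<in> l2 M \<Longrightarrow> g \<in> l2 M \<Longrightarrow> h \<in> l2 M \<Longrightarrow> ip M (\<lambda>x. f x + g x) h = ip M f h + ip M g h"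
  using ip_lincomb_left[of f M g h 1 1] by simp

lemma ip_diff_left:
  "f \<in> l2 M \<Longrightarrow> g \<in> l2 M \<Longrightarrow> h \<in> l2 M \<Longrightarrow> ip M (\<lambda>x. f x - g x) h = ip M f h - ip M g h"
  using ip_lincomb_left[of f M g h 1 "-1"] by simp

lemma ip_sum_left:
  assumes "finite I" "\<And>i. i \<in> I \<Longrightarrow> e i \<in> l2 M" "h \<in> l2 M"
  shows "ip M (\<lambda>x. \<Sum>i\<in>I. c i * e i x) h = (\<Sum>i\<in>I. c i * ip M (e i) h)"
  using assms(1,2)
proof (induction I rule: finite_induct)
  case (insert i I)
  have "(\<lambda>x. \<Sum>i\<in>I. c i * e i x) \<in> l2 M" using insert by (intro l2_sum) auto
  then show ?case
    using insert ip_lincomb_left[of "e i" M "\<lambda>x. \<Sum>i\<in>I. c i * e i x" h "c i" 1] assms(3) by simp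
qed simp

lemma ip_scale_right: "f \<in> l2 M \<Longrightarrow> h \<in> l2 M \<Longrightarrow> ip M h (\<lambda>x. a * f x) = a * ip M h f"
  using ip_scale_left[of f M h a] by (simp only: ip_commute[of M h])

lemma ip_add_right:
  "f \<in> l2 M \<Longrightarrow> g \<in> l2 M \<Longrightarrow> h \<in> l2 M \<Longrightarrow> ip M h (\<lambda>x. f x + g x) = ip M h f + ip M h g"
  using ip_add_left[of f M g h] by (simp only: ip_commute[of M h])

lemma ip_diff_right:
  "f \<in> l2 M \<Longrightarrow> g \<in> l2 M \<Longrightarrow> h \<in> l2 M \<Longrightarrow> ip M h (\<lambda>x. f x - g x) = ip M h f - ip M h g"
  using ip_diff_left[of f M g h] by (simp only: ip_commute[of M h])

lemma ip_nonneg: "ip M f f \<ge> 0"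
  by (simp add: ip_def)

lemma ip_eq_0_AE:
  assumes "f \<in> l2 M"
  shows "ip M f f = 0 \<longleftrightarrow> (AE x in M. f x = 0)"
  using integral_nonneg_eq_0_iff_AE[OF l2_integrable_mult[OF assms assms]]
  by (simp add: ip_def)

lemma ip_add_self:
  assumes "f \<in> l2 M" "g \<in> l2 M"
  shows "ip M (\<lambda>x. f x + g x) (\<lambda>x. f x + g x) = ip M f f + 2 * ip M f g + ip M g g"
  using ip_commute[of M g f] by (simp add: assms l2_add ip_add_left ip_add_right)

lemma ip_diff_self:
  assumes "f \<in> l2 M" "g \<in> l2 M"
  shows "ip M (\<lambda>x. f x - g x) (\<lambda>x. f x - g x) = ip M f f - 2 * ip M f g + ip M g g"
  using ip_commute[of M g f] by (simp add: assms l2_diff ip_diff_left ip_diff_right)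

lemma ip_Cauchy_Schwarz:
  assumes "f \<in> l2 M" "g \<in> l2 M"
  shows "(ip M f g)\<^sup>2 \<le> ip M f f * ip M g g"
proof -
  have q: "0 \<le> ip M f f + 2 * t * ip M f g + t\<^sup>2 * ip M g g" for t
    using ip_nonneg[of M "\<lambda>x. f x + t * g x"] ip_add_self[OF assms(1) l2_scale[OF assms(2), of t]]
    by (simp add: assms l2_scale ip_scale_left ip_scale_right power2_eq_square algebra_simps)
  show ?thesis
  proof (cases "ip M g g = 0")
    case True
    have "ip M f g = 0"
    proof (rule ccontr)
      assume n: "ip M f g \<noteq> 0"
      \<comment> \<open>With \<open>ip M g g = 0\<close> the quadratic in \<open>q\<close> is affine
        in t; at this t its value is -1.\<close>
      show False
        using q[of "- (ip M f f + 1) / (2 * ip M f g)"] n True by (simp add: field_simps)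
    qed
    with True show ?thesis by simp
  next
    case False
    then have pos: "ip M g g > 0" using ip_nonneg[of M g] by simp
    show ?thesis
      using q[of "- ip M f g / ip M g g"] pos
      by (simp add: field_simps power2_eq_square)
  qed
qed

lemma ip_null_right:
  assumes "f \<in> l2 M" "g \<in> l2 M" "ip M g g = 0"
  shows "ip M f g = 0"
  using ip_Cauchy_Schwarz[OF assms(1,2)] assms(3) by simp

lemma l2_norm_triangle:
  assumes "f \<in> l2 M" "g \<in> l2 M"
  shows "sqrt (ip M (\<lambda>x. f x + g x) (\<lambda>x. f x + g x)) \<le> sqrt (ip M f f) + sqrt (ip M g g)"
proof (rule real_le_lsqrt)
  have "ip M f g \<le> sqrt (ip M f f) * sqrt (ip M g g)"
    using ip_Cauchy_Schwarz[OF assms] by (simp add: real_le_rsqrt real_sqrt_mult[symmetric])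
  then show "ip M (\<lambda>x. f x + g x) (\<lambda>x. f x + g x) \<le> (sqrt (ip M f f) + sqrt (ip M g g))\<^sup>2"
    using ip_add_self[OF assms] ip_nonneg[of M f] ip_nonneg[of M g] by (simp add: power2_sum)
qed (use ip_nonneg[of M] in auto)

text \<open>The vectors \<open>e i\<close> form a longest orthonormal system in \<open>W\<close>.
  Such a system exists because the spanning family bounds its length, so no basis of
  \<open>W\<close> has to be known. Spanning is asked for almost everywhere only: elements of V_k
  agree with combinations of monomials of two degrees merely on the sphere.\<close>

lemma finite_dim_orthonormal_projection:
  fixes W :: "('b \<Rightarrow> real) set" and m :: "'j \<Rightarrow> 'b \<Rightarrow> real"
  assumes W: "W \<subseteq> l2 M" "fun_subspace W"
    and J: "finite J"
    and span: "\<forall>v\<in>W. \<exists>c. AE x in M. v x = (\<Sum>j\<in>J. c j * m j x)"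
  shows "\<exists>n e. n \<le> card J \<and> (\<forall>i<n. e i \<in> W) \<and>
    (\<forall>f\<in>l2 M. \<forall>h\<in>W. ip M (\<lambda>x. f x - (\<Sum>i<n. ip M f (e i) * e i x)) h = 0)"
proof -
  define ON where "ON e n \<longleftrightarrow> (\<forall>i<n. e i \<in> W) \<and>
      (\<forall>i<n. \<forall>j<n. ip M (e i) (e j) = (if i = j then 1 else 0))" for e and n :: nat
  have bound: "n \<le> card J" if e: "ON e n" for e n
  proof (rule ccontr)
    assume "\<not> n \<le> card J"
    then have less: "card J < card {..<n}" by simp
    have "\<forall>i<n. \<exists>c. AE x in M. e i x = (\<Sum>j\<in>J. c j * m j x)"
      using e span by (auto simp: ON_def)
    then obtain c where c: "\<And>i. i < n \<Longrightarrow> AE x in M. e i x = (\<Sum>j\<in>J. c i j * m j x)" by metis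
    \<comment> \<open>The weights \<open>y\<close> cancel the coefficient of every
      \<open>m j\<close>, so the combination \<open>s\<close> of the \<open>e i\<close> is null,
      although pairing it with \<open>e i\<close> returns \<open>y i\<close>.\<close>
    from homogeneous_system_nontrivial_solution[OF J finite_lessThan less, of "\<lambda>j i. c i j"]
    obtain y where y: "\<exists>i<n. y i \<noteq> 0" "\<And>j. j \<in> J \<Longrightarrow> (\<Sum>i<n. c i j * y i) = 0" by auto
    define s where "s x = (\<Sum>i<n. y i * e i x)" for x
    have el: "\<And>i. i < n \<Longrightarrow> e i \<in> l2 M" using e W(1) by (auto simp: ON_def)
    then have sl: "s \<in> l2 M" unfolding s_def by (intro l2_sum) auto
    have "AE x in M. \<forall>i\<in>{..<n}. e i x = (\<Sum>j\<in>J. c i j * m j x)"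
      using c by (intro AE_finite_allI) auto
    then have "AE x in M. s x = 0"
    proof eventually_elim
      case (elim x)
      then have "s x = (\<Sum>i<n. \<Sum>j\<in>J. y i * (c i j * m j x))"
        by (simp add: s_def sum_distrib_left)
      also have "\<dots> = (\<Sum>j\<in>J. (\<Sum>i<n. c i j * y i) * m j x)"
        by (subst sum.swap) (simp add: sum_distrib_left sum_distrib_right mult_ac)
      finally show ?case using y(2) by simp
    qed
    then have z: "ip M s s = 0" using ip_eq_0_AE[OF sl] by simp
    have "ip M (e i) s = y i" if "i < n" for i
    proof -
      have "ip M s (e i) = (\<Sum>k<n. y k * ip M (e k) (e i))"
        unfolding s_def using el that by (intro ip_sum_left) auto
      also have "\<dots> = (\<Sum>k<n. if k = i then y k else 0)"
        using e that by (intro sum.cong) (auto simp: ON_def)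
      finally show ?thesis using that by (simp add: ip_commute)
    qed
    moreover have "ip M (e i) s = 0" if "i < n" for i
      using ip_null_right[OF el[OF that] sl z] .
    ultimately show False using y(1) by auto
  qed
  have "\<exists>e. ON e 0" by (simp add: ON_def)
  then have "\<exists>n. (\<exists>e. ON e n) \<and> (\<forall>n'. (\<exists>e. ON e n') \<longrightarrow> n' \<le> n)"
    using bound by (intro ex_has_greatest_nat[of _ 0 _ "Suc (card J)"]) (auto simp: less_Suc_eq_le)
  then obtain n e where e: "ON e n" and mx: "\<And>n' e'. ON e' n' \<Longrightarrow> n' \<le> n" by blast
  have eW: "\<And>i. i < n \<Longrightarrow> e i \<in> W" using e by (auto simp: ON_def)
  have el: "\<And>i. i < n \<Longrightarrow> e i \<in> l2 M" using eW W(1) by auto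
  define Q where "Q f x = (\<Sum>i<n. ip M f (e i) * e i x)" for f x
  have QW: "Q f \<in> W" for f unfolding Q_def
    by (rule fun_subspace_sum[OF W(2) finite_lessThan]) (use eW in auto)
  have orth: "ip M (\<lambda>x. f x - Q f x) (e i) = 0" if "f \<in> l2 M" "i < n" for f i
  proof -
    have "ip M (Q f) (e i) = (\<Sum>k<n. ip M f (e k) * ip M (e k) (e i))"
      unfolding Q_def using el that by (intro ip_sum_left) auto
    also have "\<dots> = (\<Sum>k<n. if k = i then ip M f (e k) else 0)"
      using e that by (intro sum.cong) (auto simp: ON_def)
    finally show ?thesis using that ip_diff_left[of f M "Q f" "e i"] QW W(1) el by auto
  qed
  \<comment> \<open>A residual of positive norm, once normalized, would extend the orthonormal
    system inside \<open>W\<close> beyond its maximal length.\<close>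
  have null: "ip M (\<lambda>x. h x - Q h x) (\<lambda>x. h x - Q h x) = 0" if h: "h \<in> W" for h
  proof (rule ccontr)
    define r where "r x = h x - Q h x" for x
    assume "ip M (\<lambda>x. h x - Q h x) (\<lambda>x. h x - Q h x) \<noteq> 0"
    then have rp: "ip M r r > 0" using ip_nonneg[of M r] by (simp add: r_def[abs_def])
    have rW: "r \<in> W" using fun_subspace_lincomb[OF W(2) h QW, of 1 "-1"] by (simp add: r_def[abs_def])
    then have rl: "r \<in> l2 M" using W(1) by auto
    define q where "q x = (1 / sqrt (ip M r r)) * r x" for x
    have qW: "q \<in> W" using fun_subspace_lincomb[OF W(2) rW rW, of "1 / sqrt (ip M r r)" 0] by (simp add: q_def[abs_def])
    then have ql: "q \<in> l2 M" using W(1) by auto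
    have qi: "ip M q u = ip M r u / sqrt (ip M r r)" if "u \<in> l2 M" for u
      using ip_scale_left[OF rl that, of "1 / sqrt (ip M r r)"] by (simp add: q_def[abs_def])
    have "ip M q (e i) = 0" if "i < n" for i
      using orth[of h i] that h W(1) qi[OF el[OF that]] by (auto simp: r_def[abs_def])
    moreover have "ip M q q = 1"
      using qi[OF ql] qi[OF rl] rp ip_commute[of M q r] by simp
    ultimately have "ON (e(n := q)) (Suc n)"
      using e qW ip_commute[of M "e _" q] by (auto simp: ON_def less_Suc_eq)
    then show False using mx by fastforce
  qed
  show ?thesis
  proof (intro exI[of _ n] exI[of _ e] conjI ballI)
    show "n \<le> card J" using bound[OF e] .
    show "\<forall>i<n. e i \<in> W" using eW by blast
    fix f h assume f: "f \<in> l2 M" and h: "h \<in> W"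
    define u where "u x = f x - Q f x" for x
    have ul: "u \<in> l2 M" using f QW W(1) by (auto simp: u_def[abs_def] intro: l2_diff)
    have hl: "h \<in> l2 M" and Ql: "Q h \<in> l2 M" using h QW W(1) by auto
    \<comment> \<open>Split \<open>h\<close> into its residual, which is null and hence orthogonal
      to everything, and \<open>Q h\<close>, a combination of the \<open>e i\<close>, to which
      \<open>u\<close> is orthogonal.\<close>
    have "ip M h u = ip M (\<lambda>x. h x - Q h x) u + ip M (Q h) u"
      using ip_diff_left[OF hl Ql ul] by simp
    also have "ip M (\<lambda>x. h x - Q h x) u = 0"
      using ip_null_right[OF ul l2_diff[OF hl Ql] null[OF h]] by (simp add: ip_commute)
    also have "ip M (Q h) u = (\<Sum>k<n. ip M h (e k) * ip M (e k) u)"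
      unfolding Q_def using el ul by (intro ip_sum_left) auto
    also have "\<dots> = 0" using orth[OF f] ip_commute[of M "e _" u] by (auto simp: u_def[abs_def] intro!: sum.neutral)
    finally show "ip M (\<lambda>x. f x - (\<Sum>i<n. ip M f (e i) * e i x)) h = 0"
      using ip_commute[of M h u] by (simp add: u_def[abs_def] Q_def)
  qed
qed

section \<open>Homogeneous polynomials and harmonic decomposition\<close>

text \<open>Building up degree by multiplication with one coordinate makes homogeneity, continuity,
  products, derivatives and Euler's identity accessible to rule induction; coefficients enter only
  when the functions are matched with \<open>sph_harm\<close>.\<close>

inductive is_hom_poly :: "nat \<Rightarrow> ('a::euclidean_space \<Rightarrow> real) \<Rightarrow> bool" where
  const: "is_hom_poly 0 (\<lambda>x. a)"
| add: "is_hom_poly k f \<Longrightarrow> is_hom_poly k g \<Longrightarrow> is_hom_poly k (\<lambda>x. f x + g x)"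
| coord: "is_hom_poly k f \<Longrightarrow> b \<in> Basis \<Longrightarrow> is_hom_poly (Suc k) (\<lambda>x. (x \<bullet> b) * f x)"

definition hom_poly :: "nat \<Rightarrow> ('a::euclidean_space \<Rightarrow> real) set" where
  "hom_poly k = {f. is_hom_poly k f}"

lemma hom_poly_const: "(\<lambda>x. a) \<in> hom_poly 0"
  by (simp add: hom_poly_def is_hom_poly.const)

lemma hom_poly_add: "f \<in> hom_poly k \<Longrightarrow> g \<in> hom_poly k \<Longrightarrow> (\<lambda>x. f x + g x) \<in> hom_poly k"
  by (simp add: hom_poly_def is_hom_poly.add)

lemma hom_poly_coord: "f \<in> hom_poly k \<Longrightarrow> b \<in> Basis \<Longrightarrow> (\<lambda>x. (x \<bullet> b) * f x) \<in> hom_poly (Suc k)"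
  by (simp add: hom_poly_def is_hom_poly.coord)

lemma hom_poly_induct [consumes 1, case_names const add coord]:
  assumes "f \<in> hom_poly k"
    and "\<And>a. P 0 (\<lambda>x. a)"
    and "\<And>k f g. f \<in> hom_poly k \<Longrightarrow> P k f \<Longrightarrow> g \<in> hom_poly k \<Longrightarrow> P k g \<Longrightarrow> P k (\<lambda>x. f x + g x)"
    and "\<And>k f b. f \<in> hom_poly k \<Longrightarrow> P k f \<Longrightarrow> b \<in> Basis \<Longrightarrow> P (Suc k) (\<lambda>x. (x \<bullet> b) * f x)"
  shows "P k f"
proof -
  have "is_hom_poly k f" using assms(1) by (simp add: hom_poly_def)
  then show ?thesis by induction (use assms(2-4) in \<open>auto simp: hom_poly_def\<close>)
qed

lemma hom_poly_scale: "f \<in> hom_poly k \<Longrightarrow> (\<lambda>x. a * f x) \<in> hom_poly k"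
proof (induction rule: hom_poly_induct)
  case (const c)
  show ?case by (rule hom_poly_const)
next
  case (add k f g)
  then show ?case using hom_poly_add by (fastforce simp: distrib_left)
next
  case (coord k f b)
  then show ?case using hom_poly_coord[of "\<lambda>x. a * f x" k b] by (simp add: mult.left_commute)
qed

lemma hom_poly_zero [simp]: "(\<lambda>x. 0) \<in> hom_poly k"
proof (induction k)
  case 0
  show ?case by (rule hom_poly_const)
next
  case (Suc k)
  have "(SOME b. b \<in> Basis) \<in> (Basis :: 'a set)" by (simp add: some_in_eq)
  then show ?case using hom_poly_coord[OF Suc] by simp
qed

lemma hom_poly_lincomb:
  "f \<in> hom_poly k \<Longrightarrow> g \<in> hom_poly k \<Longrightarrow> (\<lambda>x. a * f x + b * g x) \<in> hom_poly k"
  by (intro hom_poly_add hom_poly_scale)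

lemma hom_poly_sum:
  "finite I \<Longrightarrow> (\<And>i. i \<in> I \<Longrightarrow> f i \<in> hom_poly k) \<Longrightarrow> (\<lambda>x. \<Sum>i\<in>I. f i x) \<in> hom_poly k"
  by (induction I rule: finite_induct) (auto intro: hom_poly_add)

lemma hom_poly_mult:
  "f \<in> hom_poly k \<Longrightarrow> g \<in> hom_poly m \<Longrightarrow> (\<lambda>x. f x * g x) \<in> hom_poly (k + m)"
proof (induction rule: hom_poly_induct)
  case (const a)
  then show ?case using hom_poly_scale by auto
next
  case (add k f h)
  then show ?case using hom_poly_add by (fastforce simp: distrib_right)
next
  case (coord k f b)
  then show ?case using hom_poly_coord[of "\<lambda>x. f x * g x" "k + m" b] by (simp add: mult.assoc)
qed

lemma hom_poly_homogeneous: "f \<in> hom_poly k \<Longrightarrow> f (t *\<^sub>R x) = t ^ k * f x"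
  by (induction rule: hom_poly_induct) (auto simp: algebra_simps)

lemma hom_poly_continuous: "f \<in> hom_poly k \<Longrightarrow> continuous_on S f"
  by (induction rule: hom_poly_induct) (auto intro!: continuous_intros)

lemma hom_poly_radial:
  assumes "f \<in> hom_poly k"
  shows "(\<lambda>x. (x \<bullet> x) * f x) \<in> hom_poly (k + 2)"
proof -
  have "(\<lambda>x. \<Sum>b\<in>Basis. (x \<bullet> b) * ((x \<bullet> b) * f x)) \<in> hom_poly (Suc (Suc k))"
    using assms by (intro hom_poly_sum hom_poly_coord) auto
  then show ?thesis
    by (simp add: euclidean_inner[where 'a='a, of x x for x] sum_distrib_right mult.assoc)
qed

section \<open>Partial derivatives and the Laplacian\<close>

definition has_pd :: "'a::euclidean_space \<Rightarrow> ('a \<Rightarrow> real) \<Rightarrow> ('a \<Rightarrow> real) \<Rightarrow> bool" where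
  "has_pd b f g \<longleftrightarrow> (\<forall>x. ((\<lambda>t. f (x + t *\<^sub>R b)) has_real_derivative g x) (at 0))"

text \<open>As a total function \<open>pd\<close> carries no information about existence of the
  derivative. The calculus rules are therefore stated for \<open>has_pd\<close> and transferred by
  \<open>has_pd_imp_pd\<close>.\<close>

definition pd :: "'a::euclidean_space \<Rightarrow> ('a \<Rightarrow> real) \<Rightarrow> 'a \<Rightarrow> real" where
  "pd b f x = deriv (\<lambda>t. f (x + t *\<^sub>R b)) 0"

definition lap :: "('a::euclidean_space \<Rightarrow> real) \<Rightarrow> 'a \<Rightarrow> real" where
  "lap f x = (\<Sum>b\<in>Basis. pd b (pd b f) x)"

lemma has_pd_imp_pd: "has_pd b f g \<Longrightarrow> pd b f = g"
  by (auto simp: has_pd_def pd_def DERIV_imp_deriv)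

lemma has_pd_const: "has_pd b (\<lambda>x. c) (\<lambda>x. 0)"
  by (auto simp: has_pd_def)

lemma has_pd_add: "has_pd b f f' \<Longrightarrow> has_pd b g g' \<Longrightarrow> has_pd b (\<lambda>x. f x + g x) (\<lambda>x. f' x + g' x)"
  by (auto simp: has_pd_def intro: DERIV_add)

lemma has_pd_mult:
  "has_pd b f f' \<Longrightarrow> has_pd b g g' \<Longrightarrow> has_pd b (\<lambda>x. f x * g x) (\<lambda>x. f' x * g x + f x * g' x)"
  unfolding has_pd_def by (auto intro!: derivative_eq_intros)

lemma has_pd_scale: "has_pd b f f' \<Longrightarrow> has_pd b (\<lambda>x. c * f x) (\<lambda>x. c * f' x)"
  using has_pd_mult[OF has_pd_const[of b c]] by fastforce

lemma has_pd_sum: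
  "finite I \<Longrightarrow> (\<And>i. i \<in> I \<Longrightarrow> has_pd b (f i) (f' i)) \<Longrightarrow>
    has_pd b (\<lambda>x. \<Sum>i\<in>I. f i x) (\<lambda>x. \<Sum>i\<in>I. f' i x)"
  by (induction I rule: finite_induct) (auto intro: has_pd_add has_pd_const)

lemma has_pd_coord: "has_pd b (\<lambda>x. x \<bullet> c) (\<lambda>x. b \<bullet> c)"
  unfolding has_pd_def by (auto simp: inner_add_left intro!: derivative_eq_intros)

lemma has_pd_inner_self: "has_pd b (\<lambda>x. x \<bullet> x) (\<lambda>x. 2 * (x \<bullet> b))"
  unfolding has_pd_def
  by (auto simp: inner_add_left inner_add_right inner_commute intro!: derivative_eq_intros)

text \<open>Moves the derivative from parameter 0 to any point of the line through \<open>x\<close>,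
  in the form that the mean value theorem takes.\<close>

lemma has_pd_shift:
  assumes "has_pd b f g"
  shows "((\<lambda>t. f (x + t *\<^sub>R b)) has_real_derivative g (x + s *\<^sub>R b)) (at s)"
proof -
  have "((\<lambda>t. f ((x + s *\<^sub>R b) + t *\<^sub>R b)) has_real_derivative g (x + s *\<^sub>R b)) (at 0)"
    using assms by (auto simp: has_pd_def)
  then have "((\<lambda>t. f (x + (s + t) *\<^sub>R b)) has_real_derivative g (x + s *\<^sub>R b)) (at 0)"
    by (simp add: algebra_simps)
  then show ?thesis
    using DERIV_at_within_shift[of "\<lambda>t. f (x + t *\<^sub>R b)" "g (x + s *\<^sub>R b)" s 0 UNIV] by simp
qed

text \<open>The degree \<open>k - 1\<close> truncates at \<open>k = 0\<close>. The last conjunct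
  covers that case; in the coordinate step it keeps \<open>(x \<bullet> c) * f' x\<close> in degree
  \<open>k\<close> when \<open>k = 0\<close>.\<close>

lemma hom_poly_has_pd_ex:
  "f \<in> hom_poly k \<Longrightarrow> b \<in> Basis \<Longrightarrow>
    \<exists>g \<in> hom_poly (k - 1). has_pd b f g \<and> (k = 0 \<longrightarrow> g = (\<lambda>x. 0))"
proof (induction rule: hom_poly_induct)
  case (const a)
  show ?case using has_pd_const hom_poly_const by (intro bexI[of _ "\<lambda>x. 0"]) auto
next
  case (add k f g)
  then obtain f' g' where "f' \<in> hom_poly (k - 1)" "has_pd b f f'" "k = 0 \<longrightarrow> f' = (\<lambda>x. 0)"
    "g' \<in> hom_poly (k - 1)" "has_pd b g g'" "k = 0 \<longrightarrow> g' = (\<lambda>x. 0)" by blast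
  then show ?case by (intro bexI[of _ "\<lambda>x. f' x + g' x"]) (auto intro: has_pd_add hom_poly_add)
next
  case (coord k f c)
  then obtain f' where f': "f' \<in> hom_poly (k - 1)" "has_pd b f f'" "k = 0 \<longrightarrow> f' = (\<lambda>x. 0)" by blast
  have "(\<lambda>x. (x \<bullet> c) * f' x) \<in> hom_poly k"
    using f' hom_poly_coord[OF f'(1) coord(2)] by (cases "k = 0") auto
  then have "(\<lambda>x. (b \<bullet> c) * f x + (x \<bullet> c) * f' x) \<in> hom_poly k"
    using coord.hyps by (intro hom_poly_add hom_poly_scale)
  then show ?case using has_pd_mult[OF has_pd_coord[of b c] f'(2)] by auto
qed

lemma hom_poly_has_pd: "f \<in> hom_poly k \<Longrightarrow> b \<in> Basis \<Longrightarrow> has_pd b f (pd b f)"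
  using hom_poly_has_pd_ex[of f k b] has_pd_imp_pd[of b f] by metis

lemma hom_poly_pd: "f \<in> hom_poly k \<Longrightarrow> b \<in> Basis \<Longrightarrow> pd b f \<in> hom_poly (k - 1)"
  using hom_poly_has_pd_ex[of f k b] has_pd_imp_pd[of b f] by metis

lemma hom_poly_0_pd: "f \<in> hom_poly 0 \<Longrightarrow> b \<in> Basis \<Longrightarrow> pd b f = (\<lambda>x. 0)"
  using hom_poly_has_pd_ex[of f 0 b] by (auto dest: has_pd_imp_pd)

lemma Euler_hom_poly:
  "f \<in> hom_poly k \<Longrightarrow> (\<Sum>b\<in>Basis. (x \<bullet> b) * pd b f x) = real k * f x"
proof (induction rule: hom_poly_induct)
  case (const a)
  then show ?case by (simp add: hom_poly_0_pd hom_poly_const)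
next
  case (add k f g)
  have "pd b (\<lambda>x. f x + g x) x = pd b f x + pd b g x" if "b \<in> Basis" for b
    using has_pd_imp_pd[OF has_pd_add] hom_poly_has_pd that add.hyps by metis
  then show ?case using add.IH by (simp add: distrib_left sum.distrib)
next
  case (coord k f c)
  have "pd b (\<lambda>x. (x \<bullet> c) * f x) x = (b \<bullet> c) * f x + (x \<bullet> c) * pd b f x" if "b \<in> Basis" for b
    using has_pd_imp_pd[OF has_pd_mult[OF has_pd_coord hom_poly_has_pd[OF coord.hyps(1) that]]]
    by metis
  then have "(\<Sum>b\<in>Basis. (x \<bullet> b) * pd b (\<lambda>x. (x \<bullet> c) * f x) x)
      = (\<Sum>b\<in>Basis. (x \<bullet> b) * (b \<bullet> c)) * f x + (x \<bullet> c) * (\<Sum>b\<in>Basis. (x \<bullet> b) * pd b f x)"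
    by (simp add: distrib_left sum.distrib sum_distrib_left sum_distrib_right mult_ac)
  also have "(\<Sum>b\<in>Basis. (x \<bullet> b) * (b \<bullet> c)) = x \<bullet> c"
    by (subst euclidean_inner[of x c]) (simp add: inner_commute)
  finally show ?case using coord.IH by (simp add: algebra_simps)
qed

lemma lap_hom_poly:
  assumes "f \<in> hom_poly k"
  shows "lap f \<in> hom_poly (k - 2)"
  unfolding lap_def[abs_def]
  using hom_poly_pd[OF hom_poly_pd[OF assms]] by (intro hom_poly_sum) (auto simp: numeral_2_eq_2)

lemma lap_low_degree:
  assumes "f \<in> hom_poly k" "k < 2"
  shows "lap f x = 0"
proof -
  have "pd b f \<in> hom_poly 0" if "b \<in> Basis" for b
    using hom_poly_pd[OF assms(1) that] assms(2) by (cases k) auto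
  then show ?thesis by (simp add: lap_def hom_poly_0_pd)
qed

lemma lap_lincomb:
  assumes "f \<in> hom_poly k" "g \<in> hom_poly m"
  shows "lap (\<lambda>x. a * f x + c * g x) x = a * lap f x + c * lap g x"
proof -
  have "pd b (pd b (\<lambda>x. a * f x + c * g x)) = (\<lambda>x. a * pd b (pd b f) x + c * pd b (pd b g) x)"
    if b: "b \<in> Basis" for b
  proof -
    note 1 = hom_poly_has_pd[OF assms(1) b] hom_poly_has_pd[OF assms(2) b]
    note 2 = hom_poly_has_pd[OF hom_poly_pd[OF assms(1) b] b]
      hom_poly_has_pd[OF hom_poly_pd[OF assms(2) b] b]
    have "pd b (\<lambda>x. a * f x + c * g x) = (\<lambda>x. a * pd b f x + c * pd b g x)"
      using 1 by (intro has_pd_imp_pd has_pd_add has_pd_scale)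
    moreover have "pd b (\<lambda>x. a * pd b f x + c * pd b g x) = (\<lambda>x. a * pd b (pd b f) x + c * pd b (pd b g) x)"
      using 2 by (intro has_pd_imp_pd has_pd_add has_pd_scale)
    ultimately show ?thesis by simp
  qed
  then show ?thesis by (simp add: lap_def sum.distrib sum_distrib_left)
qed

text \<open>The product rule leaves the cross terms \<open>4 * ((x \<bullet> b) * pd b f x)\<close>,
  whose sum is \<open>4 k f\<close> by Euler's identity; the second derivatives of |x|^2 contribute
  \<open>2 * DIM('a)\<close>.\<close>

lemma lap_radial:
  fixes f :: "'a::euclidean_space \<Rightarrow> real"
  assumes f: "f \<in> hom_poly k"
  shows "lap (\<lambda>x. (x \<bullet> x) * f x) x = (2 * real DIM('a) + 4 * real k) * f x + (x \<bullet> x) * lap f x"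
proof -
  have "pd b (pd b (\<lambda>x. (x \<bullet> x) * f x)) x = 2 * f x + 4 * ((x \<bullet> b) * pd b f x) + (x \<bullet> x) * pd b (pd b f) x"
    if b: "b \<in> Basis" for b
  proof -
    have 1: "pd b (\<lambda>x. (x \<bullet> x) * f x) = (\<lambda>x. 2 * (x \<bullet> b) * f x + (x \<bullet> x) * pd b f x)"
      using f b by (intro has_pd_imp_pd has_pd_mult has_pd_inner_self hom_poly_has_pd)
    have "has_pd b (\<lambda>x. 2 * (x \<bullet> b) * f x + (x \<bullet> x) * pd b f x)
       (\<lambda>x. (2 * (b \<bullet> b) * f x + 2 * (x \<bullet> b) * pd b f x) +
            (2 * (x \<bullet> b) * pd b f x + (x \<bullet> x) * pd b (pd b f) x))"
      using f b by (intro has_pd_add has_pd_mult has_pd_scale has_pd_coord has_pd_inner_self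
          hom_poly_has_pd[OF f] hom_poly_has_pd[OF hom_poly_pd[OF f]])
    from has_pd_imp_pd[OF this] show ?thesis
      unfolding 1 using b by (simp add: inner_same_Basis algebra_simps)
  qed
  then have "lap (\<lambda>x. (x \<bullet> x) * f x) x = 2 * real DIM('a) * f x
      + 4 * (\<Sum>b\<in>Basis. (x \<bullet> b) * pd b f x) + (x \<bullet> x) * lap f x"
    by (simp add: lap_def sum.distrib sum_distrib_left)
  then show ?thesis using Euler_hom_poly[OF f] by (simp add: algebra_simps)
qed

text \<open>Solving for $r$ gives $r = (q - |x|^2 s)/(2D + 4k + c)$ where $s = \Delta r$ satisfies an
  equation of the same shape in degree $k - 2$, with a larger constant.\<close>
lemma lap_radial_surjective:
  fixes q :: "'a::euclidean_space \<Rightarrow> real"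
  assumes "q \<in> hom_poly k" "c \<ge> 0"
  shows "\<exists>r \<in> hom_poly k. \<forall>x. lap (\<lambda>x. (x \<bullet> x) * r x) x + c * r x = q x"
  using assms
proof (induction k arbitrary: q c rule: less_induct)
  case (less k)
  \<comment> \<open>By \<open>lap_radial\<close> the equation for \<open>r\<close> reads
    \<open>C * r x + (x \<bullet> x) * lap r x = q x\<close>; in degrees below 2 the Laplacian
    vanishes and \<open>s = 0\<close> serves.\<close>
  define C where "C = 2 * real DIM('a) + 4 * real k + c"
  have C: "C > 0" using less.prems DIM_positive[where 'a='a] by (simp add: C_def add_pos_nonneg)
  have "\<exists>s. (\<lambda>x. (x \<bullet> x) * s x) \<in> hom_poly k \<and>
      (\<forall>x. lap (\<lambda>x. (x \<bullet> x) * s x) x + C * s x = lap q x)"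
  proof (cases "k < 2")
    case True
    then show ?thesis using lap_low_degree[OF less.prems(1)]
      by (intro exI[of _ "\<lambda>x. 0"]) (auto simp: lap_low_degree[of "\<lambda>x. 0" 0])
  next
    case False
    then have "k - 2 < k" by simp
    from less.IH[OF this lap_hom_poly[OF less.prems(1)], of C] C
    obtain s where "s \<in> hom_poly (k - 2)" "\<forall>x. lap (\<lambda>x. (x \<bullet> x) * s x) x + C * s x = lap q x"
      by auto
    then show ?thesis using hom_poly_radial[of s "k - 2"] False
      by (intro exI[of _ s]) (simp add: numeral_2_eq_2 Suc_diff_Suc)
  qed
  then obtain s where s: "(\<lambda>x. (x \<bullet> x) * s x) \<in> hom_poly k"
    "\<And>x. lap (\<lambda>x. (x \<bullet> x) * s x) x + C * s x = lap q x" by auto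
  define r where "r = (\<lambda>x. (1 / C) * q x + (- 1 / C) * ((x \<bullet> x) * s x))"
  have r: "r \<in> hom_poly k" unfolding r_def using less.prems(1) s(1) by (rule hom_poly_lincomb)
  have "lap r x = s x" for x
  proof -
    have "lap r x = (1 / C) * lap q x + (- 1 / C) * lap (\<lambda>x. (x \<bullet> x) * s x) x"
      unfolding r_def by (rule lap_lincomb[OF less.prems(1) s(1)])
    also have "\<dots> = s x" using s(2)[of x, symmetric] C by (simp add: divide_simps)
    finally show ?thesis .
  qed
  then have "lap (\<lambda>x. (x \<bullet> x) * r x) x + c * r x = C * r x + (x \<bullet> x) * s x" for x
    using lap_radial[OF r, of x] by (simp add: C_def algebra_simps)
  also have "C * r x + (x \<bullet> x) * s x = q x" for x using C by (simp add: r_def field_simps)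
  finally show ?case using r by blast
qed

section \<open>Harmonic polynomials and their restrictions to the sphere\<close>

definition harmonics :: "nat \<Rightarrow> ('a::euclidean_space \<Rightarrow> real) set" where
  "harmonics l = {f \<in> hom_poly l. \<forall>x. lap f x = 0}"

lemma harmonics_zero [simp]: "(\<lambda>x. 0) \<in> harmonics l"
  by (simp add: harmonics_def lap_low_degree[of "\<lambda>x. 0" 0])

lemma harmonics_lincomb:
  assumes "f \<in> harmonics l" "g \<in> harmonics l"
  shows "(\<lambda>x. a * f x + b * g x) \<in> harmonics l"
proof -
  have "f \<in> hom_poly l" "g \<in> hom_poly l" using assms by (auto simp: harmonics_def)
  from hom_poly_lincomb[OF this] lap_lincomb[OF this] show ?thesis
    using assms by (simp add: harmonics_def)
qed

lemma harmonics_subspace: "fun_subspace (harmonics l)"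
  by (intro fun_subspaceI harmonics_zero harmonics_lincomb)

text \<open>One step of the Fischer decomposition: \<open>r\<close> is chosen such that |x|^2 r has
  the same Laplacian as \<open>f\<close>, which is the case \<open>c = 0\<close> of
  \<open>lap_radial_surjective\<close>.\<close>

lemma hom_poly_decomposition:
  assumes "f \<in> hom_poly (k + 2)"
  obtains h r where "h \<in> harmonics (k + 2)" "r \<in> hom_poly k" "\<And>x. f x = h x + (x \<bullet> x) * r x"
proof -
  obtain r where r: "r \<in> hom_poly k" "\<And>x. lap (\<lambda>x. (x \<bullet> x) * r x) x = lap f x"
    using lap_radial_surjective[of "lap f" k 0] lap_hom_poly[OF assms] by auto
  define h where "h = (\<lambda>x. 1 * f x + (- 1) * ((x \<bullet> x) * r x))"
  have "h \<in> harmonics (k + 2)"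
    unfolding harmonics_def h_def using lap_lincomb[OF assms hom_poly_radial[OF r(1)], of 1 "-1"]
      hom_poly_lincomb[OF assms hom_poly_radial[OF r(1)], of 1 "-1"] r(2) by simp
  then show thesis using r(1) by (intro that[of h r]) (auto simp: h_def)
qed

text \<open>The space V_k of the overview, as functions on the whole Euclidean space.\<close>

definition harmonics_upto :: "nat \<Rightarrow> ('a::euclidean_space \<Rightarrow> real) set" where
  "harmonics_upto k = {f. \<exists>h. (\<forall>l. h l \<in> harmonics l) \<and> f = (\<lambda>x. \<Sum>l\<le>k. h l x)}"

lemma harmonics_upto_lincomb:
  assumes "f \<in> harmonics_upto k" "g \<in> harmonics_upto k"
  shows "(\<lambda>x. a * f x + b * g x) \<in> harmonics_upto k"
proof -
  from assms obtain u v where "\<And>l. u l \<in> harmonics l" "f = (\<lambda>x. \<Sum>l\<le>k. u l x)"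
    "\<And>l. v l \<in> harmonics l" "g = (\<lambda>x. \<Sum>l\<le>k. v l x)" by (auto simp: harmonics_upto_def)
  then show ?thesis unfolding harmonics_upto_def
    by (auto intro!: exI[of _ "\<lambda>l x. a * u l x + b * v l x"] harmonics_lincomb
        simp: sum.distrib sum_distrib_left)
qed

lemma harmonics_upto_mono:
  assumes "f \<in> harmonics_upto k" "k \<le> m"
  shows "f \<in> harmonics_upto m"
proof -
  from assms obtain u where u: "\<And>l. u l \<in> harmonics l" "f = (\<lambda>x. \<Sum>l\<le>k. u l x)"
    by (auto simp: harmonics_upto_def)
  have "(\<Sum>l\<le>k. u l x) = (\<Sum>l\<le>m. if l \<le> k then u l x else 0)" for x
    using assms(2) by (intro sum.mono_neutral_cong_left) auto
  then show ?thesis unfolding harmonics_upto_def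
    using u by (auto intro!: exI[of _ "\<lambda>l. if l \<le> k then u l else (\<lambda>x. 0)"] simp: if_distrib[of "\<lambda>f. f _"])
qed

lemma harmonics_in_harmonics_upto:
  assumes "f \<in> harmonics k"
  shows "f \<in> harmonics_upto k"
  unfolding harmonics_upto_def using assms
  by (auto intro!: exI[of _ "\<lambda>l. if l = k then f else (\<lambda>x. 0)"] simp: if_distrib[of "\<lambda>f. f _"])

lemma harmonics_upto_zero [simp]: "(\<lambda>x. 0) \<in> harmonics_upto k"
  using harmonics_upto_mono[OF harmonics_in_harmonics_upto[of "\<lambda>x. 0" 0], of k] by simp

lemma harmonics_upto_subspace: "fun_subspace (harmonics_upto k)"
  by (intro fun_subspaceI harmonics_upto_zero harmonics_upto_lincomb)

text \<open>On the sphere the factor |x|^2 is 1, so the decomposition can be iterated down to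
  degrees 0 and 1, in which every polynomial is harmonic.\<close>

lemma hom_poly_on_sphere:
  assumes "f \<in> hom_poly k"
  shows "\<exists>v \<in> harmonics_upto k. \<forall>x \<in> sphere 0 1. f x = v x"
  using assms
proof (induction k arbitrary: f rule: less_induct)
  case (less k)
  show ?case
  proof (cases "k < 2")
    case True
    then have "f \<in> harmonics k" using less.prems lap_low_degree by (auto simp: harmonics_def)
    then show ?thesis using harmonics_in_harmonics_upto by blast
  next
    case False
    then obtain j where j: "k = j + 2" by (metis le_add_diff_inverse2 not_less)
    from hom_poly_decomposition less.prems obtain h r
      where h: "h \<in> harmonics k" "r \<in> hom_poly j" "\<And>x. f x = h x + (x \<bullet> x) * r x"
      unfolding j by blast
    obtain v where v: "v \<in> harmonics_upto j" "\<forall>x \<in> sphere 0 1. r x = v x"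
      using less.IH[OF _ h(2)] j by auto
    have "(\<lambda>x. 1 * h x + 1 * v x) \<in> harmonics_upto k"
      using harmonics_in_harmonics_upto[OF h(1)] harmonics_upto_mono[OF v(1), of k] j
      by (intro harmonics_upto_lincomb) auto
    moreover have "\<forall>x \<in> sphere 0 1. f x = 1 * h x + 1 * v x"
      using h(3) v(2) by (auto simp: power2_norm_eq_inner[symmetric])
    ultimately show ?thesis by (intro bexI[of _ "\<lambda>x. 1 * h x + 1 * v x"])
  qed
qed

text \<open>Multiplying by powers of $|x|^2$, every spherical polynomial of degree at most $k$ is the
  restriction of a homogeneous one of degree $k$ plus a homogeneous one of degree $k - 1$.\<close>
lemma hom_poly_raise:
  "f \<in> hom_poly l \<Longrightarrow> \<exists>g \<in> hom_poly (l + 2 * j). \<forall>x \<in> sphere 0 1. f x = g x"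
proof (induction j)
  case (Suc j)
  then obtain g where g: "g \<in> hom_poly (l + 2 * j)" "\<forall>x \<in> sphere 0 1. f x = g x" by auto
  then have "(\<lambda>x. (x \<bullet> x) * g x) \<in> hom_poly (l + 2 * Suc j)"
    using hom_poly_radial by fastforce
  then show ?case using g(2)
    by (intro bexI[of _ "\<lambda>x. (x \<bullet> x) * g x"]) (auto simp: power2_norm_eq_inner[symmetric])
qed auto

text \<open>Raising changes the degree by an even number, so the parity of \<open>l\<close> decides
  between \<open>p\<close> and \<open>q\<close>. This is the spanning half of the dimension
  count.\<close>

lemma harmonics_upto_two_degrees:
  assumes "f \<in> harmonics_upto (Suc k)"
  shows "\<exists>p \<in> hom_poly (Suc k). \<exists>q \<in> hom_poly k. \<forall>x \<in> sphere 0 1. f x = p x + q x"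
proof -
  from assms obtain h where h: "\<And>l. h l \<in> harmonics l" "f = (\<lambda>x. \<Sum>l\<le>Suc k. h l x)"
    by (auto simp: harmonics_upto_def)
  have "\<exists>p q. p \<in> hom_poly (Suc k) \<and> q \<in> hom_poly k \<and> (\<forall>x \<in> sphere 0 1. h l x = p x + q x)"
    if l: "l \<le> Suc k" for l
  proof (cases "even (Suc k - l)")
    case True
    then obtain j where "Suc k = l + 2 * j" using l by (metis evenE le_add_diff_inverse)
    then obtain p where "p \<in> hom_poly (Suc k)" "\<forall>x \<in> sphere 0 1. h l x = p x"
      using hom_poly_raise[of "h l" l j] h(1)[of l] by (auto simp: harmonics_def)
    then show ?thesis by (intro exI[of _ p] exI[of _ "\<lambda>x. 0"]) auto
  next
    case False
    then obtain j where "Suc k - l = 2 * j + 1" using oddE by blast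
    then have "k = l + 2 * j" using l by auto
    then obtain q where "q \<in> hom_poly k" "\<forall>x \<in> sphere 0 1. h l x = q x"
      using hom_poly_raise[of "h l" l j] h(1)[of l] by (auto simp: harmonics_def)
    then show ?thesis by (intro exI[of _ "\<lambda>x. 0"] exI[of _ q]) auto
  qed
  then obtain p q where "\<And>l. l \<le> Suc k \<Longrightarrow> p l \<in> hom_poly (Suc k)"
    "\<And>l. l \<le> Suc k \<Longrightarrow> q l \<in> hom_poly k"
    "\<And>l x. l \<le> Suc k \<Longrightarrow> x \<in> sphere 0 1 \<Longrightarrow> h l x = p l x + q l x" by metis
  then show ?thesis
    by (intro bexI[of _ "\<lambda>x. \<Sum>l\<le>Suc k. p l x"] bexI[of _ "\<lambda>x. \<Sum>l\<le>Suc k. q l x"])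
      (auto simp: h(2) sum.distrib[symmetric] simp del: sum.atMost_Suc intro!: sum.cong hom_poly_sum)
qed

section \<open>Coefficients of homogeneous polynomials\<close>

definition mono_eval :: "('a::euclidean_space \<Rightarrow> nat) \<Rightarrow> 'a \<Rightarrow> real" where
  "mono_eval \<alpha> x = (\<Prod>b\<in>Basis. (x \<bullet> b) ^ \<alpha> b)"

definition exponents :: "nat \<Rightarrow> ('a::euclidean_space \<Rightarrow> nat) set" where
  "exponents k = {\<alpha>. (\<forall>i. i \<notin> Basis \<longrightarrow> \<alpha> i = 0) \<and> (\<Sum>b\<in>Basis. \<alpha> b) = k}"

lemma finite_exponents [simp]: "finite (exponents k :: ('a::euclidean_space \<Rightarrow> nat) set)"
proof (rule finite_subset)
  show "exponents k \<subseteq> {\<alpha> :: 'a \<Rightarrow> nat. \<forall>i. (i \<in> Basis \<longrightarrow> \<alpha> i \<in> {..k}) \<and> (i \<notin> Basis \<longrightarrow> \<alpha> i = 0)}"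
    by (auto simp: exponents_def intro: member_le_sum)
  show "finite {\<alpha> :: 'a \<Rightarrow> nat. \<forall>i. (i \<in> Basis \<longrightarrow> \<alpha> i \<in> {..k}) \<and> (i \<notin> Basis \<longrightarrow> \<alpha> i = 0)}"
    by (rule finite_set_of_finite_funs) auto
qed

lemma exponents_Suc_update:
  assumes "b \<in> Basis"
  shows "\<alpha>(b := Suc (\<alpha> b)) \<in> exponents (Suc k) \<longleftrightarrow> \<alpha> \<in> exponents k"
proof -
  have "(\<Sum>i\<in>Basis. (\<alpha>(b := Suc (\<alpha> b))) i) = Suc (\<Sum>i\<in>Basis. \<alpha> i)"
    using assms by (simp add: sum.remove[of _ b] cong: sum.cong_simp)
  then show ?thesis using assms by (auto simp: exponents_def)
qed

lemma exponents_0: "exponents 0 = {\<lambda>_. 0}"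
  by (auto simp: exponents_def)

lemma mono_eval_Suc_update:
  assumes "b \<in> Basis"
  shows "mono_eval (\<alpha>(b := Suc (\<alpha> b))) x = (x \<bullet> b) * mono_eval \<alpha> x"
  using assms by (simp add: mono_eval_def prod.remove[of _ b] cong: prod.cong_simp)

lemma poly_eval_exponents:
  assumes "\<And>\<alpha>. c \<alpha> \<noteq> 0 \<Longrightarrow> \<alpha> \<in> exponents k"
  shows "poly_eval c x = (\<Sum>\<alpha>\<in>exponents k. c \<alpha> * mono_eval \<alpha> x)"
  unfolding poly_eval_def mono_eval_def
  by (intro sum.mono_neutral_left) (use assms in auto)

lemma mono_eval_hom_poly: "\<alpha> \<in> exponents k \<Longrightarrow> mono_eval \<alpha> \<in> hom_poly k"
proof (induction k arbitrary: \<alpha>)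
  case 0
  then show ?case by (simp add: exponents_0 mono_eval_def[abs_def] hom_poly_const)
next
  case (Suc k)
  then have "(\<Sum>b\<in>Basis. \<alpha> b) \<noteq> 0" by (simp add: exponents_def)
  then obtain b where b: "b \<in> Basis" "\<alpha> b \<noteq> 0" by (meson sum.neutral)
  define \<beta> where "\<beta> = \<alpha>(b := \<alpha> b - 1)"
  have \<alpha>: "\<alpha> = \<beta>(b := Suc (\<beta> b))" using b by (auto simp: \<beta>_def)
  have "\<beta> \<in> exponents k" using Suc.prems exponents_Suc_update[OF b(1), of \<beta> k] unfolding \<alpha>[symmetric] by simp
  from hom_poly_coord[OF Suc.IH[OF this] b(1)] show ?case
    by (subst \<alpha>) (simp add: mono_eval_Suc_update[OF b(1), abs_def])
qed

lemma hom_poly_eq_poly_eval: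
  "f \<in> hom_poly k \<Longrightarrow> \<exists>c. (\<forall>\<alpha>. c \<alpha> \<noteq> 0 \<longrightarrow> \<alpha> \<in> exponents k) \<and> f = poly_eval c"
proof (induction rule: hom_poly_induct)
  case (const a)
  let ?c = "\<lambda>\<alpha>. if \<alpha> = (\<lambda>_. 0) then a else 0"
  have c: "\<alpha> \<in> exponents 0" if "?c \<alpha> \<noteq> 0" for \<alpha> :: "'a \<Rightarrow> nat"
    using that by (auto simp: exponents_0 split: if_splits)
  have "(\<lambda>x. a) = poly_eval ?c"
    by (rule ext, subst poly_eval_exponents[of _ 0]) (auto simp: exponents_0 mono_eval_def split: if_splits)
  then show ?case using c by (intro exI[of _ ?c] conjI allI impI)
next
  case (add k f g)
  then obtain c c' where c: "\<forall>\<alpha>. c \<alpha> \<noteq> 0 \<longrightarrow> \<alpha> \<in> exponents k" "f = poly_eval c"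
    "\<forall>\<alpha>. c' \<alpha> \<noteq> 0 \<longrightarrow> \<alpha> \<in> exponents k" "g = poly_eval c'" by auto
  have d: "\<alpha> \<in> exponents k" if "c \<alpha> + c' \<alpha> \<noteq> 0" for \<alpha>
    using that c by (metis add.right_neutral)
  have "f x + g x = poly_eval (\<lambda>\<alpha>. c \<alpha> + c' \<alpha>) x" for x
    unfolding c(2,4) using poly_eval_exponents[of c k x] poly_eval_exponents[of c' k x] c
      poly_eval_exponents[of "\<lambda>\<alpha>. c \<alpha> + c' \<alpha>" k x] d
    by (simp add: distrib_right sum.distrib)
  then show ?case using d by (intro exI[of _ "\<lambda>\<alpha>. c \<alpha> + c' \<alpha>"]) auto
next
  case (coord k f b)
  then obtain c where c: "\<And>\<alpha>. c \<alpha> \<noteq> 0 \<Longrightarrow> \<alpha> \<in> exponents k" "f = poly_eval c" by auto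
  \<comment> \<open>Shifts the coefficients by the unit exponent at \<open>b\<close>; monomials
    without a factor \<open>x \<bullet> b\<close> receive 0, and these are the terms missed by the
    reindexing below.\<close>
  define c' where "c' \<alpha> = (if \<alpha> b = 0 then 0 else c (\<alpha>(b := \<alpha> b - 1)))" for \<alpha>
  have pred: "(\<alpha>(b := \<alpha> b - 1))(b := Suc ((\<alpha>(b := \<alpha> b - 1)) b)) = \<alpha>" if "\<alpha> b \<noteq> 0" for \<alpha> :: "'a \<Rightarrow> nat"
    using that by auto
  have d: "\<alpha> \<in> exponents (Suc k)" if "c' \<alpha> \<noteq> 0" for \<alpha>
  proof -
    have n: "\<alpha> b \<noteq> 0" "c (\<alpha>(b := \<alpha> b - 1)) \<noteq> 0" using that by (auto simp: c'_def split: if_splits)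
    then show ?thesis
      using c(1) exponents_Suc_update[OF coord.hyps(2), of "\<alpha>(b := \<alpha> b - 1)" k] unfolding pred[of \<alpha>, OF n(1)] by simp
  qed
  have "(x \<bullet> b) * f x = poly_eval c' x" for x
  proof -
    have "(x \<bullet> b) * f x = (\<Sum>\<alpha>\<in>exponents k. c \<alpha> * mono_eval (\<alpha>(b := Suc (\<alpha> b))) x)"
      unfolding c(2) using c(1) mono_eval_Suc_update[OF coord.hyps(2)]
      by (simp add: poly_eval_exponents[of c k] sum_distrib_left mult_ac)
    also have "\<dots> = (\<Sum>\<alpha>\<in>exponents (Suc k). c' \<alpha> * mono_eval \<alpha> x)"
    proof (rule sum.reindex_bij_witness_not_neutral[where S' = "{}" and T' = "{\<alpha> \<in> exponents (Suc k). \<alpha> b = 0}"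
          and j = "\<lambda>\<alpha>. \<alpha>(b := Suc (\<alpha> b))" and i = "\<lambda>\<alpha>. \<alpha>(b := \<alpha> b - 1)"])
      show "\<alpha>(b := \<alpha> b - 1) \<in> exponents k - {}"
        if "\<alpha> \<in> exponents (Suc k) - {\<alpha> \<in> exponents (Suc k). \<alpha> b = 0}" for \<alpha>
      proof -
        have "\<alpha> b \<noteq> 0" "\<alpha> \<in> exponents (Suc k)" using that by auto
        then show ?thesis
          using exponents_Suc_update[OF coord.hyps(2), of "\<alpha>(b := \<alpha> b - 1)" k] unfolding pred[of \<alpha>, OF \<open>\<alpha> b \<noteq> 0\<close>] by simp
      qed
    qed (auto simp: c'_def exponents_Suc_update[OF coord.hyps(2)])
    finally show ?thesis using poly_eval_exponents[of c' "Suc k" x] d by simp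
  qed
  then show ?case using d by (intro exI[of _ c']) auto
qed

text \<open>Coefficients of the partial derivative along \<open>b\<close>. Applied twice and summed
  over \<open>Basis\<close> it gives the expression in \<open>harmonic_homog_poly\<close>.\<close>

definition dcoeff :: "'a::euclidean_space \<Rightarrow> (('a \<Rightarrow> nat) \<Rightarrow> real) \<Rightarrow> ('a \<Rightarrow> nat) \<Rightarrow> real" where
  "dcoeff b c \<beta> = real (Suc (\<beta> b)) * c (\<beta>(b := Suc (\<beta> b)))"

lemma dcoeff_exponents:
  assumes "b \<in> Basis" "\<And>\<alpha>. c \<alpha> \<noteq> 0 \<Longrightarrow> \<alpha> \<in> exponents k" "dcoeff b c \<beta> \<noteq> 0"
  shows "k \<noteq> 0" "\<beta> \<in> exponents (k - 1)"
proof -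
  have *: "\<beta>(b := Suc (\<beta> b)) \<in> exponents k" using assms(2,3) by (auto simp: dcoeff_def)
  then show "k \<noteq> 0" by (cases k) (simp_all add: exponents_0, metis fun_upd_same nat.distinct(1))
  then show "\<beta> \<in> exponents (k - 1)" using * exponents_Suc_update[OF assms(1), of \<beta> "k - 1"] by simp
qed

lemma has_pd_mono_eval:
  assumes "b \<in> Basis"
  shows "has_pd b (mono_eval \<alpha>) (\<lambda>x. real (\<alpha> b) * mono_eval (\<alpha>(b := \<alpha> b - 1)) x)"
proof -
  define R where "R x = (\<Prod>i\<in>Basis - {b}. (x \<bullet> i) ^ \<alpha> i)" for x :: 'a
  have m: "mono_eval \<alpha> x = (x \<bullet> b) ^ \<alpha> b * R x"
    "mono_eval (\<alpha>(b := \<alpha> b - 1)) x = (x \<bullet> b) ^ (\<alpha> b - 1) * R x" for x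
    using assms by (simp_all add: mono_eval_def R_def prod.remove[of _ b] cong: prod.cong_simp)
  have R: "R (x + t *\<^sub>R b) = R x" for x t
    using assms unfolding R_def by (intro prod.cong) (auto simp: inner_add_left inner_not_same_Basis)
  show ?thesis
    using assms unfolding has_pd_def m R
    by (auto simp: inner_add_left intro!: derivative_eq_intros)
qed

lemma has_pd_poly_eval:
  fixes b :: "'a::euclidean_space"
  assumes b: "b \<in> Basis" and c: "\<And>\<alpha>. c \<alpha> \<noteq> 0 \<Longrightarrow> \<alpha> \<in> exponents k"
  shows "has_pd b (poly_eval c) (poly_eval (dcoeff b c))"
proof -
  have "has_pd b (\<lambda>x. \<Sum>\<alpha>\<in>exponents k. c \<alpha> * mono_eval \<alpha> x)
     (\<lambda>x. \<Sum>\<alpha>\<in>exponents k. c \<alpha> * (real (\<alpha> b) * mono_eval (\<alpha>(b := \<alpha> b - 1)) x))"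
    using b by (intro has_pd_sum has_pd_scale has_pd_mono_eval) auto
  moreover have "(\<Sum>\<alpha>\<in>exponents k. c \<alpha> * (real (\<alpha> b) * mono_eval (\<alpha>(b := \<alpha> b - 1)) x))
      = (\<Sum>\<beta>\<in>exponents (k - 1). dcoeff b c \<beta> * mono_eval \<beta> x)" for x
  proof -
    let ?S = "{\<alpha> \<in> exponents k. \<alpha> b \<noteq> 0}"
    let ?T = "{\<beta> \<in> exponents (k - 1). \<beta>(b := Suc (\<beta> b)) \<in> exponents k}"
    have pred: "\<alpha>(b := \<alpha> b - 1) \<in> ?T" if \<alpha>: "\<alpha> \<in> ?S" for \<alpha>
    proof -
      obtain k' where k: "k = Suc k'" using \<alpha> by (cases k) (auto simp: exponents_0)
      define \<beta> where "\<beta> = \<alpha>(b := \<alpha> b - 1)"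
      have eq: "\<beta>(b := Suc (\<beta> b)) = \<alpha>" using \<alpha> by (auto simp: \<beta>_def)
      then have "\<beta> \<in> exponents k'" using \<alpha> exponents_Suc_update[OF b, of \<beta> k'] k by simp
      then have "\<beta> \<in> ?T" using eq \<alpha> k by simp
      then show ?thesis by (simp only: \<beta>_def)
    qed
    have "(\<Sum>\<alpha>\<in>exponents k. c \<alpha> * (real (\<alpha> b) * mono_eval (\<alpha>(b := \<alpha> b - 1)) x))
        = (\<Sum>\<alpha>\<in>?S. c \<alpha> * (real (\<alpha> b) * mono_eval (\<alpha>(b := \<alpha> b - 1)) x))"
      by (intro sum.mono_neutral_right) auto
    also have "\<dots> = (\<Sum>\<beta>\<in>?T. dcoeff b c \<beta> * mono_eval \<beta> x)"
      by (rule sum.reindex_bij_witness[where i = "\<lambda>\<alpha>. \<alpha>(b := Suc (\<alpha> b))" and j = "\<lambda>\<alpha>. \<alpha>(b := \<alpha> b - 1)"])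
        (use pred in \<open>auto simp: dcoeff_def\<close>)
    also have "\<dots> = (\<Sum>\<beta>\<in>exponents (k - 1). dcoeff b c \<beta> * mono_eval \<beta> x)"
      by (intro sum.mono_neutral_left) (use c in \<open>auto simp: dcoeff_def\<close>)
    finally show ?thesis .
  qed
  moreover have "(\<Sum>\<beta>\<in>exponents (k - 1). dcoeff b c \<beta> * mono_eval \<beta> x) = poly_eval (dcoeff b c) x" for x
    using dcoeff_exponents[OF b c] by (subst poly_eval_exponents[of _ "k - 1"]) auto
  moreover have "poly_eval c = (\<lambda>x. \<Sum>\<alpha>\<in>exponents k. c \<alpha> * mono_eval \<alpha> x)"
    using poly_eval_exponents[of c k] c by auto
  ultimately show ?thesis by simp
qed

text \<open>Induction on the degree: differentiating along some \<open>b\<close> with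
  \<open>\<alpha> b \<noteq> 0\<close> lowers the degree and keeps the coefficient at
  \<open>\<alpha>\<close> up to the nonzero factor \<open>\<alpha> b\<close>. Degree 0 is evaluation
  at the origin.\<close>

lemma poly_eval_eq_0:
  assumes "\<And>\<alpha>. c \<alpha> \<noteq> 0 \<Longrightarrow> \<alpha> \<in> exponents k" "poly_eval c = (\<lambda>x. 0)"
  shows "c \<alpha> = 0"
  using assms
proof (induction k arbitrary: c \<alpha>)
  case 0
  have "poly_eval c (0 :: 'a) = c (\<lambda>_. 0)"
    by (subst poly_eval_exponents[of _ 0]) (use 0 in \<open>auto simp: exponents_0 mono_eval_def\<close>)
  then show ?case using 0 by (auto simp: exponents_0)
next
  case (Suc k)
  show ?case
  proof (rule ccontr)
    assume "c \<alpha> \<noteq> 0"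
    then have \<alpha>: "\<alpha> \<in> exponents (Suc k)" using Suc.prems by blast
    then have "(\<Sum>b\<in>Basis. \<alpha> b) \<noteq> 0" by (simp add: exponents_def)
    then obtain b where b: "b \<in> Basis" "\<alpha> b \<noteq> 0" by (meson sum.neutral)
    have "poly_eval (dcoeff b c) = (\<lambda>x. 0)"
      using has_pd_imp_pd[OF has_pd_poly_eval[of b c "Suc k"]] b Suc.prems
        has_pd_imp_pd[OF has_pd_const[of b 0]] by simp
    then have "dcoeff b c (\<alpha>(b := \<alpha> b - 1)) = 0"
      using dcoeff_exponents(2)[OF b(1), of c "Suc k"] Suc.prems(1) by (intro Suc.IH) auto
    then show False using b \<open>c \<alpha> \<noteq> 0\<close> by (simp add: dcoeff_def)
  qed
qed

text \<open>The right-hand side says that all coefficients of the Laplacian vanish; by uniqueness of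
  coefficients that is the same as vanishing of the function.\<close>

lemma lap_poly_eval:
  fixes c :: "('a::euclidean_space \<Rightarrow> nat) \<Rightarrow> real"
  assumes c: "\<And>\<alpha>. c \<alpha> \<noteq> 0 \<Longrightarrow> \<alpha> \<in> exponents k"
  shows "(\<forall>x. lap (poly_eval c) x = 0) \<longleftrightarrow>
    (\<forall>\<beta>. (\<Sum>b\<in>Basis. real ((\<beta> b + 2) * (\<beta> b + 1)) * c (\<beta>(b := \<beta> b + 2))) = 0)"
proof -
  define L where "L \<beta> = (\<Sum>b\<in>Basis. dcoeff b (dcoeff b c) \<beta>)" for \<beta>
  have dd: "\<beta> \<in> exponents (k - 2)" if "b \<in> Basis" "dcoeff b (dcoeff b c) \<beta> \<noteq> 0" for b \<beta>
    using dcoeff_exponents(2)[OF that(1) dcoeff_exponents(2)[OF that(1) c] that(2)]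
    by (simp add: numeral_2_eq_2)
  have L: "\<beta> \<in> exponents (k - 2)" if "L \<beta> \<noteq> 0" for \<beta>
    using that dd unfolding L_def by (meson sum.neutral)
  have "lap (poly_eval c) x = poly_eval L x" for x
  proof -
    have "pd b (pd b (poly_eval c)) x = poly_eval (dcoeff b (dcoeff b c)) x" if b: "b \<in> Basis" for b
      using has_pd_imp_pd[OF has_pd_poly_eval[OF b c]]
        has_pd_imp_pd[OF has_pd_poly_eval[OF b dcoeff_exponents(2)[OF b c]]] by simp
    also have "poly_eval (dcoeff b (dcoeff b c)) x
        = (\<Sum>\<beta>\<in>exponents (k - 2). dcoeff b (dcoeff b c) \<beta> * mono_eval \<beta> x)" if b: "b \<in> Basis" for b
      using dd[OF b] by (intro poly_eval_exponents)
    finally have "lap (poly_eval c) x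
        = (\<Sum>b\<in>Basis. \<Sum>\<beta>\<in>exponents (k - 2). dcoeff b (dcoeff b c) \<beta> * mono_eval \<beta> x)"
      by (simp add: lap_def)
    also have "\<dots> = (\<Sum>\<beta>\<in>exponents (k - 2). L \<beta> * mono_eval \<beta> x)"
      by (subst sum.swap) (simp add: L_def sum_distrib_right)
    also have "\<dots> = poly_eval L x" using L by (intro poly_eval_exponents[symmetric])
    finally show ?thesis .
  qed
  then have "(\<forall>x. lap (poly_eval c) x = 0) \<longleftrightarrow> (\<forall>x. poly_eval L x = 0)" by simp
  also have "\<dots> \<longleftrightarrow> (\<forall>\<beta>. L \<beta> = 0)"
  proof
    assume "\<forall>x. poly_eval L x = 0"
    then show "\<forall>\<beta>. L \<beta> = 0" using poly_eval_eq_0[OF L, of L] by auto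
  next
    assume "\<forall>\<beta>. L \<beta> = 0"
    then show "\<forall>x. poly_eval L x = 0" by (simp add: poly_eval_def)
  qed
  also have "L = (\<lambda>\<beta>. \<Sum>b\<in>Basis. real ((\<beta> b + 2) * (\<beta> b + 1)) * c (\<beta>(b := \<beta> b + 2)))"
    unfolding L_def dcoeff_def by (intro ext sum.cong) (auto simp: algebra_simps)
  finally show ?thesis .
qed

text \<open>Bridge from the coefficient definition of spherical harmonics to the description by
  functions with vanishing Laplacian, which is the one used in all later arguments.\<close>

lemma sph_harm_eq: "sph_harm l = (harmonics l :: ('a::euclidean_space \<Rightarrow> real) set)"
proof -
  have iff: "harmonic_homog_poly l c \<longleftrightarrow>
      (\<forall>\<alpha>. c \<alpha> \<noteq> 0 \<longrightarrow> \<alpha> \<in> exponents l) \<and> (\<forall>x. lap (poly_eval c) x = 0)"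
    for c :: "('a \<Rightarrow> nat) \<Rightarrow> real"
  proof (cases "\<forall>\<alpha>. c \<alpha> \<noteq> 0 \<longrightarrow> \<alpha> \<in> exponents l")
    case True
    then have "{\<alpha>. c \<alpha> \<noteq> 0} \<subseteq> exponents l" by auto
    then have "finite {\<alpha>. c \<alpha> \<noteq> 0}" by (rule finite_subset) simp
    then show ?thesis using True lap_poly_eval[of c l]
      by (simp add: harmonic_homog_poly_def exponents_def)
  qed (auto simp: harmonic_homog_poly_def exponents_def)
  have "poly_eval c \<in> hom_poly l" if "\<forall>\<alpha>. c \<alpha> \<noteq> 0 \<longrightarrow> \<alpha> \<in> exponents l"
    for c :: "('a \<Rightarrow> nat) \<Rightarrow> real"
  proof -
    have "poly_eval c = (\<lambda>x. \<Sum>\<alpha>\<in>exponents l. c \<alpha> * mono_eval \<alpha> x)"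
      using that poly_eval_exponents[of c l] by auto
    then show ?thesis by (auto intro!: hom_poly_sum hom_poly_scale mono_eval_hom_poly)
  qed
  then show ?thesis using hom_poly_eq_poly_eval[of _ l]
    unfolding sph_harm_def harmonics_def iff by blast
qed

lemma hom_poly_span_monomials:
  assumes "f \<in> hom_poly k"
  shows "\<exists>c. \<forall>x. f x = (\<Sum>\<alpha>\<in>exponents k. c \<alpha> * mono_eval \<alpha> x)"
  using hom_poly_eq_poly_eval[OF assms] poly_eval_exponents by metis

lemma monomials_independent:
  assumes "\<And>x. (\<Sum>\<alpha>\<in>exponents k. c \<alpha> * mono_eval \<alpha> x) = 0" "\<alpha> \<in> exponents k"
  shows "c \<alpha> = 0"
proof -
  let ?c = "\<lambda>\<alpha>. if \<alpha> \<in> exponents k then c \<alpha> else 0"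
  have "poly_eval ?c x = 0" for x
    by (subst poly_eval_exponents[of _ k]) (use assms(1)[of x] in \<open>auto split: if_splits\<close>)
  then have "?c \<alpha> = 0" by (intro poly_eval_eq_0[of ?c k]) (auto split: if_splits)
  then show ?thesis using assms(2) by simp
qed

section \<open>Integration over the sphere\<close>

lemma lborel_integral_scale:
  fixes f :: "'a::euclidean_space \<Rightarrow> real"
  assumes [measurable]: "f \<in> borel_measurable borel" and "r > 0"
  shows "(\<integral>x. f x \<partial>lborel) = r ^ DIM('a) * (\<integral>x. f (r *\<^sub>R x) \<partial>lborel)"
  using assms(2)
  by (subst lborel_affine[of r 0]) (auto simp: integral_density integral_distr)

lemma lborel_integral_translate:
  fixes f :: "'a::euclidean_space \<Rightarrow> real"
  assumes [measurable]: "f \<in> borel_measurable borel"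
  shows "(\<integral>x. f (c + x) \<partial>lborel) = (\<integral>x. f x \<partial>lborel)"
  by (subst (2) lborel_distr_plus[of c, symmetric]) (auto simp: integral_distr)

lemma continuous_on_compact_abs_bound:
  fixes f :: "'a::euclidean_space \<Rightarrow> real"
  assumes "continuous_on UNIV f" "compact S"
  obtains K where "K \<ge> 0" "\<And>x. x \<in> S \<Longrightarrow> \<bar>f x\<bar> \<le> K"
proof -
  have "bounded (f ` S)"
    using assms by (intro compact_imp_bounded compact_continuous_image) (auto intro: continuous_on_subset)
  then obtain K where "K > 0" "\<forall>y\<in>f ` S. norm y \<le> K" unfolding bounded_pos by blast
  then show thesis by (intro that[of K]) auto
qed

lemma integrable_lborel_bounded_ball:
  fixes f :: "'a::euclidean_space \<Rightarrow> real"
  assumes [measurable]: "f \<in> borel_measurable borel"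
    and "\<And>x. \<bar>f x\<bar> \<le> K * indicator (ball 0 R) x"
  shows "integrable lborel f"
proof (rule Bochner_Integration.integrable_bound)
  have "integrable lborel (indicator (ball (0 :: 'a) R) :: 'a \<Rightarrow> real)"
    using emeasure_lborel_ball_finite[of "0 :: 'a" R] by (simp add: integrable_indicator_iff)
  then show "integrable lborel (\<lambda>x. K * indicator (ball (0 :: 'a) R) x :: real)" by simp
  show "AE x in lborel. norm (f x) \<le> norm (K * indicator (ball 0 R) x)"
    using assms(2) by (intro AE_I2) (smt (verit) real_norm_def)
qed simp

text \<open>Comparing the integrals of $f$ and of its degree-zero version $f(x/|x|)$ over the thin
  shell $r \le |x| < 1$, where both integrands nearly agree, and letting $r \to 1$ gives the
  radial factor.\<close>
lemma integral_ball_homogeneous: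
  fixes f :: "'a::euclidean_space \<Rightarrow> real"
  assumes f: "continuous_on UNIV f" "\<And>t x. f (t *\<^sub>R x) = t ^ m * f x"
  shows "(real m + real DIM('a)) * (\<integral>x. indicator (ball 0 1) x * f x \<partial>lborel)
    = real DIM('a) * (\<integral>x. indicator (ball 0 1) x * f (x /\<^sub>R norm x) \<partial>lborel)"
proof -
  define D where "D = DIM('a)"
  define g where "g x = f (x /\<^sub>R norm x)" for x
  have fm [measurable]: "f \<in> borel_measurable borel" using f(1) by (rule borel_measurable_continuous_onI)
  have gm [measurable]: "g \<in> borel_measurable borel" unfolding g_def[abs_def] by measurable
  \<comment> \<open>At the origin \<open>x /\<^sub>R norm x\<close> is 0, and the identity becomes
    homogeneity with factor 0.\<close>
  have fg: "f x = norm x ^ m * g x" for x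
    using f(2)[of "norm x" "x /\<^sub>R norm x"] f(2)[of 0 x] by (cases "x = 0") (auto simp: g_def)
  have gs: "g (r *\<^sub>R x) = g x" if "r > 0" for r x using that by (simp add: g_def mult.commute[of _ r] mult.assoc[symmetric])
  obtain K where K: "K \<ge> 0" "\<And>x. x \<in> cball 0 1 \<Longrightarrow> \<bar>f x\<bar> \<le> K"
    using continuous_on_compact_abs_bound[OF f(1) compact_cball] by blast
  have gK: "\<bar>g x\<bar> \<le> K" for x
    unfolding g_def by (rule K(2)) (cases "x = 0"; simp)
  define F where "F r = (\<integral>x. indicator (ball 0 r) x * f x \<partial>lborel)" for r
  define G where "G r = (\<integral>x. indicator (ball 0 r) x * g x \<partial>lborel)" for r
  define V where "V = (\<integral>x. (indicator (ball (0 :: 'a) 1) x :: real) \<partial>lborel)"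
  have scale: "(\<integral>x. indicator (ball 0 r) x * q x \<partial>lborel)
      = r ^ D * (\<integral>x. indicator (ball 0 1) x * q (r *\<^sub>R x) \<partial>lborel)"
    if [measurable]: "q \<in> borel_measurable borel" and "r > 0" for q :: "'a \<Rightarrow> real" and r
  proof -
    have "indicator (ball 0 r) (r *\<^sub>R x) = (indicator (ball 0 1) x :: real)" for x :: 'a
      using \<open>r > 0\<close> by (simp add: indicator_def)
    moreover have "(\<lambda>x. indicator (ball 0 r) x * q x) \<in> borel_measurable borel"
      by (intro borel_measurable_times borel_measurable_indicator) auto
    ultimately show ?thesis using lborel_integral_scale[of "\<lambda>x. indicator (ball 0 r) x * q x" r] \<open>r > 0\<close>
      by (simp add: D_def)
  qed
  have Fr: "F r = r ^ (m + D) * F 1" if "r > 0" for r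
    using scale[OF fm that] unfolding F_def f(2) by (simp add: power_add mult.left_commute[of _ "r ^ m"] mult.assoc)
  have Gr: "G r = r ^ D * G 1" if "r > 0" for r
    using scale[OF gm that] unfolding G_def gs[OF that] by simp
  have Vr: "(\<integral>x. (indicator (ball (0 :: 'a) r) x :: real) \<partial>lborel) = r ^ D * V" if "r > 0" for r
    using scale[of "\<lambda>_. 1" r] that unfolding V_def by simp
  have intf: "integrable lborel (\<lambda>x. indicator (ball 0 r) x * f x)" if "r \<le> 1" for r
    using K that by (intro integrable_lborel_bounded_ball[of _ K 1]) (auto simp: indicator_def abs_mult)
  have intg: "integrable lborel (\<lambda>x. indicator (ball 0 r) x * g x)" for r
    using gK by (intro integrable_lborel_bounded_ball[of _ K r]) (auto simp: indicator_def abs_mult)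
  have inti: "integrable lborel (\<lambda>x. indicator (ball (0 :: 'a) r) x :: real)" for r
    by (intro integrable_lborel_bounded_ball[of _ 1 r] borel_measurable_indicator) auto
  \<comment> \<open>On the shell, |f - g| = (1 - |x|^m) |g| is at most K (1 - r^m). Dividing the
    estimate for the shell integrals by 1 - r turns 1 - r^(m+D) and 1 - r^D into geometric sums. As
    r tends to 1 these tend to m + D and D, while the factor 1 - r^m sends the right-hand side to
    0.\<close>
  have ineq: "\<bar>(\<Sum>i<m + D. r ^ i) * F 1 - (\<Sum>i<D. r ^ i) * G 1\<bar> \<le> K * (1 - r ^ m) * ((\<Sum>i<D. r ^ i) * V)"
    if r: "0 < r" "r < 1" for r
  proof -
    let ?d = "\<lambda>x. (indicator (ball 0 1) x * f x - indicator (ball 0 r) x * f x)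
        - (indicator (ball 0 1) x * g x - indicator (ball 0 r) x * g x)"
    let ?b = "\<lambda>x::'a. K * (1 - r ^ m) * (indicator (ball 0 1) x - indicator (ball 0 r) x)"
    have pt: "\<bar>?d x\<bar> \<le> ?b x" for x
    proof (cases "x \<in> ball 0 1 \<and> x \<notin> ball 0 r")
      case True
      then have n: "r \<le> norm x" "norm x \<le> 1" by auto
      then have "r ^ m \<le> norm x ^ m" "norm x ^ m \<le> 1"
        using r by (auto intro: power_mono power_le_one)
      then have "\<bar>(1 - norm x ^ m)\<bar> * \<bar>g x\<bar> \<le> (1 - r ^ m) * K"
        using gK[of x] by (intro mult_mono) auto
      moreover have "?d x = - ((1 - norm x ^ m) * g x)" using True by (simp add: fg[of x] algebra_simps)
      ultimately show ?thesis using True by (simp add: abs_mult mult.commute)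
    next
      case False
      then show ?thesis using r by (auto simp: indicator_def)
    qed
    have "(\<integral>x. ?d x \<partial>lborel) = (F 1 - F r) - (G 1 - G r)"
      unfolding F_def G_def using r by (simp add: intf intg)
    moreover have "(\<integral>x. ?b x \<partial>lborel) = K * (1 - r ^ m) * (V - r ^ D * V)"
    proof -
      have "(\<integral>x. ?b x \<partial>lborel) = K * (1 - r ^ m) * ((\<integral>x. (indicator (ball (0 :: 'a) 1) x :: real) \<partial>lborel)
          - (\<integral>x. (indicator (ball (0 :: 'a) r) x :: real) \<partial>lborel))"
        by (simp only: integral_mult_right_zero Bochner_Integration.integral_diff[OF inti inti])
      then show ?thesis unfolding Vr[OF r(1)] V_def .
    qed
    moreover have "\<bar>\<integral>x. ?d x \<partial>lborel\<bar> \<le> (\<integral>x. ?b x \<partial>lborel)"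
    proof -
      have "\<bar>\<integral>x. ?d x \<partial>lborel\<bar> \<le> (\<integral>x. \<bar>?d x\<bar> \<partial>lborel)" by (rule integral_abs_bound)
      also have "\<dots> \<le> (\<integral>x. ?b x \<partial>lborel)"
        using r by (intro integral_mono pt integrable_abs Bochner_Integration.integrable_diff
            intf intg inti integrable_mult_right) auto
      finally show ?thesis .
    qed
    ultimately have "\<bar>(1 - r ^ (m + D)) * F 1 - (1 - r ^ D) * G 1\<bar> \<le> K * (1 - r ^ m) * ((1 - r ^ D) * V)"
      using Fr[OF r(1)] Gr[OF r(1)] by (simp add: algebra_simps)
    then have "(1 - r) * \<bar>(\<Sum>i<m + D. r ^ i) * F 1 - (\<Sum>i<D. r ^ i) * G 1\<bar>
        \<le> (1 - r) * (K * (1 - r ^ m) * ((\<Sum>i<D. r ^ i) * V))"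
    proof -
      have e: "(1 - r) * \<bar>y\<bar> = \<bar>(1 - r) * y\<bar>" for y using r by (simp add: abs_mult)
      assume *: "\<bar>(1 - r ^ (m + D)) * F 1 - (1 - r ^ D) * G 1\<bar> \<le> K * (1 - r ^ m) * ((1 - r ^ D) * V)"
      have e1: "(1 - r) * ((\<Sum>i<m + D. r ^ i) * F 1 - (\<Sum>i<D. r ^ i) * G 1)
          = (1 - r ^ (m + D)) * F 1 - (1 - r ^ D) * G 1"
        unfolding one_diff_power_eq[of r "m + D"] one_diff_power_eq[of r D] by (simp add: algebra_simps)
      have e2: "(1 - r) * (K * (1 - r ^ m) * ((\<Sum>i<D. r ^ i) * V)) = K * (1 - r ^ m) * ((1 - r ^ D) * V)"
        unfolding one_diff_power_eq[of r D] by (simp add: algebra_simps)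
      show ?thesis unfolding e e1 e2 by (rule *)
    qed
    then show ?thesis using r by simp
  qed
  have "((\<lambda>r::real. \<bar>(\<Sum>i<m + D. r ^ i) * F 1 - (\<Sum>i<D. r ^ i) * G 1\<bar>) \<longlongrightarrow>
      \<bar>(\<Sum>i<m + D. 1 ^ i) * F 1 - (\<Sum>i<D. 1 ^ i) * G 1\<bar>) (at_left 1)"
    by (intro tendsto_intros)
  moreover have "((\<lambda>r::real. K * (1 - r ^ m) * ((\<Sum>i<D. r ^ i) * V)) \<longlongrightarrow>
      K * (1 - 1 ^ m) * ((\<Sum>i<D. 1 ^ i) * V)) (at_left 1)"
    by (intro tendsto_intros)
  moreover have "eventually (\<lambda>r. \<bar>(\<Sum>i<m + D. r ^ i) * F 1 - (\<Sum>i<D. r ^ i) * G 1\<bar>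
      \<le> K * (1 - r ^ m) * ((\<Sum>i<D. r ^ i) * V)) (at_left 1)"
    by (rule eventually_mono[OF eventually_at_left_real[of 0 "1 :: real"]]) (use ineq in auto)
  ultimately have "\<bar>(\<Sum>i<m + D. 1 ^ i) * F 1 - (\<Sum>i<D. 1 ^ i) * G 1\<bar>
      \<le> K * (1 - 1 ^ m) * ((\<Sum>i<D. 1 ^ i) * V)"
    by (intro tendsto_le[OF trivial_limit_at_left_real]) auto
  then show ?thesis by (simp add: F_def G_def g_def D_def)
qed

text \<open>Difference quotients of \<open>u\<close> integrate to 0 by translation invariance. The
  mean value theorem bounds them by the supremum of |v|, so dominated convergence passes the value 0
  on to the integral of \<open>v\<close>.\<close>

lemma integral_pd_compact_support:
  fixes u v :: "'a::euclidean_space \<Rightarrow> real"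
  assumes pd: "has_pd b u v" and b: "b \<in> Basis"
    and cont: "continuous_on UNIV u" "continuous_on UNIV v"
    and supp: "\<And>x. norm x \<ge> 1 \<Longrightarrow> u x = 0" "\<And>x. norm x \<ge> 1 \<Longrightarrow> v x = 0"
  shows "(\<integral>x. v x \<partial>lborel) = 0"
proof -
  have [measurable]: "u \<in> borel_measurable borel" "v \<in> borel_measurable borel"
    using cont by (auto intro: borel_measurable_continuous_onI)
  have bd: "\<exists>K\<ge>0. \<forall>x. \<bar>q x\<bar> \<le> K" if q: "continuous_on UNIV q" "\<And>x. norm x \<ge> 1 \<Longrightarrow> q x = 0" for q :: "'a \<Rightarrow> real"
  proof -
    obtain K where "K \<ge> 0" and K: "\<And>x. x \<in> cball 0 1 \<Longrightarrow> \<bar>q x\<bar> \<le> K"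
      using continuous_on_compact_abs_bound[OF q(1) compact_cball] by blast
    then have "\<bar>q x\<bar> \<le> K" for x using K[of x] q(2)[of x] \<open>K \<ge> 0\<close> by (cases "norm x \<le> 1") auto
    then show ?thesis using \<open>K \<ge> 0\<close> by blast
  qed
  obtain Ku where Ku: "Ku \<ge> 0" "\<And>x. \<bar>u x\<bar> \<le> Ku" using bd[OF cont(1) supp(1)] by auto
  obtain Kv where Kv: "Kv \<ge> 0" "\<And>x. \<bar>v x\<bar> \<le> Kv" using bd[OF cont(2) supp(2)] by auto
  have intu: "integrable lborel u"
    using Ku supp(1) by (intro integrable_lborel_bounded_ball[of _ Ku 1]) (auto simp: indicator_def)
  define h where "h n x = real (Suc n) * (u ((1 / real (Suc n)) *\<^sub>R b + x) - u x)" for n x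
  have intu': "integrable lborel (\<lambda>x. u (c + x))" for c
    using intu by (subst (asm) lborel_distr_plus[of c, symmetric]) (simp add: integrable_distr_eq)
  have h0: "(\<integral>x. h n x \<partial>lborel) = 0" for n
    unfolding h_def using intu intu' by (simp add: lborel_integral_translate)
  have "(\<lambda>n. \<integral>x. h n x \<partial>lborel) \<longlonglongrightarrow> (\<integral>x. v x \<partial>lborel)"
  proof (rule integral_dominated_convergence)
    \<comment> \<open>Radius 2: the step of the difference quotient has length at most 1 and
      \<open>u\<close> vanishes outside the unit ball.\<close>
    show "integrable lborel (\<lambda>x. Kv * indicator (ball (0 :: 'a) 2) x :: real)"
      using Kv(1) by (intro integrable_lborel_bounded_ball[of _ Kv 2] borel_measurable_times
          borel_measurable_indicator) (auto simp: abs_mult)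
    have "h n x = 0" if "norm x \<ge> 2" for n x
    proof -
      have "norm x \<le> norm ((1 / real (Suc n)) *\<^sub>R b + x) + norm ((1 / real (Suc n)) *\<^sub>R b)"
        by (metis add_diff_cancel_left' norm_triangle_ineq4 add.commute)
      also have "norm ((1 / real (Suc n)) *\<^sub>R b) \<le> 1" using b by simp
      finally have "norm ((1 / real (Suc n)) *\<^sub>R b + x) \<ge> 1" using that by simp
      then show ?thesis using supp(1) that by (simp add: h_def)
    qed
    moreover have "\<bar>h n x\<bar> \<le> Kv" for n x
    proof -
      have "\<exists>z>0. z < 1 / real (Suc n) \<and> u (x + (1 / real (Suc n)) *\<^sub>R b) - u (x + 0 *\<^sub>R b)
          = (1 / real (Suc n) - 0) * v (x + z *\<^sub>R b)"
        by (rule MVT2[where f = "\<lambda>t. u (x + t *\<^sub>R b)"]) (auto intro: has_pd_shift[OF pd])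
      then obtain z where "u (x + (1 / real (Suc n)) *\<^sub>R b) - u x = (1 / real (Suc n)) * v (x + z *\<^sub>R b)"
        by auto
      then have "h n x = v (x + z *\<^sub>R b)" by (simp add: h_def add.commute)
      then show ?thesis using Kv(2) by simp
    qed
    ultimately show "AE x in lborel. norm (h n x) \<le> Kv * indicator (ball 0 2) x" for n
      by (intro AE_I2) (auto simp: indicator_def)
    have "(\<lambda>n. h n x) \<longlonglongrightarrow> v x" for x
    proof -
      have "((\<lambda>t. (u (x + t *\<^sub>R b) - u x) / t) \<longlongrightarrow> v x) (at 0)"
        using pd by (auto simp: has_pd_def DERIV_def)
      moreover have "filterlim (\<lambda>n. 1 / real (Suc n)) (at 0) sequentially"
        unfolding filterlim_at using LIMSEQ_inverse_real_of_nat by (auto simp: inverse_eq_divide)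
      ultimately have "(\<lambda>n. (u (x + (1 / real (Suc n)) *\<^sub>R b) - u x) / (1 / real (Suc n))) \<longlonglongrightarrow> v x"
        by (rule filterlim_compose)
      then show ?thesis by (simp add: h_def[abs_def] add.commute mult.commute)
    qed
    then show "AE x in lborel. (\<lambda>n. h n x) \<longlonglongrightarrow> v x" by simp
  qed (auto simp: h_def)
  then show ?thesis unfolding h0 by (simp add: LIMSEQ_const_iff)
qed

text \<open>At 0 the difference quotient is bounded by |h|. The positive part itself has a corner
  there, which is why the bump function carries a square.\<close>

lemma has_real_derivative_max0_square:
  "((\<lambda>s::real. (max 0 s)\<^sup>2) has_real_derivative 2 * max 0 s) (at s)"
proof (cases s "0 :: real" rule: linorder_cases)
  case less
  have "((\<lambda>s::real. 0) has_real_derivative 2 * max 0 s) (at s)" using less by simp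
  then show ?thesis
    by (rule has_field_derivative_transform_within_open[of _ _ _ "{..<0}"]) (use less in auto)
next
  case greater
  have "((\<lambda>s::real. s\<^sup>2) has_real_derivative 2 * max 0 s) (at s)"
    using greater by (auto intro!: derivative_eq_intros)
  then show ?thesis
    by (rule has_field_derivative_transform_within_open[of _ _ _ "{0<..}"]) (use greater in auto)
next
  case equal
  have "((\<lambda>h::real. (max 0 h)\<^sup>2 / h) \<longlongrightarrow> 0) (at 0)"
  proof (rule Lim_null_comparison)
    show "\<forall>\<^sub>F h in at (0::real). norm ((max 0 h)\<^sup>2 / h) \<le> \<bar>h\<bar>"
      by (rule always_eventually) (auto simp: max_def power2_eq_square)
    show "((\<lambda>h::real. \<bar>h\<bar>) \<longlongrightarrow> 0) (at 0)" by (intro tendsto_eq_intros) auto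
  qed
  then show ?thesis using equal by (simp add: DERIV_def)
qed

lemma has_pd_bump:
  "has_pd b (\<lambda>x. (max 0 (1 - x \<bullet> x))\<^sup>2) (\<lambda>x. - 4 * (x \<bullet> b) * max 0 (1 - x \<bullet> x))"
  unfolding has_pd_def
proof
  fix x :: 'a
  have "((\<lambda>t. 1 - (x + t *\<^sub>R b) \<bullet> (x + t *\<^sub>R b)) has_real_derivative - 2 * (x \<bullet> b)) (at 0)"
    using has_pd_inner_self[of b] unfolding has_pd_def
    by (intro derivative_eq_intros) (auto intro: derivative_eq_intros)
  from DERIV_chain2[OF has_real_derivative_max0_square this]
  show "((\<lambda>t. (max 0 (1 - (x + t *\<^sub>R b) \<bullet> (x + t *\<^sub>R b)))\<^sup>2) has_real_derivative
      - 4 * (x \<bullet> b) * max 0 (1 - x \<bullet> x)) (at 0)" by (simp add: algebra_simps)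
qed

section \<open>Basic properties of the normalized surface measure\<close>

lemma sets_sphere_measure [simp, measurable_cong]: "sets sphere_measure = sets borel"
  by (simp add: sphere_measure_def)

lemma space_sphere_measure [simp]: "space sphere_measure = UNIV"
  by (simp add: sphere_measure_def)

lemma measure_unit_ball_pos: "measure lborel (ball (0 :: 'a::euclidean_space) 1) > 0"
  using content_ball_pos[of 1 "0 :: 'a"] by simp

lemma emeasure_unit_ball:
  "emeasure lborel (ball (0 :: 'a::euclidean_space) 1) \<noteq> 0"
  "emeasure lborel (ball (0 :: 'a::euclidean_space) 1) \<noteq> \<infinity>"
  using measure_unit_ball_pos[where 'a='a] emeasure_lborel_ball_finite[of "0 :: 'a" 1]
  by (auto simp: measure_def)

lemma AE_sphere_measure:
  assumes [measurable]: "Measurable.pred borel P"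
  shows "(AE x in sphere_measure. P (x :: 'a::euclidean_space)) \<longleftrightarrow>
    (AE x in lborel. x \<in> ball 0 1 \<longrightarrow> P (x /\<^sub>R norm x))"
proof -
  have "(AE x in sphere_measure. P (x :: 'a)) \<longleftrightarrow> (AE x in uniform_measure lborel (ball 0 1). P (x /\<^sub>R norm (x :: 'a)))"
    unfolding sphere_measure_def
    by (rule AE_distr_iff) (simp_all add: uniform_measure_def)
  also have "\<dots> \<longleftrightarrow> (AE x in lborel. x \<in> ball 0 1 \<longrightarrow> P (x /\<^sub>R norm x))"
    by (rule AE_uniform_measure) (use emeasure_unit_ball[where 'a='a] in \<open>auto simp: top.not_eq_extremum\<close>)
  finally show ?thesis .
qed

text \<open>Only the centre of the ball is not projected to the sphere, since
  \<open>x /\<^sub>R norm x\<close> is 0 at \<open>x = 0\<close>, and a single point is Lebesgue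
  null.\<close>

lemma AE_sphere_norm: "AE x in sphere_measure. norm (x :: 'a::euclidean_space) = 1"
proof -
  have "AE x in lborel. x \<noteq> (0 :: 'a)"
    using AE_lborel_singleton[of "0 :: 'a"] by simp
  then show ?thesis by (subst AE_sphere_measure) (auto elim: eventually_mono)
qed

lemma finite_measure_sphere_measure: "finite_measure (sphere_measure :: 'a::euclidean_space measure)"
proof
  let ?e = "emeasure lborel (ball (0 :: 'a) 1)"
  have "emeasure (sphere_measure :: 'a measure) (space sphere_measure) = ?e / ?e"
    using emeasure_unit_ball[where 'a='a] by (simp add: sphere_measure_def emeasure_distr)
  also have "\<dots> = 1"
    using emeasure_unit_ball[where 'a='a] by (intro ennreal_divide_self) (auto simp: less_top zero_less_iff_neq_zero)
  finally have "emeasure (sphere_measure :: 'a measure) (space sphere_measure) = 1" .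
  then show "emeasure (sphere_measure :: 'a measure) (space sphere_measure) \<noteq> \<infinity>" by simp
qed

lemma integral_sphere_measure:
  fixes f :: "'a::euclidean_space \<Rightarrow> real"
  assumes [measurable]: "f \<in> borel_measurable borel"
  shows "(\<integral>x. indicator (ball 0 1) x * f (x /\<^sub>R norm x) \<partial>lborel)
    = measure lborel (ball (0 :: 'a) 1) * (\<integral>x. f x \<partial>sphere_measure)"
proof -
  let ?B = "ball (0 :: 'a) 1"
  have e: "emeasure lborel ?B = ennreal (measure lborel ?B)"
    using emeasure_unit_ball[where 'a='a] by (simp add: emeasure_eq_ennreal_measure)
  have "uniform_measure lborel ?B = density lborel (\<lambda>x. ennreal (indicator ?B x / measure lborel ?B))"
    unfolding uniform_measure_def e using measure_unit_ball_pos[where 'a='a]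
    by (intro arg_cong[of _ _ "density lborel"] ext) (auto simp: indicator_def divide_ennreal[symmetric])
  then have "(\<integral>x. f x \<partial>sphere_measure)
      = (\<integral>x. f (x /\<^sub>R norm x) \<partial>density lborel (\<lambda>x. ennreal (indicator ?B x / measure lborel ?B)))"
    unfolding sphere_measure_def by (subst integral_distr) auto
  also have "\<dots> = (\<integral>x. (indicator ?B x / measure lborel ?B) * f (x /\<^sub>R norm x) \<partial>lborel)"
  proof (subst integral_density)
    show "(\<lambda>x. indicator ?B x / measure lborel ?B) \<in> borel_measurable lborel"
      by (intro borel_measurable_divide borel_measurable_indicator) auto
  qed auto
  also have "\<dots> = (\<integral>x. (1 / measure lborel ?B) * (indicator ?B x * f (x /\<^sub>R norm x)) \<partial>lborel)"
    by (intro Bochner_Integration.integral_cong) auto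
  finally show ?thesis using measure_unit_ball_pos[where 'a='a] by simp
qed

lemma l2_continuous:
  fixes f :: "'a::euclidean_space \<Rightarrow> real"
  assumes "continuous_on UNIV f"
  shows "f \<in> l2 sphere_measure" "integrable sphere_measure f"
proof -
  interpret finite_measure "sphere_measure :: 'a measure" by (rule finite_measure_sphere_measure)
  have [measurable]: "f \<in> borel_measurable borel" using assms by (rule borel_measurable_continuous_onI)
  obtain K where K: "\<And>x. x \<in> sphere 0 1 \<Longrightarrow> \<bar>f x\<bar> \<le> K"
    using continuous_on_compact_abs_bound[OF assms compact_sphere] by blast
  have "AE x in sphere_measure. norm (f x) \<le> K"
    using AE_sphere_norm by eventually_elim (use K in auto)
  then show "integrable sphere_measure f" by (intro integrable_const_bound[of _ K]) auto
  have "AE x in sphere_measure. norm ((f x)\<^sup>2) \<le> K\<^sup>2"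
    using AE_sphere_norm by eventually_elim (use K in \<open>auto intro: abs_le_square_iff[THEN iffD1] simp: abs_le_square_iff[symmetric] intro: order_trans[OF _ abs_ge_self]\<close>)
  then have "integrable sphere_measure (\<lambda>x. (f x)\<^sup>2)" by (intro integrable_const_bound[of _ "K\<^sup>2"]) auto
  then show "f \<in> l2 sphere_measure" by (simp add: l2_def)
qed

text \<open>The set \<open>U\<close> of points of the punctured ball whose direction is not a zero
  of \<open>f\<close> is open. If it contained x/2 it would contain a ball of positive Lebesgue
  measure, whereas the hypothesis makes it null.\<close>

lemma continuous_AE_sphere_zero:
  fixes f :: "'a::euclidean_space \<Rightarrow> real"
  assumes f: "continuous_on UNIV f" and ae: "AE x in sphere_measure. f x = 0" and x: "norm x = 1"
  shows "f x = 0"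
proof (rule ccontr)
  assume nz: "f x \<noteq> 0"
  have [measurable]: "f \<in> borel_measurable borel" using f by (rule borel_measurable_continuous_onI)
  define U where "U = {y \<in> ball 0 1 - {0}. f (y /\<^sub>R norm y) \<noteq> 0}"
  have "open U"
  proof -
    have "continuous_on (ball 0 1 - {0}) (\<lambda>y. f (y /\<^sub>R norm y))"
      by (intro continuous_on_compose2[OF f] continuous_intros) auto
    then have "open ((\<lambda>y. f (y /\<^sub>R norm y)) -` (- {0}) \<inter> (ball 0 1 - {0}))"
      by (subst Int_commute, intro continuous_open_preimage) auto
    moreover have "(\<lambda>y. f (y /\<^sub>R norm y)) -` (- {0}) \<inter> (ball 0 1 - {0}) = U" by (auto simp: U_def)
    ultimately show ?thesis by simp
  qed
  moreover have "(1/2) *\<^sub>R x \<in> U" using x nz by (auto simp: U_def)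
  ultimately obtain e where e: "e > 0" "ball ((1/2) *\<^sub>R x) e \<subseteq> U" by (auto simp: open_contains_ball)
  have "AE y in lborel. y \<in> ball 0 1 \<longrightarrow> f (y /\<^sub>R norm y) = 0" using ae by (subst (asm) AE_sphere_measure) auto
  then have "AE y in lborel. y \<notin> ball ((1/2) *\<^sub>R x) e"
    by eventually_elim (use e in \<open>auto simp: U_def\<close>)
  then have "emeasure lborel (ball ((1/2) *\<^sub>R x) e) = 0"
    by (subst (asm) AE_iff_measurable[of "ball ((1/2) *\<^sub>R x) e"]) auto
  then show False using content_ball_pos[OF e(1), of "(1/2) *\<^sub>R x"] by (simp add: measure_def)
qed

text \<open>Polar coordinates for a homogeneous integrand: the factor D/(m + D) is D times the
  integral of r^(m+D-1) over [0,1].\<close>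

lemma hom_poly_sphere_integral:
  fixes f :: "'a::euclidean_space \<Rightarrow> real"
  assumes f: "f \<in> hom_poly m"
  shows "(\<integral>x. indicator (ball 0 1) x * f x \<partial>lborel)
    = measure lborel (ball (0 :: 'a) 1) * real DIM('a) / (real m + real DIM('a)) * (\<integral>x. f x \<partial>sphere_measure)"
proof -
  have c: "continuous_on UNIV f" using f by (rule hom_poly_continuous)
  have "real m + real DIM('a) > 0" by (simp add: add_nonneg_pos)
  then show ?thesis
    using integral_ball_homogeneous[OF c hom_poly_homogeneous[OF f]]
      integral_sphere_measure[OF borel_measurable_continuous_onI[OF c]]
    by (simp add: field_simps)
qed

section \<open>Integration by parts on the sphere and orthogonality of degrees\<close>

lemma integral_sphere_radial:
  fixes f :: "'a::euclidean_space \<Rightarrow> real"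
  assumes "continuous_on UNIV f"
  shows "(\<integral>x. (x \<bullet> x) * f x \<partial>sphere_measure) = (\<integral>x. f x \<partial>sphere_measure)"
proof (rule integral_cong_AE)
  have [measurable]: "f \<in> borel_measurable borel" using assms by (rule borel_measurable_continuous_onI)
  show "(\<lambda>x. (x \<bullet> x) * f x) \<in> borel_measurable sphere_measure" "f \<in> borel_measurable sphere_measure"
    by measurable
  show "AE x in sphere_measure. (x \<bullet> x) * f x = f x"
    using AE_sphere_norm by eventually_elim (simp add: power2_norm_eq_inner[symmetric])
qed

text \<open>Integration by parts on the sphere, from $\int \partial_b (F w) = 0$ for the bump
  $w = (1 - |x|^2)_+^2$, whose square makes $F w$ continuously differentiable.\<close>
lemma sphere_integration_by_parts:
  fixes F :: "'a::euclidean_space \<Rightarrow> real"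
  assumes F: "F \<in> hom_poly m" and b: "b \<in> Basis" and D: "DIM('a) \<ge> 2"
  shows "(real m + real DIM('a) - 1) * (\<integral>x. (x \<bullet> b) * F x \<partial>sphere_measure)
    = (\<integral>x. pd b F x \<partial>sphere_measure)"
proof -
  define G where "G = pd b F"
  define w where "w x = max 0 (1 - x \<bullet> x)" for x :: 'a
  define H where "H x = (x \<bullet> b) * F x" for x
  define I where "I f = (\<integral>x. indicator (ball 0 1) x * f x \<partial>lborel)" for f :: "'a \<Rightarrow> real"
  have HH: "H \<in> hom_poly (Suc m)" unfolding H_def[abs_def] using F b by (rule hom_poly_coord)
  have GG: "G \<in> hom_poly (m - 1)" unfolding G_def using F b by (rule hom_poly_pd)
  have wc: "continuous_on UNIV w" unfolding w_def[abs_def] by (intro continuous_intros)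
  have w0: "w x = 0" if "norm x \<ge> 1" for x
  proof -
    have "1 \<le> (norm x)\<^sup>2" using that by simp
    then show ?thesis by (simp add: w_def power2_norm_eq_inner)
  qed
  have w1: "w x = 1 - x \<bullet> x" if "norm x < 1" for x
  proof -
    have "(norm x)\<^sup>2 \<le> 1" using that by (simp add: power_le_one)
    then show ?thesis by (simp add: w_def power2_norm_eq_inner)
  qed
  define v where "v x = G x * (w x)\<^sup>2 + F x * (- 4 * (x \<bullet> b) * w x)" for x
  have "has_pd b (\<lambda>x. F x * (w x)\<^sup>2) v"
    unfolding v_def[abs_def] w_def G_def
    by (rule has_pd_mult[OF hom_poly_has_pd[OF F b] has_pd_bump])
  moreover have "continuous_on UNIV (\<lambda>x. F x * (w x)\<^sup>2)" "continuous_on UNIV v"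
    unfolding v_def[abs_def] by (intro continuous_intros wc hom_poly_continuous[OF F] hom_poly_continuous[OF GG])+
  ultimately have "(\<integral>x. v x \<partial>lborel) = 0"
    using w0 by (intro integral_pd_compact_support[of b "\<lambda>x. F x * (w x)\<^sup>2" v] b) (simp_all add: v_def)
  \<comment> \<open>In the ball the square of \<open>w\<close> is 1 - 2|x|^2 + |x|^4, so
    \<open>v\<close> splits into homogeneous polynomials, each of which
    \<open>hom_poly_sphere_integral\<close> carries over to the sphere.\<close>
  moreover have "v x = indicator (ball 0 1) x * G x - 2 * (indicator (ball 0 1) x * ((x \<bullet> x) * G x))
      + indicator (ball 0 1) x * ((x \<bullet> x) * ((x \<bullet> x) * G x))
      - 4 * (indicator (ball 0 1) x * H x) + 4 * (indicator (ball 0 1) x * ((x \<bullet> x) * H x))" for x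
    by (cases "norm x < 1") (simp_all add: v_def w0 w1 H_def power2_eq_square algebra_simps)
  moreover have int: "integrable lborel (\<lambda>x. indicator (ball 0 1) x * f x)" if "f \<in> hom_poly k" for f :: "'a \<Rightarrow> real" and k
  proof -
    have c: "continuous_on UNIV f" using that by (rule hom_poly_continuous)
    have [measurable]: "f \<in> borel_measurable borel" using c by (rule borel_measurable_continuous_onI)
    obtain K where K: "\<And>x. x \<in> cball 0 1 \<Longrightarrow> \<bar>f x\<bar> \<le> K"
      using continuous_on_compact_abs_bound[OF c compact_cball] by blast
    show ?thesis
      using K by (intro integrable_lborel_bounded_ball[of _ K 1]) (auto simp: indicator_def abs_mult)
  qed
  ultimately have "I G - 2 * I (\<lambda>x. (x \<bullet> x) * G x) + I (\<lambda>x. (x \<bullet> x) * ((x \<bullet> x) * G x))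
      - 4 * I H + 4 * I (\<lambda>x. (x \<bullet> x) * H x) = 0"
    unfolding I_def
    using int[OF GG] int[OF hom_poly_radial[OF GG]] int[OF hom_poly_radial[OF hom_poly_radial[OF GG]]]
      int[OF HH] int[OF hom_poly_radial[OF HH]] by simp
  moreover
  define V where "V = measure lborel (ball (0 :: 'a) 1) * real DIM('a)"
  define SG where "SG = (\<integral>x. G x \<partial>sphere_measure)"
  define SH where "SH = (\<integral>x. H x \<partial>sphere_measure)"
  \<comment> \<open>\<open>s\<close> is the degree of \<open>G\<close> plus the dimension, the
    denominator in \<open>hom_poly_sphere_integral\<close>. \<open>H\<close> has two degrees more,
    and each factor |x|^2 adds another 2.\<close>
  define s where "s = real m + real DIM('a) - 1"
  have V: "V > 0" using measure_unit_ball_pos[where 'a='a] by (simp add: V_def)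
  have s: "s > 0" using D by (simp add: s_def)
  have cG: "continuous_on UNIV G" and cH: "continuous_on UNIV H"
    using GG HH by (auto intro: hom_poly_continuous)
  have cG2: "continuous_on UNIV (\<lambda>x. (x \<bullet> x) * G x)" by (intro continuous_intros cG)
  have SG0: "SG = 0" if "m = 0"
    using hom_poly_0_pd[of F b] F b that by (simp add: SG_def G_def)
  have radial: "I f = V / c * S" if "f \<in> hom_poly k" "(\<integral>x. f x \<partial>sphere_measure) = S"
    "S = 0 \<or> c = real k + real DIM('a)" for f k c S
    using hom_poly_sphere_integral[OF that(1)] that(2,3) unfolding I_def V_def by auto
  \<comment> \<open>For \<open>m = 0\<close> the truncated degree \<open>m - 1\<close> does not
    match \<open>s\<close>, but then \<open>G\<close>, and with it \<open>SG\<close>, is 0.\<close>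
  have deg: "SG = 0 \<or> s = real (m - 1) + real DIM('a)" using SG0 by (cases m) (auto simp: s_def)
  have "I G = V / s * SG"
    by (rule radial[OF GG]) (use deg in \<open>auto simp: SG_def\<close>)
  moreover have "I (\<lambda>x. (x \<bullet> x) * G x) = V / (s + 2) * SG"
    by (rule radial[OF hom_poly_radial[OF GG]])
      (use deg in \<open>auto simp: SG_def integral_sphere_radial[OF cG]\<close>)
  moreover have "I (\<lambda>x. (x \<bullet> x) * ((x \<bullet> x) * G x)) = V / (s + 4) * SG"
    by (rule radial[OF hom_poly_radial[OF hom_poly_radial[OF GG]]])
      (use deg in \<open>auto simp: SG_def integral_sphere_radial[OF cG] integral_sphere_radial[OF cG2]\<close>)
  moreover have "I H = V / (s + 2) * SH"
    by (rule radial[OF HH]) (auto simp: SH_def s_def)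
  moreover have "I (\<lambda>x. (x \<bullet> x) * H x) = V / (s + 4) * SH"
    by (rule radial[OF hom_poly_radial[OF HH]]) (auto simp: SH_def s_def integral_sphere_radial[OF cH])
  ultimately have "V * (SG * (1 / s - 2 / (s + 2) + 1 / (s + 4))) = V * (SH * (4 / (s + 2) - 4 / (s + 4)))"
    by (simp add: algebra_simps)
  then have *: "SG * (1 / s - 2 / (s + 2) + 1 / (s + 4)) = SH * (4 / (s + 2) - 4 / (s + 4))" using V by simp
  have nz: "s \<noteq> 0" "s + 2 \<noteq> 0" "s + 4 \<noteq> 0" using s by auto
  \<comment> \<open>The left bracket in \<open>*\<close> is a second difference of 1/s and the right
    one a first difference, and both have numerator 8; what remains after cancelling is
    \<open>SG = s * SH\<close>.\<close>
  have "SG * (8 / (s * (s + 2) * (s + 4))) = SH * (8 / ((s + 2) * (s + 4)))"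
  proof -
    have "1 / s - 2 / (s + 2) + 1 / (s + 4) = 8 / (s * (s + 2) * (s + 4))"
      using nz by (simp add: divide_simps) (simp add: algebra_simps)
    moreover have "4 / (s + 2) - 4 / (s + 4) = 8 / ((s + 2) * (s + 4))"
      using nz by (simp add: divide_simps)
    ultimately show ?thesis using * by simp
  qed
  then have "SG * (8 * s + 32) = SH * 8 * (s * (s + 4))" using nz by (simp add: divide_simps)
  then have "(8 * (s + 4)) * SG = (8 * (s + 4)) * (s * SH)" by (simp add: algebra_simps)
  then have "SG = s * SH" using nz by (subst (asm) mult_left_cancel) auto
  then show ?thesis by (simp add: SG_def SH_def G_def H_def s_def)
qed

text \<open>By Euler's identity and integration by parts, $(l + m + D - 2)\, l \int pq$ equals
  $\sum_b \int \partial_b p\, \partial_b q$, which is symmetric in $p$ and $q$.\<close>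
lemma harmonics_orthogonal:
  fixes p q :: "'a::euclidean_space \<Rightarrow> real"
  assumes p: "p \<in> harmonics l" and q: "q \<in> harmonics m" and "l \<noteq> m" and D: "DIM('a) \<ge> 3"
  shows "ip sphere_measure p q = 0"
proof -
  have green: "(real l + real m + real DIM('a) - 2) * (real l * ip sphere_measure p q)
      = (\<Sum>b\<in>Basis. \<integral>x. pd b p x * pd b q x \<partial>sphere_measure)"
    if p: "p \<in> harmonics l" and q: "q \<in> harmonics m" and lm: "l + m \<ge> 1"
    for p q :: "'a \<Rightarrow> real" and l m
  proof -
    have pl: "p \<in> hom_poly l" and qm: "q \<in> hom_poly m" and lap: "\<And>x. lap p x = 0"
      using p q by (auto simp: harmonics_def)
    \<comment> \<open>For \<open>l = 0\<close> the derivative of \<open>p\<close> is 0, which lies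
      in every degree, so truncation in \<open>l + m - 1\<close> does no harm.\<close>
    have F: "(\<lambda>x. pd b p x * q x) \<in> hom_poly (l + m - 1)" if b: "b \<in> Basis" for b
      using hom_poly_mult[OF hom_poly_pd[OF pl b] qm] hom_poly_0_pd[of p b] pl b by (cases l) auto
    have cont: "continuous_on UNIV p" "continuous_on UNIV q" using pl qm by (auto intro: hom_poly_continuous)
    have contp: "continuous_on UNIV (pd b p)" "continuous_on UNIV (pd b (pd b p))" "continuous_on UNIV (pd b q)"
      if "b \<in> Basis" for b
      using hom_poly_pd[OF pl that] hom_poly_pd[OF hom_poly_pd[OF pl that] that] hom_poly_pd[OF qm that]
      by (auto intro: hom_poly_continuous)
    have "real l * ip sphere_measure p q = (\<integral>x. (\<Sum>b\<in>Basis. (x \<bullet> b) * (pd b p x * q x)) \<partial>sphere_measure)"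
      unfolding ip_def using Euler_hom_poly[OF pl]
      by (simp add: mult.assoc[symmetric] sum_distrib_right[symmetric]) (simp add: mult.assoc)
    also have "\<dots> = (\<Sum>b\<in>Basis. \<integral>x. (x \<bullet> b) * (pd b p x * q x) \<partial>sphere_measure)"
      by (intro Bochner_Integration.integral_sum l2_continuous(2) continuous_intros contp cont)
    finally have "(real l + real m + real DIM('a) - 2) * (real l * ip sphere_measure p q)
        = (\<Sum>b\<in>Basis. (real (l + m - 1) + real DIM('a) - 1) * (\<integral>x. (x \<bullet> b) * (pd b p x * q x) \<partial>sphere_measure))"
      using lm by (simp add: sum_distrib_left of_nat_diff add.assoc)
    also have "\<dots> = (\<Sum>b\<in>Basis. \<integral>x. pd b (\<lambda>x. pd b p x * q x) x \<partial>sphere_measure)"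
      using D by (intro sum.cong refl sphere_integration_by_parts F) auto
    also have "\<dots> = (\<Sum>b\<in>Basis. (\<integral>x. pd b (pd b p) x * q x \<partial>sphere_measure) + (\<integral>x. pd b p x * pd b q x \<partial>sphere_measure))"
    proof (rule sum.cong)
      fix b :: 'a assume b: "b \<in> Basis"
      have "pd b (\<lambda>x. pd b p x * q x) = (\<lambda>x. pd b (pd b p) x * q x + pd b p x * pd b q x)"
        by (intro has_pd_imp_pd has_pd_mult hom_poly_has_pd[OF hom_poly_pd[OF pl]] hom_poly_has_pd[OF qm] b)
      then show "(\<integral>x. pd b (\<lambda>x. pd b p x * q x) x \<partial>sphere_measure)
          = (\<integral>x. pd b (pd b p) x * q x \<partial>sphere_measure) + (\<integral>x. pd b p x * pd b q x \<partial>sphere_measure)"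
        by (simp, intro Bochner_Integration.integral_add l2_continuous(2) continuous_intros contp cont b)
    qed simp
    also have "\<dots> = (\<integral>x. (\<Sum>b\<in>Basis. pd b (pd b p) x * q x) \<partial>sphere_measure)
        + (\<Sum>b\<in>Basis. \<integral>x. pd b p x * pd b q x \<partial>sphere_measure)"
      by (subst Bochner_Integration.integral_sum)
        (auto simp: sum.distrib intro!: l2_continuous(2) continuous_intros contp cont)
    also have "(\<integral>x. (\<Sum>b\<in>Basis. pd b (pd b p) x * q x) \<partial>sphere_measure) = 0"
      using lap by (simp add: sum_distrib_right[symmetric] lap_def)
    finally show ?thesis by simp
  qed
  let ?s = "real l + real m + real DIM('a) - 2"
  have lm: "l + m \<ge> 1" "m + l \<ge> 1" using \<open>l \<noteq> m\<close> by auto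
  have "?s * (real l * ip sphere_measure p q) = ?s * (real m * ip sphere_measure p q)"
    using green[OF p q lm(1)] green[OF q p lm(2)]
    by (simp add: ip_commute[of _ q p] add_ac mult.commute[of "pd _ q _"])
  moreover have "?s > 0" using D by simp
  ultimately show ?thesis using \<open>l \<noteq> m\<close> by simp
qed

section \<open>Density of the spherical harmonics\<close>

text \<open>The parallelogram law with the difference term dropped. It stands in for the triangle
  inequality, because \<open>l2_closure\<close> measures squared distances.\<close>

lemma ip_add_self_le:
  assumes "f \<in> l2 M" "g \<in> l2 M"
  shows "ip M (\<lambda>x. f x + g x) (\<lambda>x. f x + g x) \<le> 2 * ip M f f + 2 * ip M g g"
  using ip_add_self[OF assms] ip_diff_self[OF assms] ip_nonneg[of M "\<lambda>x. f x - g x"] by simp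

definition l2_closure :: "'b measure \<Rightarrow> ('b \<Rightarrow> real) set \<Rightarrow> ('b \<Rightarrow> real) set" where
  "l2_closure M P = {f \<in> l2 M. \<forall>\<epsilon>>0. \<exists>p\<in>P. ip M (\<lambda>x. f x - p x) (\<lambda>x. f x - p x) < \<epsilon>}"

lemma l2_closure_l2: "f \<in> l2_closure M P \<Longrightarrow> f \<in> l2 M"
  by (simp add: l2_closure_def)

lemma l2_closure_lincomb:
  assumes P: "P \<subseteq> l2 M" "fun_subspace P"
    and f: "f \<in> l2_closure M P" and g: "g \<in> l2_closure M P"
  shows "(\<lambda>x. a * f x + b * g x) \<in> l2_closure M P"
proof -
  have fl: "f \<in> l2 M" and gl: "g \<in> l2 M" using f g by (auto simp: l2_closure_def)
  have "\<exists>r\<in>P. ip M (\<lambda>x. (a * f x + b * g x) - r x) (\<lambda>x. (a * f x + b * g x) - r x) < \<epsilon>" if "\<epsilon> > 0" for \<epsilon>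
  proof -
    \<comment> \<open>The summand 1 keeps the denominator positive when \<open>a = b = 0\<close> and
      makes the final estimate strict.\<close>
    define \<delta> where "\<delta> = \<epsilon> / (2 * a\<^sup>2 + 2 * b\<^sup>2 + 1)"
    have c: "2 * a\<^sup>2 + 2 * b\<^sup>2 + 1 > 0" using zero_le_power2[of a] zero_le_power2[of b] by linarith
    have "\<delta> > 0" using that c by (simp add: \<delta>_def)
    then obtain p q where p: "p \<in> P" "ip M (\<lambda>x. f x - p x) (\<lambda>x. f x - p x) < \<delta>"
      and q: "q \<in> P" "ip M (\<lambda>x. g x - q x) (\<lambda>x. g x - q x) < \<delta>"
      using f g by (force simp: l2_closure_def)
    define u v where "u x = f x - p x" and "v x = g x - q x" for x
    have ul: "u \<in> l2 M" and vl: "v \<in> l2 M"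
      using fl gl p(1) q(1) P(1) by (auto simp: u_def[abs_def] v_def[abs_def] intro: l2_diff)
    have "ip M (\<lambda>x. a * u x + b * v x) (\<lambda>x. a * u x + b * v x) \<le> 2 * (a\<^sup>2 * ip M u u) + 2 * (b\<^sup>2 * ip M v v)"
      using ip_add_self_le[OF l2_scale[OF ul, of a] l2_scale[OF vl, of b]]
      by (simp add: ul vl l2_scale ip_scale_left ip_scale_right power2_eq_square)
    also have "\<dots> \<le> 2 * (a\<^sup>2 * \<delta>) + 2 * (b\<^sup>2 * \<delta>)"
      using p(2) q(2) by (intro add_mono mult_left_mono) (auto simp: u_def[abs_def] v_def[abs_def])
    also have "\<dots> < (2 * a\<^sup>2 + 2 * b\<^sup>2 + 1) * \<delta>" using \<open>\<delta> > 0\<close> by (simp add: algebra_simps)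
    also have "\<dots> = \<epsilon>" using c by (simp add: \<delta>_def)
    finally have "ip M (\<lambda>x. a * u x + b * v x) (\<lambda>x. a * u x + b * v x) < \<epsilon>" .
    then show ?thesis
      using fun_subspace_lincomb[OF P(2) p(1) q(1), of a b]
      by (intro bexI[of _ "\<lambda>x. a * p x + b * q x"]) (auto simp: u_def v_def algebra_simps)
  qed
  then show ?thesis using l2_lincomb[OF fl gl] by (simp add: l2_closure_def)
qed

lemma l2_closure_limit:
  assumes P: "P \<subseteq> l2 M" and f: "f \<in> l2 M"
    and appr: "\<And>\<epsilon>. \<epsilon> > 0 \<Longrightarrow> \<exists>g\<in>l2_closure M P. ip M (\<lambda>x. f x - g x) (\<lambda>x. f x - g x) < \<epsilon>"
  shows "f \<in> l2_closure M P"
proof -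
  have "\<exists>p\<in>P. ip M (\<lambda>x. f x - p x) (\<lambda>x. f x - p x) < \<epsilon>" if "\<epsilon> > 0" for \<epsilon>
  proof -
    \<comment> \<open>A quarter each, since \<open>ip_add_self_le\<close> doubles both squared
      distances.\<close>
    have e: "\<epsilon> / 4 > 0" using that by simp
    obtain g where g: "g \<in> l2_closure M P" "ip M (\<lambda>x. f x - g x) (\<lambda>x. f x - g x) < \<epsilon> / 4"
      using appr[OF e] by blast
    obtain p where p: "p \<in> P" "ip M (\<lambda>x. g x - p x) (\<lambda>x. g x - p x) < \<epsilon> / 4"
      using g(1) e unfolding l2_closure_def by blast
    have "ip M (\<lambda>x. (f x - g x) + (g x - p x)) (\<lambda>x. (f x - g x) + (g x - p x))
        \<le> 2 * ip M (\<lambda>x. f x - g x) (\<lambda>x. f x - g x) + 2 * ip M (\<lambda>x. g x - p x) (\<lambda>x. g x - p x)"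
      using f l2_closure_l2[OF g(1)] p(1) P by (intro ip_add_self_le l2_diff) auto
    then show ?thesis using g(2) p by (intro bexI[of _ p]) auto
  qed
  then show ?thesis using f by (simp add: l2_closure_def)
qed

lemma l2_closure_dominated:
  assumes P: "P \<subseteq> l2 M" and f: "f \<in> l2 M" and g: "\<And>n. g n \<in> l2_closure M P"
    and lim: "\<And>x. x \<in> space M \<Longrightarrow> (\<lambda>n. g n x) \<longlonglongrightarrow> f x" and w: "w \<in> l2 M"
    and dom: "\<And>n x. x \<in> space M \<Longrightarrow> \<bar>f x - g n x\<bar> \<le> w x"
  shows "f \<in> l2_closure M P"
proof (rule l2_closure_limit[OF P f])
  fix \<epsilon> :: real assume "\<epsilon> > 0"
  note gl = l2_closure_l2[OF g]
  have "(\<lambda>n. ip M (\<lambda>x. f x - g n x) (\<lambda>x. f x - g n x)) \<longlonglongrightarrow> (\<integral>x. 0 \<partial>M)"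
    unfolding ip_def
  proof (rule integral_dominated_convergence[where w = "\<lambda>x. w x * w x"])
    show "integrable M (\<lambda>x. w x * w x)" by (rule l2_integrable_mult[OF w w])
    show "AE x in M. (\<lambda>n. (f x - g n x) * (f x - g n x)) \<longlonglongrightarrow> 0"
    proof (rule AE_I2)
      fix x assume "x \<in> space M"
      then have "(\<lambda>n. (f x - g n x) * (f x - g n x)) \<longlonglongrightarrow> (f x - f x) * (f x - f x)"
        by (intro tendsto_intros lim)
      then show "(\<lambda>n. (f x - g n x) * (f x - g n x)) \<longlonglongrightarrow> 0" by simp
    qed
    show "AE x in M. norm ((f x - g n x) * (f x - g n x)) \<le> w x * w x" for n
    proof (rule AE_I2)
      fix x assume "x \<in> space M"
      from dom[OF this, of n] have "\<bar>f x - g n x\<bar> \<le> w x" .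
      then show "norm ((f x - g n x) * (f x - g n x)) \<le> w x * w x"
        unfolding real_norm_def abs_mult by (intro mult_mono) auto
    qed
  qed (use f gl in measurable)
  then have "\<forall>\<^sub>F n in sequentially. ip M (\<lambda>x. f x - g n x) (\<lambda>x. f x - g n x) < \<epsilon>"
    using \<open>\<epsilon> > 0\<close> by (intro order_tendstoD) auto
  then obtain n where "ip M (\<lambda>x. f x - g n x) (\<lambda>x. f x - g n x) < \<epsilon>"
    by (auto simp: eventually_sequentially)
  then show "\<exists>g\<in>l2_closure M P. ip M (\<lambda>x. f x - g x) (\<lambda>x. f x - g x) < \<epsilon>" using g by blast
qed

lemma l2_mono:
  assumes f: "f \<in> l2 M" and g: "g \<in> borel_measurable M" and le: "\<And>x. \<bar>g x\<bar> \<le> \<bar>f x\<bar>"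
  shows "g \<in> l2 M"
proof -
  have "integrable M (\<lambda>x. (g x)\<^sup>2)"
  proof (rule Bochner_Integration.integrable_bound)
    show "integrable M (\<lambda>x. (f x)\<^sup>2)" using f by (simp add: l2_def)
    show "(\<lambda>x. (g x)\<^sup>2) \<in> borel_measurable M" using g by measurable
    show "AE x in M. norm ((g x)\<^sup>2) \<le> norm ((f x)\<^sup>2)"
      using le by (intro AE_I2) (simp add: abs_le_square_iff)
  qed
  then show ?thesis using g by (simp add: l2_def)
qed

lemma l2_bounded:
  assumes "finite_measure M" "f \<in> borel_measurable M" "\<And>x. \<bar>f x\<bar> \<le> K"
  shows "f \<in> l2 M"
proof -
  interpret finite_measure M by fact
  have "\<bar>(f x)\<^sup>2\<bar> \<le> K\<^sup>2" for x using power_mono[OF assms(3)[of x], of 2] by simp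
  then have "integrable M (\<lambda>x. (f x)\<^sup>2)"
    using assms(2) by (intro integrable_const_bound[of _ "K\<^sup>2"]) auto
  then show ?thesis using assms(2) by (simp add: l2_def)
qed

text \<open>Measure-theoretic induction: continuous functions approximate indicators of open sets,
  Dynkin's lemma extends this to Borel sets, monotone limits of simple functions reach nonnegative
  functions, and positive and negative parts give the rest.\<close>

lemma l2_closure_continuous_UNIV:
  fixes M :: "'a::metric_space measure"
  assumes fin: "finite_measure M" and sets: "sets M = sets borel"
    and P: "P \<subseteq> l2 M" "fun_subspace P"
    and cont: "\<And>g :: 'a \<Rightarrow> real. continuous_on UNIV g \<Longrightarrow> g \<in> l2_closure M P"
  shows "l2_closure M P = l2 M"
proof -
  note [measurable_cong] = sets
  have space: "space M = UNIV" using sets_eq_imp_space_eq[OF sets] by simp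
  note lincomb = l2_closure_lincomb[OF P]
  have one: "(\<lambda>x. 1) \<in> l2_closure M P" and zero: "(\<lambda>x. 0) \<in> l2_closure M P" by (intro cont continuous_intros)+
  have one_l2: "(\<lambda>x. 1) \<in> l2 M" using l2_closure_l2[OF one] .
  have ind_l2: "indicator A \<in> l2 M" if "A \<in> sets borel" for A :: "'a set"
    using that sets by (intro l2_bounded[OF fin, of _ 1]) (auto simp: indicator_def)
  have op: "indicator U \<in> l2_closure M P" if U: "open U" for U :: "'a set"
  \<comment> \<open>The distance to the empty set is 0 by convention, so for \<open>U = UNIV\<close>
    the functions \<open>g n\<close> below would vanish identically.\<close>
  proof (cases "U = UNIV")
    case True
    then show ?thesis using one by (simp add: indicator_def)
  next
    case False
    define g where "g n x = min 1 (real n * infdist x (- U))" for n x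
    show ?thesis
    proof (rule l2_closure_dominated[OF P(1), where g = g and w = "\<lambda>x. 1"])
      show "indicator U \<in> l2 M" using U by (intro ind_l2) auto
      show "g n \<in> l2_closure M P" for n unfolding g_def[abs_def] by (intro cont continuous_intros)
      show "\<bar>indicator U x - g n x\<bar> \<le> 1" for n x
        using infdist_nonneg[of x "- U"] by (auto simp: g_def indicator_def min_def)
      show "(\<lambda>n. g n x) \<longlonglongrightarrow> indicator U x" for x
      proof (cases "x \<in> U")
        case True
        have pos: "infdist x (- U) > 0"
          using False True U by (intro infdist_pos_not_in_closed) (auto simp: closed_def)
        obtain N where N: "1 < real N * infdist x (- U)" using reals_Archimedean3[OF pos] by blast
        have "g n x = 1" if "n \<ge> N" for n
        proof -
          have "real N * infdist x (- U) \<le> real n * infdist x (- U)"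
            using that pos by (intro mult_right_mono) auto
          then show ?thesis using N by (simp add: g_def)
        qed
        then have "\<forall>\<^sub>F n in sequentially. g n x = 1" by (auto simp: eventually_sequentially)
        then show ?thesis using True by (simp add: tendsto_eventually)
      next
        case xU: False
        then show ?thesis by (simp add: g_def)
      qed
    qed (rule one_l2)
  qed
  have borel: "indicator A \<in> l2_closure M P" if "A \<in> sets borel" for A :: "'a set"
  proof -
    have "Int_stable {S :: 'a set. open S}" "{S :: 'a set. open S} \<subseteq> Pow UNIV"
      "A \<in> sigma_sets UNIV {S. open S}"
      using that by (auto simp: Int_stable_def borel_def)
    then show ?thesis
    proof (induction rule: sigma_sets_induct_disjoint)
      case (compl A)
      have "indicator (UNIV - A) = (\<lambda>x. 1 * 1 + (- 1) * (indicator A x :: real))"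
        by (auto simp: indicator_def)
      then show ?case using lincomb[OF one compl(2), of 1 "-1"] by simp
    next
      case (union A)
      have Ab: "A i \<in> sets borel" for i using union(2) by (auto simp: borel_def)
      show ?case
      proof (rule l2_closure_dominated[OF P(1), where g = "\<lambda>n. indicator (\<Union>i<n. A i)" and w = "\<lambda>x. 1"])
        show "indicator (\<Union>i. A i) \<in> l2 M" using Ab by (intro ind_l2) auto
        show "indicator (\<Union>i<n. A i) \<in> l2_closure M P" for n
        proof -
          have "(\<lambda>x. \<Sum>i<n. 1 * indicator (A i) x) \<in> l2_closure M P"
            by (rule fun_subspace_sum[OF fun_subspaceI[OF zero]]) (use union(3) lincomb in auto)
          moreover have "(\<lambda>x. \<Sum>i<n. 1 * indicator (A i) x) = (indicator (\<Union>i<n. A i) :: 'a \<Rightarrow> real)"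
            using union(1) by (intro ext, subst indicator_UN_disjoint) (auto simp: disjoint_family_on_def)
          ultimately show ?thesis by (simp only:)
        qed
        show "(\<lambda>n. indicator (\<Union>i<n. A i) x) \<longlonglongrightarrow> (indicator (\<Union>i. A i) x :: real)" for x
          by (rule LIMSEQ_indicator_UN)
        show "\<bar>indicator (\<Union>i. A i) x - indicator (\<Union>i<n. A i) x\<bar> \<le> (1 :: real)" for n x
          by (auto simp: indicator_def)
      qed (rule one_l2)
    next
      case empty
      have "indicator {} = (\<lambda>x::'a. 0 :: real)" by auto
      then show ?case using zero by simp
    qed (use op in auto)
  qed
  have nonneg: "u \<in> l2_closure M P" if "u \<in> l2 M" "\<And>x. 0 \<le> u x" for u
  proof -
    \<comment> \<open>Square integrability is a premise inside the induction, whose rule only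
      supplies measurable functions; \<open>l2_mono\<close> hands it down to summands and to the
      approximating sequence.\<close>
    have "u \<in> l2 M \<longrightarrow> u \<in> l2_closure M P"
      using l2_measurable[OF that(1)] that(2)
    proof (induction rule: borel_measurable_induct_real)
      case (set A)
      then show ?case using borel sets by simp
    next
      case (mult u c)
      show ?case
      proof
        assume cu: "(\<lambda>x. c * u x) \<in> l2 M"
        show "(\<lambda>x. c * u x) \<in> l2_closure M P"
        proof (cases "c = 0")
          case True
          then show ?thesis using zero by simp
        next
          case False
          then have "u \<in> l2 M" using l2_scale[OF cu, of "1 / c"] by simp
          then show ?thesis using mult.IH lincomb[of u u c 0] by simp
        qed
      qed
    next
      case (add u v)
      show ?case
      proof
        assume vu: "(\<lambda>x. v x + u x) \<in> l2 M"
        have "u \<in> l2 M" by (rule l2_mono[OF vu add.hyps(1)]) (use add.hyps(2,4) in simp)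
        moreover have "v \<in> l2 M" by (rule l2_mono[OF vu add.hyps(3)]) (use add.hyps(2,4) in simp)
        ultimately have "u \<in> l2_closure M P" "v \<in> l2_closure M P" using add.IH by blast+
        then show "(\<lambda>x. v x + u x) \<in> l2_closure M P" using lincomb[of v u 1 1] by simp
      qed
    next
      case (seq U)
      show ?case
      proof
        assume ul: "u \<in> l2 M"
        have le: "U i x \<le> u x" for i x
          using incseq_le[OF _ seq.hyps(4), of x i] seq.hyps(3) space by (auto simp: incseq_def le_fun_def)
        have "U i \<in> l2 M" for i
          by (rule l2_mono[OF ul seq.hyps(1)]) (simp add: seq.hyps(2) order_trans[OF le abs_ge_self])
        then have "U i \<in> l2_closure M P" for i using seq.IH by blast
        then show "u \<in> l2_closure M P"
        proof (rule l2_closure_dominated[OF P(1) ul])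
          show "\<bar>u x - U i x\<bar> \<le> u x" for i x using le[of i x] seq.hyps(2)[of i x] by simp
        qed (use seq.hyps(4) ul in auto)
      qed
    qed
    then show ?thesis using that(1) by blast
  qed
  have "f \<in> l2_closure M P" if f: "f \<in> l2 M" for f
  proof -
    have part: "(\<lambda>x. max 0 (s * f x)) \<in> l2 M" if "\<bar>s\<bar> \<le> 1" for s
    proof (rule l2_mono[OF f])
      show "\<bar>max 0 (s * f x)\<bar> \<le> \<bar>f x\<bar>" for x
        using mult_right_mono[OF that, of "\<bar>f x\<bar>"] by (auto simp: max_def abs_mult[symmetric])
    qed (use f in measurable)
    have "(\<lambda>x. 1 * max 0 (1 * f x) + (- 1) * max 0 (- 1 * f x)) \<in> l2_closure M P"
      by (intro lincomb nonneg part) auto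
    moreover have "(\<lambda>x. 1 * max 0 (1 * f x) + (- 1) * max 0 (- 1 * f x)) = f" by (auto simp: max_def)
    ultimately show ?thesis by (simp only:)
  qed
  then show ?thesis using l2_closure_l2 by blast
qed

section \<open>Polynomials on the sphere and the Stone-Weierstrass theorem\<close>

lemma harmonics_continuous: "f \<in> harmonics l \<Longrightarrow> continuous_on UNIV f"
  by (auto simp: harmonics_def intro: hom_poly_continuous)

lemma harmonics_upto_continuous: "f \<in> harmonics_upto k \<Longrightarrow> continuous_on UNIV f"
  unfolding harmonics_upto_def using harmonics_continuous by (fastforce intro: continuous_on_sum)

lemma harmonics_l2: "harmonics l \<subseteq> l2 sphere_measure"
  using l2_continuous(1) harmonics_continuous by blast

lemma harmonics_upto_l2: "harmonics_upto k \<subseteq> l2 sphere_measure"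
  using l2_continuous(1) harmonics_upto_continuous by blast

text \<open>Polynomials of mixed degree, as the link between \<open>real_polynomial_function\<close>
  in the Stone-Weierstrass theorem and \<open>hom_poly\<close>, where each summand can be reduced to
  harmonics on the sphere.\<close>

inductive sum_of_hom_polys :: "('a::euclidean_space \<Rightarrow> real) \<Rightarrow> bool" where
  hom: "f \<in> hom_poly k \<Longrightarrow> sum_of_hom_polys f"
| add: "sum_of_hom_polys f \<Longrightarrow> sum_of_hom_polys g \<Longrightarrow> sum_of_hom_polys (\<lambda>x. f x + g x)"

lemma sum_of_hom_polys_mult:
  assumes "sum_of_hom_polys f" "sum_of_hom_polys g"
  shows "sum_of_hom_polys (\<lambda>x. f x * g x)"
  using assms
proof (induction f rule: sum_of_hom_polys.induct)
  case (hom f k)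
  from hom(2,1) show ?case
  proof (induction g rule: sum_of_hom_polys.induct)
    case (hom g m)
    then show ?case using hom_poly_mult sum_of_hom_polys.hom by blast
  next
    case (add g h)
    then show ?case using sum_of_hom_polys.add by (fastforce simp: distrib_left)
  qed
next
  case (add f h)
  then show ?case using sum_of_hom_polys.add by (fastforce simp: distrib_right)
qed

lemma sum_of_hom_polys_sum:
  "finite I \<Longrightarrow> (\<And>i. i \<in> I \<Longrightarrow> sum_of_hom_polys (f i)) \<Longrightarrow> sum_of_hom_polys (\<lambda>x. \<Sum>i\<in>I. f i x)"
  by (induction I rule: finite_induct)
    (auto intro: sum_of_hom_polys.add sum_of_hom_polys.hom[OF hom_poly_zero])

lemma real_polynomial_function_sum_of_hom_polys:
  fixes p :: "'a::euclidean_space \<Rightarrow> real"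
  shows "real_polynomial_function p \<Longrightarrow> sum_of_hom_polys p"
proof (induction rule: real_polynomial_function.induct)
  case (linear f)
  interpret bounded_linear f by fact
  have "f x = (\<Sum>b\<in>Basis. f b * ((x \<bullet> b) * 1))" for x
    by (subst (1) euclidean_representation[of x, symmetric]) (simp only: sum scaleR real_scaleR_def mult_1_right mult_1_left mult.commute)
  then have "f = (\<lambda>x. \<Sum>b\<in>Basis. f b * ((x \<bullet> b) * 1))" by (rule ext)
  moreover have "sum_of_hom_polys (\<lambda>x. \<Sum>b\<in>Basis. f b * ((x \<bullet> b) * 1))"
    by (intro sum_of_hom_polys_sum sum_of_hom_polys.hom[of _ "Suc 0"] hom_poly_scale hom_poly_coord hom_poly_const) auto
  ultimately show ?case by (simp only:)
next
  case (const c)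
  show ?case by (rule sum_of_hom_polys.hom[OF hom_poly_const])
next
  case (add f g)
  then show ?case by (intro sum_of_hom_polys.add)
next
  case (mult f g)
  then show ?case by (intro sum_of_hom_polys_mult)
qed

lemma sum_of_hom_polys_on_sphere:
  "sum_of_hom_polys f \<Longrightarrow> \<exists>k. \<exists>v \<in> harmonics_upto k. \<forall>x \<in> sphere 0 1. f x = v x"
proof (induction rule: sum_of_hom_polys.induct)
  case (hom f k)
  then show ?case using hom_poly_on_sphere by blast
next
  case (add f g)
  then obtain k m u v where "u \<in> harmonics_upto k" "\<forall>x \<in> sphere 0 1. f x = u x"
    "v \<in> harmonics_upto m" "\<forall>x \<in> sphere 0 1. g x = v x" by auto
  moreover from this have "(\<lambda>x. 1 * u x + 1 * v x) \<in> harmonics_upto (max k m)"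
    by (intro harmonics_upto_lincomb) (auto intro: harmonics_upto_mono)
  ultimately show ?case
    by (intro exI[of _ "max k m"] bexI[of _ "\<lambda>x. 1 * u x + 1 * v x"]) auto
qed

text \<open>Polynomials are uniformly dense among continuous functions on the sphere by
  Stone-Weierstrass, and each of them agrees there with an element of some V_k. As the measure is
  finite, uniform closeness gives closeness in L_2.\<close>

lemma harmonics_dense:
  "l2_closure sphere_measure (\<Union>k. harmonics_upto k) = l2 (sphere_measure :: 'a::euclidean_space measure)"
proof (rule l2_closure_continuous_UNIV[OF finite_measure_sphere_measure sets_sphere_measure])
  show "(\<Union>k. harmonics_upto k) \<subseteq> l2 (sphere_measure :: 'a measure)" using harmonics_upto_l2 by blast
  have "(\<lambda>x. a * p x + b * q x) \<in> (\<Union>k. harmonics_upto k)"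
    if "p \<in> (\<Union>k. harmonics_upto k)" "q \<in> (\<Union>k. harmonics_upto k)" for p q :: "'a \<Rightarrow> real" and a b
  proof -
    from that obtain k m where "p \<in> harmonics_upto k" "q \<in> harmonics_upto m" by auto
    then have "(\<lambda>x. a * p x + b * q x) \<in> harmonics_upto (max k m)"
      by (intro harmonics_upto_lincomb) (auto intro: harmonics_upto_mono)
    then show ?thesis by blast
  qed
  then show "fun_subspace (\<Union>k. harmonics_upto k :: ('a \<Rightarrow> real) set)"
    by (intro fun_subspaceI) (auto intro: harmonics_upto_zero)
next
  fix g :: "'a \<Rightarrow> real" assume g: "continuous_on UNIV g"
  interpret finite_measure "sphere_measure :: 'a measure" by (rule finite_measure_sphere_measure)
  define m where "m = measure (sphere_measure :: 'a measure) UNIV"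
  have gl: "g \<in> l2 sphere_measure" using g by (rule l2_continuous)
  have "\<exists>p\<in>(\<Union>k. harmonics_upto k). ip sphere_measure (\<lambda>x. g x - p x) (\<lambda>x. g x - p x) < \<epsilon>" if "\<epsilon> > 0" for \<epsilon>
  proof -
    \<comment> \<open>With \<open>m\<close> the total mass, the squared error is at most m
      \<delta>^2 = m \<epsilon>/(m + 1) < \<epsilon>.\<close>
    define \<delta> where "\<delta> = sqrt (\<epsilon> / (m + 1))"
    have m: "m \<ge> 0" by (simp add: m_def)
    have \<delta>: "\<delta> > 0" using that m by (simp add: \<delta>_def)
    obtain p where p: "real_polynomial_function p" "\<And>x. x \<in> sphere 0 1 \<Longrightarrow> \<bar>g x - p x\<bar> < \<delta>"
      using Stone_Weierstrass_real_polynomial_function[OF compact_sphere, of 0 1 g \<delta>] \<delta>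
        continuous_on_subset[OF g] by blast
    obtain k v where v: "v \<in> harmonics_upto k" "\<And>x. x \<in> sphere 0 1 \<Longrightarrow> p x = v x"
      using sum_of_hom_polys_on_sphere[OF real_polynomial_function_sum_of_hom_polys[OF p(1)]] by blast
    have vl: "v \<in> l2 sphere_measure" using v(1) harmonics_upto_l2 by blast
    have "ip sphere_measure (\<lambda>x. g x - v x) (\<lambda>x. g x - v x) \<le> (\<integral>x. \<delta>\<^sup>2 \<partial>(sphere_measure :: 'a measure))"
      unfolding ip_def
    proof (rule integral_mono_AE)
      show "integrable sphere_measure (\<lambda>x. (g x - v x) * (g x - v x))"
        by (intro l2_integrable_mult l2_diff gl vl)
      show "AE x in sphere_measure. (g x - v x) * (g x - v x) \<le> \<delta>\<^sup>2"
        using AE_sphere_norm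
      proof eventually_elim
        case (elim x)
        then have "\<bar>g x - v x\<bar> \<le> \<bar>\<delta>\<bar>" using p(2)[of x] v(2)[of x] \<delta> by simp
        then show ?case by (simp only: abs_le_square_iff power2_eq_square)
      qed
    qed simp
    also have "\<dots> = m * (\<epsilon> / (m + 1))" using m that by (simp add: m_def \<delta>_def)
    also have "\<dots> < \<epsilon>" using m that by (simp add: field_simps)
    finally show ?thesis using v(1) by blast
  qed
  then show "g \<in> l2_closure sphere_measure (\<Union>k. harmonics_upto k)" using gl by (simp add: l2_closure_def)
qed

section \<open>Projections onto the harmonics and Parseval's identity\<close>

lemma AE_sphere_cong:
  assumes "\<And>x. x \<in> sphere 0 1 \<Longrightarrow> P (x :: 'a::euclidean_space)"
  shows "AE x in sphere_measure. P x"
  using AE_sphere_norm by eventually_elim (use assms in auto)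

text \<open>\<open>sph_proj\<close> is a \<open>SOME\<close> choice, so an orthogonal projection
  must first be shown to exist. It comes from \<open>finite_dim_orthonormal_projection\<close>, with
  the monomials of degree \<open>l\<close> as spanning family.\<close>

lemma sph_proj:
  fixes f :: "'a::euclidean_space \<Rightarrow> real"
  assumes f: "f \<in> l2 sphere_measure"
  shows "sph_proj l f \<in> harmonics l"
    and "h \<in> harmonics l \<Longrightarrow> ip sphere_measure (\<lambda>x. f x - sph_proj l f x) h = 0"
proof -
  have span: "\<forall>v\<in>harmonics l. \<exists>c. AE x in sphere_measure. v (x :: 'a) = (\<Sum>\<alpha>\<in>exponents l. c \<alpha> * mono_eval \<alpha> x)"
  proof
    fix v :: "'a \<Rightarrow> real" assume "v \<in> harmonics l"
    then have "v \<in> hom_poly l" by (simp add: harmonics_def)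
    then obtain c where c: "\<forall>x. v x = (\<Sum>\<alpha>\<in>exponents l. c \<alpha> * mono_eval \<alpha> x)"
      using hom_poly_span_monomials by blast
    show "\<exists>c. AE x in sphere_measure. v x = (\<Sum>\<alpha>\<in>exponents l. c \<alpha> * mono_eval \<alpha> x)"
      by (intro exI[of _ c] AE_I2 c[rule_format])
  qed
  from finite_dim_orthonormal_projection[OF harmonics_l2 harmonics_subspace finite_exponents span]
  obtain n and e :: "nat \<Rightarrow> 'a \<Rightarrow> real" where ne: "n \<le> card (exponents l :: ('a \<Rightarrow> nat) set) \<and> (\<forall>i<n. e i \<in> harmonics l) \<and>
      (\<forall>f\<in>l2 sphere_measure. \<forall>h\<in>harmonics l.
        ip sphere_measure (\<lambda>x. f x - (\<Sum>i<n. ip sphere_measure f (e i) * e i x)) h = 0)"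
    by (elim exE) (rule that)
  note e = ne[THEN conjunct2, THEN conjunct1] ne[THEN conjunct2, THEN conjunct2]
  define g where "g = (\<lambda>x. \<Sum>i<n. ip sphere_measure f (e i) * e i x)"
  have "g \<in> harmonics l" unfolding g_def
    by (rule fun_subspace_sum[OF harmonics_subspace]) (use e in auto)
  moreover have "\<forall>h\<in>harmonics l. ip sphere_measure (\<lambda>x. f x - g x) h = 0"
    using e(2) f by (simp add: g_def)
  ultimately have "\<exists>g. g \<in> sph_harm l \<and>
      (\<forall>h\<in>sph_harm l. (\<integral>x. (f x - g x) * h x \<partial>sphere_measure) = 0)"
    unfolding sph_harm_eq ip_def by blast
  from someI_ex[OF this, folded sph_proj_def]
  show "sph_proj l f \<in> harmonics l"
    "h \<in> harmonics l \<Longrightarrow> ip sphere_measure (\<lambda>x. f x - sph_proj l f x) h = 0"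
    unfolding sph_harm_eq ip_def by auto
qed

text \<open>Pythagoras: \<open>g - p\<close> lies in \<open>W\<close> and is therefore orthogonal to
  the residual \<open>f - g\<close>.\<close>

lemma best_approximation:
  assumes W: "W \<subseteq> l2 M" "fun_subspace W"
    and f: "f \<in> l2 M" and g: "g \<in> W" and orth: "\<And>h. h \<in> W \<Longrightarrow> ip M (\<lambda>x. f x - g x) h = 0"
    and p: "p \<in> W"
  shows "ip M (\<lambda>x. f x - g x) (\<lambda>x. f x - g x) \<le> ip M (\<lambda>x. f x - p x) (\<lambda>x. f x - p x)"
proof -
  have gp: "(\<lambda>x. g x - p x) \<in> W" using fun_subspace_lincomb[OF W(2) g p, of 1 "-1"] by simp
  have "ip M (\<lambda>x. (f x - g x) + (g x - p x)) (\<lambda>x. (f x - g x) + (g x - p x))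
      = ip M (\<lambda>x. f x - g x) (\<lambda>x. f x - g x) + 2 * ip M (\<lambda>x. f x - g x) (\<lambda>x. g x - p x)
        + ip M (\<lambda>x. g x - p x) (\<lambda>x. g x - p x)"
    using f g p gp W(1) by (intro ip_add_self l2_diff) auto
  then show ?thesis using orth[OF gp] ip_nonneg[of M "\<lambda>x. g x - p x"] by simp
qed

text \<open>Since different degrees are orthogonal, pairing the sum with a harmonic of degree
  \<open>m\<close> leaves only the \<open>m\<close>-th projection. Hence the sum of the projections
  is the projection onto V_k, and the error formula is Pythagoras.\<close>

lemma sph_proj_partial_sum:
  fixes f :: "'a::euclidean_space \<Rightarrow> real"
  assumes f: "f \<in> l2 sphere_measure" and D: "DIM('a) \<ge> 3"
  defines "S k \<equiv> (\<lambda>x. \<Sum>l\<le>k. sph_proj l f x)"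
  shows "S k \<in> harmonics_upto k"
    and "h \<in> harmonics_upto k \<Longrightarrow> ip sphere_measure (\<lambda>x. f x - S k x) h = 0"
    and "ip sphere_measure (\<lambda>x. f x - S k x) (\<lambda>x. f x - S k x)
      = ip sphere_measure f f - (\<Sum>l\<le>k. ip sphere_measure (sph_proj l f) (sph_proj l f))"
proof -
  note Pl = sph_proj(1)[OF f]
  have Pl2: "sph_proj l f \<in> l2 sphere_measure" for l using Pl[of l] harmonics_l2 by blast
  show S: "S k \<in> harmonics_upto k" unfolding harmonics_upto_def S_def
    using Pl by (intro CollectI exI[of _ "\<lambda>l. sph_proj l f"]) auto
  then have Sl: "S k \<in> l2 sphere_measure" using harmonics_upto_l2 by blast
  have Sh: "ip sphere_measure (S k) h = ip sphere_measure f h"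
    and Sp: "ip sphere_measure (S k) h = ip sphere_measure (sph_proj m f) h"
    if "h \<in> harmonics m" "m \<le> k" for h m
  proof -
    have hl: "h \<in> l2 sphere_measure" using that harmonics_l2 by blast
    have "ip sphere_measure (S k) h = (\<Sum>l\<le>k. ip sphere_measure (sph_proj l f) h)"
      unfolding S_def using ip_sum_left[of "{..k}" "\<lambda>l. sph_proj l f" sphere_measure h "\<lambda>_. 1"] Pl2 hl by simp
    also have "\<dots> = (\<Sum>l\<le>k. if l = m then ip sphere_measure (sph_proj m f) h else 0)"
      using harmonics_orthogonal[OF Pl that(1) _ D] by (intro sum.cong) auto
    also have "\<dots> = ip sphere_measure (sph_proj m f) h" using that by simp
    finally show *: "ip sphere_measure (S k) h = ip sphere_measure (sph_proj m f) h" .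
    show "ip sphere_measure (S k) h = ip sphere_measure f h"
      using * sph_proj(2)[OF f that(1)] ip_diff_left[OF f Pl2 hl] by simp
  qed
  show orth: "ip sphere_measure (\<lambda>x. f x - S k x) h = 0" if "h \<in> harmonics_upto k" for h
  proof -
    from that obtain u where u: "\<And>l. u l \<in> harmonics l" "h = (\<lambda>x. \<Sum>l\<le>k. 1 * u l x)"
      by (auto simp: harmonics_upto_def)
    have ul: "u l \<in> l2 sphere_measure" for l using u(1)[of l] harmonics_l2 by blast
    have fS: "(\<lambda>x. f x - S k x) \<in> l2 sphere_measure" by (intro l2_diff f Sl)
    have "ip sphere_measure h (\<lambda>x. f x - S k x) = (\<Sum>l\<le>k. 1 * ip sphere_measure (u l) (\<lambda>x. f x - S k x))"
      unfolding u(2) by (rule ip_sum_left) (use ul fS in auto)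
    also have "\<dots> = 0"
    proof (intro sum.neutral ballI)
      fix l assume "l \<in> {..k}"
      then have "ip sphere_measure (\<lambda>x. f x - S k x) (u l) = 0"
        using Sh[OF u(1)[of l]] ip_diff_left[OF f Sl ul] by simp
      then show "1 * ip sphere_measure (u l) (\<lambda>x. f x - S k x) = 0" by (simp add: ip_commute)
    qed
    finally show ?thesis by (simp add: ip_commute)
  qed
  have "ip sphere_measure (S k) (S k) = (\<Sum>l\<le>k. 1 * ip sphere_measure (sph_proj l f) (S k))"
    using ip_sum_left[of "{..k}" "\<lambda>l. sph_proj l f" sphere_measure "S k" "\<lambda>_. 1"] Pl2 Sl
    unfolding S_def by simp
  also have "\<dots> = (\<Sum>l\<le>k. ip sphere_measure (sph_proj l f) (sph_proj l f))"
    using Sp[OF Pl] ip_commute[of sphere_measure "S k"] by (intro sum.cong) auto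
  finally have SS: "ip sphere_measure (S k) (S k) = (\<Sum>l\<le>k. ip sphere_measure (sph_proj l f) (sph_proj l f))" .
  have "ip sphere_measure f (S k) = ip sphere_measure (S k) (S k)"
    using orth[OF S] ip_diff_left[OF f Sl Sl] by simp
  then show "ip sphere_measure (\<lambda>x. f x - S k x) (\<lambda>x. f x - S k x)
      = ip sphere_measure f f - (\<Sum>l\<le>k. ip sphere_measure (sph_proj l f) (sph_proj l f))"
    using ip_diff_self[OF f Sl] SS by simp
qed

text \<open>Density provides an approximant in some V_K. For \<open>k \<ge> K\<close> the partial
  sum is the best approximation from the larger space V_k, so its error, the gap in the identity, is
  no bigger.\<close>

lemma Parseval_sph_proj:
  fixes f :: "'a::euclidean_space \<Rightarrow> real"
  assumes f: "f \<in> l2 sphere_measure" and D: "DIM('a) \<ge> 3"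
  shows "(\<lambda>l. ip sphere_measure (sph_proj l f) (sph_proj l f)) sums ip sphere_measure f f"
proof -
  let ?a = "\<lambda>l. ip sphere_measure (sph_proj l f) (sph_proj l f)"
  have "(\<lambda>k. \<Sum>l\<le>k. ?a l) \<longlonglongrightarrow> ip sphere_measure f f"
  proof (rule LIMSEQ_I)
    fix \<epsilon> :: real assume "\<epsilon> > 0"
    have "f \<in> l2_closure sphere_measure (\<Union>k. harmonics_upto k)" using f harmonics_dense by auto
    then obtain K p where p: "p \<in> harmonics_upto K"
      "ip sphere_measure (\<lambda>x. f x - p x) (\<lambda>x. f x - p x) < \<epsilon>"
      using \<open>\<epsilon> > 0\<close> unfolding l2_closure_def by blast
    have "norm ((\<Sum>l\<le>k. ?a l) - ip sphere_measure f f) < \<epsilon>" if "k \<ge> K" for k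
    proof -
      note S = sph_proj_partial_sum[OF f D, where k = k]
      have "ip sphere_measure f f - (\<Sum>l\<le>k. ?a l) \<le> ip sphere_measure (\<lambda>x. f x - p x) (\<lambda>x. f x - p x)"
        unfolding S(3)[symmetric]
        by (rule best_approximation[OF harmonics_upto_l2 harmonics_upto_subspace f S(1,2)
              harmonics_upto_mono[OF p(1) that]])
      moreover have "0 \<le> ip sphere_measure f f - (\<Sum>l\<le>k. ?a l)"
        unfolding S(3)[symmetric] by (rule ip_nonneg)
      ultimately show ?thesis using p(2) by simp
    qed
    then show "\<exists>K. \<forall>k\<ge>K. norm ((\<Sum>l\<le>k. ?a l) - ip sphere_measure f f) < \<epsilon>" by blast
  qed
  then show ?thesis by (simp add: sums_def_le)
qed

section \<open>Approximation numbers\<close>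

lemma L2_sphere_eq: "L2_sphere = l2 sphere_measure"
  by (simp add: L2_sphere_def l2_def)

lemma L2_norm_sphere_eq: "L2_norm_sphere f = sqrt (ip sphere_measure f f)"
  by (simp add: L2_norm_sphere_def ip_def power2_eq_square)

lemma HLambda_l2: "f \<in> HLambda lam \<Longrightarrow> f \<in> l2 sphere_measure"
  by (simp add: HLambda_def L2_sphere_eq)

lemma HLambda_sums:
  assumes "f \<in> HLambda lam"
  shows "(\<lambda>l. ip sphere_measure (sph_proj l f) (sph_proj l f) / (lam l)\<^sup>2) sums (HLambda_norm lam f)\<^sup>2"
proof -
  have eq: "(L2_norm_sphere (sph_proj l f) / lam l)\<^sup>2 = ip sphere_measure (sph_proj l f) (sph_proj l f) / (lam l)\<^sup>2" for l
    by (simp add: L2_norm_sphere_eq power_divide ip_nonneg)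
  have s: "summable (\<lambda>l. (L2_norm_sphere (sph_proj l f) / lam l)\<^sup>2)" using assms by (simp add: HLambda_def)
  then have "(HLambda_norm lam f)\<^sup>2 = (\<Sum>l. (L2_norm_sphere (sph_proj l f) / lam l)\<^sup>2)"
    by (simp add: HLambda_norm_def suminf_nonneg)
  then show ?thesis using summable_sums[OF s] by (simp add: eq)
qed

text \<open>By Parseval the left-hand side is the sum over degrees at least \<open>k\<close>, where
  \<open>lam l \<le> lam k\<close>. This is the error estimate of the upper bound;
  \<open>k = 0\<close> is the embedding into L_2.\<close>

lemma tail_bound:
  fixes f :: "'a::euclidean_space \<Rightarrow> real"
  assumes f: "f \<in> HLambda lam" and pos: "\<And>l. lam l > 0" and noninc: "decseq lam" and D: "DIM('a) \<ge> 3"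
  shows "ip sphere_measure f f - (\<Sum>l<k. ip sphere_measure (sph_proj l f) (sph_proj l f))
    \<le> (lam k)\<^sup>2 * (HLambda_norm lam f)\<^sup>2"
proof -
  let ?a = "\<lambda>l. ip sphere_measure (sph_proj l f) (sph_proj l f)"
  have fin: "(\<lambda>l. if l \<in> {..<k} then ?a l else 0) sums (\<Sum>l<k. ?a l)"
    by (rule sums_If_finite_set) simp
  have "ip sphere_measure f f \<le> (\<Sum>l<k. ?a l) + (lam k)\<^sup>2 * (HLambda_norm lam f)\<^sup>2"
  proof (rule sums_le[OF _ Parseval_sph_proj[OF HLambda_l2[OF f] D] sums_add[OF fin sums_mult[OF HLambda_sums[OF f]]]])
    fix l
    show "?a l \<le> (if l \<in> {..<k} then ?a l else 0) + (lam k)\<^sup>2 * (?a l / (lam l)\<^sup>2)"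
    proof (cases "l < k")
      case True
      then show ?thesis by (simp add: ip_nonneg)
    next
      case False
      then have "(lam l)\<^sup>2 \<le> (lam k)\<^sup>2" using noninc pos by (intro power_mono) (auto simp: decseq_def less_imp_le)
      then have "?a l * (lam l)\<^sup>2 \<le> ?a l * (lam k)\<^sup>2" by (intro mult_left_mono ip_nonneg)
      then show ?thesis using False pos[of l] by (simp add: field_simps)
    qed
  qed
  then show ?thesis by simp
qed

lemma L2_norm_le_HLambda_norm:
  fixes f :: "'a::euclidean_space \<Rightarrow> real"
  assumes f: "f \<in> HLambda lam" and pos: "\<And>l. lam l > 0" and noninc: "decseq lam" and D: "DIM('a) \<ge> 3"
  shows "L2_norm_sphere f \<le> lam 0 * HLambda_norm lam f"
proof -
  have "HLambda_norm lam f \<ge> 0"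
    using HLambda_sums[OF f] by (simp add: HLambda_norm_def suminf_nonneg)
       (use f in \<open>auto simp: HLambda_def intro: suminf_nonneg\<close>)
  then show ?thesis
    using tail_bound[OF f pos noninc D, of 0] pos[of 0] unfolding L2_norm_sphere_eq
    by (intro real_le_lsqrt) (auto simp: power_mult_distrib)
qed

text \<open>A Bernstein-type inequality: only degrees up to \<open>k\<close> contribute, and there
  \<open>1 / lam l \<le> 1 / lam k\<close>.\<close>

lemma harmonics_upto_HLambda:
  fixes f :: "'a::euclidean_space \<Rightarrow> real"
  assumes f: "f \<in> harmonics_upto k" and pos: "\<And>l. lam l > 0" and noninc: "decseq lam" and D: "DIM('a) \<ge> 3"
  shows "f \<in> HLambda lam" and "HLambda_norm lam f \<le> L2_norm_sphere f / lam k"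
proof -
  have fl: "f \<in> l2 sphere_measure" using f harmonics_upto_l2 by blast
  obtain u where u: "\<And>l. u l \<in> harmonics l" "f = (\<lambda>x. \<Sum>l\<le>k. 1 * u l x)"
    using f by (auto simp: harmonics_upto_def)
  let ?a = "\<lambda>l. ip sphere_measure (sph_proj l f) (sph_proj l f)"
  \<comment> \<open>\<open>f\<close> is orthogonal to all harmonics of degree \<open>l\<close>, in
    particular to its own projection, whose squared norm equals that inner product.\<close>
  have a0: "?a l = 0" if "l > k" for l
  proof -
    note P = sph_proj(1)[OF fl, of l] sph_proj(2)[OF fl, of _ l]
    have Pl: "sph_proj l f \<in> l2 sphere_measure" using P(1) harmonics_l2 by blast
    have "ip sphere_measure f (sph_proj l f) = (\<Sum>m\<le>k. 1 * ip sphere_measure (u m) (sph_proj l f))"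
      unfolding u(2) by (rule ip_sum_left) (use u(1) harmonics_l2 Pl[unfolded u(2)] in auto)
    also have "\<dots> = 0" using that harmonics_orthogonal[OF u(1) P(1) _ D] by (intro sum.neutral) auto
    finally show ?thesis using P(2)[OF P(1)] ip_diff_left[OF fl Pl Pl] by simp
  qed
  have eq: "(L2_norm_sphere (sph_proj l f) / lam l)\<^sup>2 = ?a l / (lam l)\<^sup>2" for l
    by (simp add: L2_norm_sphere_eq power_divide ip_nonneg)
  have le: "?a l / (lam l)\<^sup>2 \<le> ?a l / (lam k)\<^sup>2" for l
  proof (cases "l \<le> k")
    case True
    then have "(lam k)\<^sup>2 \<le> (lam l)\<^sup>2" using noninc pos by (intro power_mono) (auto simp: decseq_def less_imp_le)
    then show ?thesis using pos[of k] pos[of l] by (intro divide_left_mono ip_nonneg) auto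
  next
    case False
    then show ?thesis using a0[of l] by simp
  qed
  have P: "(\<lambda>l. ?a l / (lam k)\<^sup>2) sums (ip sphere_measure f f / (lam k)\<^sup>2)"
    by (intro sums_divide Parseval_sph_proj fl D)
  have "summable (\<lambda>l. ?a l / (lam l)\<^sup>2)"
  proof (rule summable_comparison_test[OF _ sums_summable[OF P]], intro exI allI impI)
    show "norm (?a l / (lam l)\<^sup>2) \<le> ?a l / (lam k)\<^sup>2" for l
      using le[of l] by (simp add: ip_nonneg)
  qed
  then have "summable (\<lambda>l. (L2_norm_sphere (sph_proj l f) / lam l)\<^sup>2)" unfolding eq .
  then show fH: "f \<in> HLambda lam" using fl by (simp add: HLambda_def L2_sphere_eq)
  have "(HLambda_norm lam f)\<^sup>2 \<le> ip sphere_measure f f / (lam k)\<^sup>2"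
    by (rule sums_le[OF le HLambda_sums[OF fH] P])
  also have "\<dots> = (L2_norm_sphere f / lam k)\<^sup>2" by (simp add: L2_norm_sphere_eq power_divide ip_nonneg)
  finally show "HLambda_norm lam f \<le> L2_norm_sphere f / lam k"
    by (rule power2_le_imp_le) (use pos[of k] in \<open>simp add: L2_norm_sphere_eq ip_nonneg\<close>)
qed

lemma L2_norm_sphere_sum_le:
  assumes "\<And>i. i < (n :: nat) \<Longrightarrow> g i \<in> l2 sphere_measure"
  shows "L2_norm_sphere (\<lambda>x. \<Sum>i<n. c i * g i x) \<le> (\<Sum>i<n. \<bar>c i\<bar> * L2_norm_sphere (g i))"
  using assms
proof (induction n)
  case 0
  show ?case by (simp add: L2_norm_sphere_def)
next
  case (Suc n)
  have sc: "L2_norm_sphere (\<lambda>x. c n * g n x) = \<bar>c n\<bar> * L2_norm_sphere (g n)"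
    using Suc.prems[of n]
    by (simp add: L2_norm_sphere_eq ip_scale_left ip_scale_right l2_scale real_sqrt_mult real_sqrt_abs2 mult.assoc[symmetric])
  have "L2_norm_sphere (\<lambda>x. (\<Sum>i<n. c i * g i x) + c n * g n x)
      \<le> L2_norm_sphere (\<lambda>x. \<Sum>i<n. c i * g i x) + L2_norm_sphere (\<lambda>x. c n * g n x)"
    unfolding L2_norm_sphere_eq
    by (rule l2_norm_triangle) (use Suc.prems in \<open>auto intro!: l2_sum l2_scale\<close>)
  then show ?case using Suc sc by simp
qed

definition approx_error :: "(nat \<Rightarrow> real) \<Rightarrow> nat \<Rightarrow> (nat \<Rightarrow> ('a::euclidean_space \<Rightarrow> real) \<Rightarrow> real) \<Rightarrow>
    (nat \<Rightarrow> 'a \<Rightarrow> real) \<Rightarrow> real" where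
  "approx_error lam n L g = (SUP f \<in> {f \<in> HLambda lam. HLambda_norm lam f \<le> 1}.
     L2_norm_sphere (\<lambda>x. f x - (\<Sum>i<n. L i f * g i x)))"

definition admissible :: "(nat \<Rightarrow> real) \<Rightarrow> nat \<Rightarrow> (nat \<Rightarrow> ('a::euclidean_space \<Rightarrow> real) \<Rightarrow> real) \<Rightarrow>
    (nat \<Rightarrow> 'a \<Rightarrow> real) \<Rightarrow> bool" where
  "admissible lam n L g \<longleftrightarrow> (\<forall>i<n. L i \<in> HLambda_dual lam) \<and> (\<forall>i<n. g i \<in> L2_sphere)"

lemma approx_num_eq:
  "approx_num TYPE('a::euclidean_space) lam n =
    Inf {approx_error lam n L (g :: nat \<Rightarrow> 'a \<Rightarrow> real) | L g. admissible lam n L g}"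
  unfolding approx_num_def approx_error_def admissible_def
  by (intro arg_cong[of _ _ Inf]) auto

text \<open>A supremum of reals says something only about bounded sets. Here the embedding into L_2
  bounds \<open>f\<close>, and continuity of the functionals bounds the finite sum.\<close>

lemma approx_error_bdd_above:
  fixes g :: "nat \<Rightarrow> 'a::euclidean_space \<Rightarrow> real"
  assumes adm: "admissible lam n L g" and pos: "\<And>l. lam l > 0" and noninc: "decseq lam" and D: "DIM('a) \<ge> 3"
  shows "bdd_above ((\<lambda>f. L2_norm_sphere (\<lambda>x. f x - (\<Sum>i<n. L i f * g i x))) `
    {f \<in> HLambda lam. HLambda_norm lam f \<le> 1})"
proof -
  have gl: "\<And>i. i < n \<Longrightarrow> g i \<in> l2 sphere_measure" using adm by (simp add: admissible_def L2_sphere_eq)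
  have "\<exists>C. \<forall>f\<in>HLambda lam. \<bar>L i f\<bar> \<le> C * HLambda_norm lam f" if "i < n" for i
    using adm that by (auto simp: admissible_def HLambda_dual_def)
  then obtain C where C: "\<And>i f. i < n \<Longrightarrow> f \<in> HLambda lam \<Longrightarrow> \<bar>L i f\<bar> \<le> C i * HLambda_norm lam f" by metis
  show ?thesis
  proof (rule bdd_aboveI2)
    fix f :: "'a \<Rightarrow> real" assume "f \<in> {f \<in> HLambda lam. HLambda_norm lam f \<le> 1}"
    then have f: "f \<in> HLambda lam" "HLambda_norm lam f \<le> 1" by auto
    have fl: "f \<in> l2 sphere_measure" using f(1) by (rule HLambda_l2)
    have h0: "HLambda_norm lam f \<ge> 0"
      using f(1) by (auto simp: HLambda_norm_def HLambda_def intro: suminf_nonneg)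
    have Lb: "\<bar>L i f\<bar> \<le> \<bar>C i\<bar>" if "i < n" for i
    proof -
      have "\<bar>L i f\<bar> \<le> C i * HLambda_norm lam f" using C that f(1) by blast
      also have "\<dots> \<le> \<bar>C i\<bar> * 1" using h0 f(2) by (intro mult_mono) auto
      finally show ?thesis by simp
    qed
    have "L2_norm_sphere (\<lambda>x. f x + (\<Sum>i<n. (- L i f) * g i x))
        \<le> L2_norm_sphere f + L2_norm_sphere (\<lambda>x. \<Sum>i<n. (- L i f) * g i x)"
      unfolding L2_norm_sphere_eq by (rule l2_norm_triangle[OF fl l2_sum]) (use gl in auto)
    also have "L2_norm_sphere f \<le> lam 0 * HLambda_norm lam f"
      by (rule L2_norm_le_HLambda_norm[OF f(1) pos noninc D])
    also have "\<dots> \<le> lam 0" using pos[of 0] f(2) by simp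
    also have "L2_norm_sphere (\<lambda>x. \<Sum>i<n. (- L i f) * g i x) \<le> (\<Sum>i<n. \<bar>- L i f\<bar> * L2_norm_sphere (g i))"
      by (rule L2_norm_sphere_sum_le[OF gl])
    also have "\<dots> \<le> (\<Sum>i<n. \<bar>C i\<bar> * L2_norm_sphere (g i))"
      using Lb by (intro sum_mono mult_right_mono) (auto simp: L2_norm_sphere_eq ip_nonneg)
    finally show "L2_norm_sphere (\<lambda>x. f x - (\<Sum>i<n. L i f * g i x))
        \<le> lam 0 + (\<Sum>i<n. \<bar>C i\<bar> * L2_norm_sphere (g i))"
      by (simp add: sum_negf)
  qed
qed

lemma zero_HLambda:
  fixes lam :: "nat \<Rightarrow> real"
  assumes "\<And>l. lam l > 0" "decseq lam" "DIM('a::euclidean_space) \<ge> 3"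
  shows "(\<lambda>x::'a. 0) \<in> {f \<in> HLambda lam. HLambda_norm lam f \<le> 1}"
  using harmonics_upto_HLambda[of "\<lambda>x::'a. 0" 0 lam] assms by (simp add: L2_norm_sphere_def)

lemma approx_error_nonneg:
  fixes g :: "nat \<Rightarrow> 'a::euclidean_space \<Rightarrow> real"
  assumes "admissible lam n L g" "\<And>l. lam l > 0" "decseq lam" "DIM('a) \<ge> 3"
  shows "approx_error lam n L g \<ge> 0"
  unfolding approx_error_def
  by (rule cSUP_upper2[OF approx_error_bdd_above[OF assms] zero_HLambda[OF assms(2-4)]])
    (simp add: L2_norm_sphere_eq ip_nonneg)

section \<open>The two bounds for the approximation numbers\<close>

lemma exponents_disjoint: "j \<noteq> k \<Longrightarrow> exponents j \<inter> exponents k = {}"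
  by (auto simp: exponents_def)

text \<open>The functionals are inner products with an orthonormal system of V_(k+1), whose length
  is at most the number of monomials of degrees k+1 and k.\<close>

lemma approx_num_upper:
  fixes lam :: "nat \<Rightarrow> real"
  assumes pos: "\<And>l. lam l > 0" and noninc: "decseq lam" and D: "DIM('a::euclidean_space) \<ge> 3"
    and n: "card (exponents (Suc k) :: ('a \<Rightarrow> nat) set) + card (exponents k :: ('a \<Rightarrow> nat) set) \<le> n"
  shows "approx_num TYPE('a) lam n \<le> lam (Suc (Suc k))"
proof -
  let ?J = "exponents (Suc k) \<union> exponents k :: ('a \<Rightarrow> nat) set"
  have cJ: "card ?J = card (exponents (Suc k) :: ('a \<Rightarrow> nat) set) + card (exponents k :: ('a \<Rightarrow> nat) set)"
    by (intro card_Un_disjoint exponents_disjoint) auto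
  have span: "\<forall>v\<in>harmonics_upto (Suc k). \<exists>c. AE x in sphere_measure. v (x :: 'a) = (\<Sum>\<alpha>\<in>?J. c \<alpha> * mono_eval \<alpha> x)"
  proof
    fix v :: "'a \<Rightarrow> real" assume "v \<in> harmonics_upto (Suc k)"
    then obtain p q where pq: "p \<in> hom_poly (Suc k)" "q \<in> hom_poly k" "\<And>x. x \<in> sphere 0 1 \<Longrightarrow> v x = p x + q x"
      using harmonics_upto_two_degrees by blast
    obtain c c' where c: "\<forall>x. p x = (\<Sum>\<alpha>\<in>exponents (Suc k). c \<alpha> * mono_eval \<alpha> x)"
      "\<forall>x. q x = (\<Sum>\<alpha>\<in>exponents k. c' \<alpha> * mono_eval \<alpha> x)"
      using hom_poly_span_monomials[OF pq(1)] hom_poly_span_monomials[OF pq(2)] by blast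
    \<comment> \<open>The two exponent sets are disjoint, so the two coefficient families can be
      glued into one.\<close>
    define b where "b \<alpha> = (if \<alpha> \<in> exponents k then c' \<alpha> else c \<alpha>)" for \<alpha>
    have "p x + q x = (\<Sum>\<alpha>\<in>?J. b \<alpha> * mono_eval \<alpha> x)" for x
    proof -
      have "(\<Sum>\<alpha>\<in>?J. b \<alpha> * mono_eval \<alpha> x)
          = (\<Sum>\<alpha>\<in>exponents (Suc k). b \<alpha> * mono_eval \<alpha> x) + (\<Sum>\<alpha>\<in>exponents k. b \<alpha> * mono_eval \<alpha> x)"
        by (intro sum.union_disjoint exponents_disjoint) auto
      also have "(\<Sum>\<alpha>\<in>exponents (Suc k). b \<alpha> * mono_eval \<alpha> x) = p x"
        unfolding c(1)[rule_format] by (intro sum.cong) (auto simp: b_def exponents_def)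
      also have "(\<Sum>\<alpha>\<in>exponents k. b \<alpha> * mono_eval \<alpha> x) = q x"
        unfolding c(2)[rule_format] by (intro sum.cong) (auto simp: b_def)
      finally show ?thesis by simp
    qed
    then have "AE x in sphere_measure. v x = (\<Sum>\<alpha>\<in>?J. b \<alpha> * mono_eval \<alpha> x)"
      using pq(3) by (intro AE_sphere_cong) simp
    then show "\<exists>c. AE x in sphere_measure. v x = (\<Sum>\<alpha>\<in>?J. c \<alpha> * mono_eval \<alpha> x)" by (rule exI[of _ b])
  qed
  have fJ: "finite ?J" by simp
  from finite_dim_orthonormal_projection[OF harmonics_upto_l2 harmonics_upto_subspace fJ span]
  obtain m and e :: "nat \<Rightarrow> 'a \<Rightarrow> real" where me: "m \<le> card ?J \<and> (\<forall>i<m. e i \<in> harmonics_upto (Suc k)) \<and>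
      (\<forall>f\<in>l2 sphere_measure. \<forall>h\<in>harmonics_upto (Suc k).
        ip sphere_measure (\<lambda>x. f x - (\<Sum>i<m. ip sphere_measure f (e i) * e i x)) h = 0)"
    by (elim exE) (rule that)
  note m = me[THEN conjunct1, unfolded cJ, THEN order_trans, OF n]
  have e: "e i \<in> harmonics_upto (Suc k)" "e i \<in> l2 sphere_measure" if "i < m" for i
    using me that harmonics_upto_l2 by blast+
  \<comment> \<open>The orthonormal system has \<open>m \<le> n\<close> elements; zeros fill the
    remaining places.\<close>
  define L where "L i f = (if i < m then ip sphere_measure f (e i) else 0)" for i f
  define g where "g i = (if i < m then e i else (\<lambda>x. 0))" for i
  have adm: "admissible lam n L g"
    unfolding admissible_def
  proof (intro conjI allI impI)
    fix i
    show "g i \<in> L2_sphere" using e by (simp add: L2_sphere_eq g_def)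
    show "L i \<in> HLambda_dual lam"
    proof (cases "i < m")
      case True
      note ei = e(2)[OF True]
      have "\<bar>ip sphere_measure f (e i)\<bar> \<le> (lam 0 * L2_norm_sphere (e i)) * HLambda_norm lam f"
        if f: "f \<in> HLambda lam" for f
      proof -
        have "\<bar>ip sphere_measure f (e i)\<bar> \<le> L2_norm_sphere f * L2_norm_sphere (e i)"
          using ip_Cauchy_Schwarz[OF HLambda_l2[OF f] ei]
          by (simp add: L2_norm_sphere_eq real_sqrt_mult[symmetric] real_le_rsqrt)
        also have "\<dots> \<le> (lam 0 * HLambda_norm lam f) * L2_norm_sphere (e i)"
          by (intro mult_right_mono L2_norm_le_HLambda_norm[OF f pos noninc D])
            (simp add: L2_norm_sphere_eq ip_nonneg)
        finally show ?thesis by (simp add: mult_ac)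
      qed
      then show ?thesis using True ip_lincomb_left[OF HLambda_l2 HLambda_l2 ei]
        unfolding HLambda_dual_def L_def by auto
    qed (simp add: HLambda_dual_def L_def[abs_def] exI[of _ 0])
  qed
  have Lg: "(\<Sum>i<n. L i f * g i x) = (\<Sum>i<m. ip sphere_measure f (e i) * e i x)" for f x
  proof -
    have "(\<Sum>i<m. ip sphere_measure f (e i) * e i x) = (\<Sum>i<m. L i f * g i x)"
      by (intro sum.cong) (auto simp: L_def g_def)
    also have "\<dots> = (\<Sum>i<n. L i f * g i x)"
      using m by (intro sum.mono_neutral_left) (auto simp: L_def)
    finally show ?thesis by simp
  qed
  have "approx_error lam n L g \<le> lam (Suc (Suc k))"
    unfolding approx_error_def
  proof (rule cSUP_least)
    show "{f \<in> HLambda lam. HLambda_norm lam f \<le> 1} \<noteq> ({} :: ('a \<Rightarrow> real) set)"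
      using zero_HLambda[OF pos noninc D] by blast
    fix f :: "'a \<Rightarrow> real" assume "f \<in> {f \<in> HLambda lam. HLambda_norm lam f \<le> 1}"
    then have f: "f \<in> HLambda lam" "HLambda_norm lam f \<le> 1" by auto
    note fl = HLambda_l2[OF f(1)]
    define G where "G = (\<lambda>x. \<Sum>i<m. ip sphere_measure f (e i) * e i x)"
    have G: "G \<in> harmonics_upto (Suc k)" unfolding G_def
      by (rule fun_subspace_sum[OF harmonics_upto_subspace]) (use e in auto)
    \<comment> \<open>\<open>G\<close> is the best approximation to \<open>f\<close> from V_(k+1),
      so its error does not exceed that of the partial sum of projections, which Parseval's identity
      controls.\<close>
    note S = sph_proj_partial_sum[OF fl D, where k = "Suc k"]
    have "ip sphere_measure (\<lambda>x. f x - G x) (\<lambda>x. f x - G x)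
        \<le> ip sphere_measure f f - (\<Sum>l\<le>Suc k. ip sphere_measure (sph_proj l f) (sph_proj l f))"
      unfolding S(3)[symmetric]
      by (rule best_approximation[OF harmonics_upto_l2 harmonics_upto_subspace fl G _ S(1)])
        (use me fl in \<open>simp add: G_def\<close>)
    \<comment> \<open>The sum over \<open>l \<le> Suc k\<close> is the sum over
      \<open>l < Suc (Suc k)\<close>, hence the index of \<open>lam\<close>.\<close>
    also have "\<dots> \<le> (lam (Suc (Suc k)))\<^sup>2 * (HLambda_norm lam f)\<^sup>2"
      using tail_bound[OF f(1) pos noninc D, of "Suc (Suc k)"] by (simp only: lessThan_Suc_atMost)
    also have "\<dots> \<le> (lam (Suc (Suc k)))\<^sup>2 * 1"
    proof (intro mult_left_mono)
      have "HLambda_norm lam f \<ge> 0"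
        using f(1) by (auto simp: HLambda_norm_def HLambda_def intro: suminf_nonneg)
      then show "(HLambda_norm lam f)\<^sup>2 \<le> 1" using f(2) by (simp add: power_le_one)
    qed simp
    finally show "L2_norm_sphere (\<lambda>x. f x - (\<Sum>i<n. L i f * g i x)) \<le> lam (Suc (Suc k))"
      using pos[of "Suc (Suc k)"] unfolding L2_norm_sphere_eq Lg
      by (intro real_le_lsqrt) (auto simp: G_def)
  qed
  moreover have "approx_num TYPE('a) lam n \<le> approx_error lam n L g"
    unfolding approx_num_eq
  proof (rule cInf_lower)
    show "bdd_below {approx_error lam n L (g :: nat \<Rightarrow> 'a \<Rightarrow> real) | L g. admissible lam n L g}"
      by (rule bdd_belowI[of _ 0]) (use approx_error_nonneg[OF _ pos noninc D] in auto)
  qed (use adm in auto)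
  ultimately show ?thesis by (rule order_trans[rotated])
qed

text \<open>Linearity of \<open>L\<close> is given only on \<open>HLambda lam\<close> and for
  combinations of two elements, so every partial sum has to stay in that set; the subspace
  \<open>W\<close> ensures this.\<close>

lemma HLambda_dual_sum:
  fixes v :: "'i \<Rightarrow> 'a::euclidean_space \<Rightarrow> real"
  assumes L: "L \<in> HLambda_dual lam" and W: "fun_subspace W" "W \<subseteq> HLambda lam"
    and "finite I" "\<And>i. i \<in> I \<Longrightarrow> v i \<in> W"
  shows "L (\<lambda>x. \<Sum>i\<in>I. c i * v i x) = (\<Sum>i\<in>I. c i * L (v i))"
  using assms(4,5)
proof (induction I rule: finite_induct)
  case empty
  have "(\<lambda>x::'a. 0) \<in> HLambda lam" using fun_subspace_zero[OF W(1)] W(2) by blast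
  moreover have "\<forall>f\<in>HLambda lam. \<forall>g\<in>HLambda lam. \<forall>a b. L (\<lambda>x. a * f x + b * g x) = a * L f + b * L g"
    using L by (simp add: HLambda_dual_def)
  ultimately have "L (\<lambda>x. 0 * 0 + 0 * 0) = 0 * L (\<lambda>x. 0) + 0 * L (\<lambda>x. 0)" by fast
  then show ?case by simp
next
  case (insert i I)
  have "v i \<in> HLambda lam" using insert.prems W(2) by blast
  moreover have "(\<lambda>x. \<Sum>i\<in>I. c i * v i x) \<in> HLambda lam"
    using fun_subspace_sum[OF W(1) insert.hyps(1)] insert.prems W(2) by blast
  moreover have "\<forall>f\<in>HLambda lam. \<forall>g\<in>HLambda lam. \<forall>a b. L (\<lambda>x. a * f x + b * g x) = a * L f + b * L g"
    using L by (simp add: HLambda_dual_def)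
  ultimately have "L (\<lambda>x. c i * v i x + 1 * (\<Sum>i\<in>I. c i * v i x))
      = c i * L (v i) + 1 * L (\<lambda>x. \<Sum>i\<in>I. c i * v i x)" by fast
  then show ?case using insert by simp
qed

text \<open>The degrees k+1 and k have opposite parity, so passing from x to -x separates the two
  homogeneous parts on the sphere. Homogeneity extends their vanishing to the whole space, where
  monomials of one degree are independent.\<close>

lemma sphere_monomials_independent:
  fixes c :: "('a::euclidean_space \<Rightarrow> nat) \<Rightarrow> real"
  assumes z: "\<And>x. x \<in> sphere 0 1 \<Longrightarrow> (\<Sum>\<alpha>\<in>exponents (Suc k) \<union> exponents k. c \<alpha> * mono_eval \<alpha> x) = 0"
    and \<alpha>: "\<alpha> \<in> exponents (Suc k) \<union> exponents k"
  shows "c \<alpha> = 0"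
proof -
  define p where "p j x = (\<Sum>\<alpha>\<in>exponents j. c \<alpha> * mono_eval \<alpha> x)" for j and x :: 'a
  have hom: "p j \<in> hom_poly j" for j
    unfolding p_def[abs_def] by (intro hom_poly_sum hom_poly_scale mono_eval_hom_poly) auto
  have sum0: "p (Suc k) x + p k x = 0" if "x \<in> sphere 0 1" for x
    using z[OF that] unfolding p_def
    by (subst (asm) sum.union_disjoint) (auto simp: exponents_disjoint)
  have par: "p j (- x) = (- 1) ^ j * p j x" for j x
    using hom_poly_homogeneous[OF hom, of j "-1" x] by simp
  have sph: "p (Suc k) x = 0 \<and> p k x = 0" if "x \<in> sphere 0 1" for x
    using sum0[OF that] sum0[of "- x"] that unfolding par by (cases "even k") auto
  have "p j x = 0" if j: "j = Suc k \<or> j = k" for j x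
  proof (cases "x = 0")
    case False
    have "p j (norm x *\<^sub>R (x /\<^sub>R norm x)) = norm x ^ j * p j (x /\<^sub>R norm x)"
      by (rule hom_poly_homogeneous[OF hom])
    moreover have "x /\<^sub>R norm x \<in> sphere 0 1" using False by simp
    ultimately show ?thesis using False sph j by auto
  next
    case True
    obtain b :: 'a where b: "b \<in> Basis" using nonempty_Basis by blast
    have "p j (0 *\<^sub>R b) = 0 ^ j * p j b" by (rule hom_poly_homogeneous[OF hom])
    then show ?thesis using True sph[of b] b j by auto
  qed
  then show ?thesis using \<alpha> monomials_independent[of c "Suc k" \<alpha>] monomials_independent[of c k \<alpha>]
    unfolding p_def by blast
qed

lemma approx_num_lower:
  fixes lam :: "nat \<Rightarrow> real"
  assumes pos: "\<And>l. lam l > 0" and noninc: "decseq lam" and D: "DIM('a::euclidean_space) \<ge> 3"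
    and n: "n < card (exponents (Suc k) :: ('a \<Rightarrow> nat) set) + card (exponents k :: ('a \<Rightarrow> nat) set)"
  shows "lam (Suc k) \<le> approx_num TYPE('a) lam n"
  unfolding approx_num_eq
proof (rule cInf_greatest)
  have "admissible lam n (\<lambda>_ _. 0) (\<lambda>_ _. 0 :: real)"
    by (auto simp: admissible_def HLambda_dual_def L2_sphere_eq intro: exI[of _ 0])
  then show "{approx_error lam n L (g :: nat \<Rightarrow> 'a \<Rightarrow> real) | L g. admissible lam n L g} \<noteq> {}" by blast
next
  fix y assume "y \<in> {approx_error lam n L (g :: nat \<Rightarrow> 'a \<Rightarrow> real) | L g. admissible lam n L g}"
  then obtain L and g :: "nat \<Rightarrow> 'a \<Rightarrow> real" where y: "y = approx_error lam n L g" and adm: "admissible lam n L g"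
    by blast
  let ?V = "harmonics_upto (Suc k) :: ('a \<Rightarrow> real) set"
  let ?J = "exponents (Suc k) \<union> exponents k :: ('a \<Rightarrow> nat) set"
  have cJ: "card ?J = card (exponents (Suc k) :: ('a \<Rightarrow> nat) set) + card (exponents k :: ('a \<Rightarrow> nat) set)"
    by (intro card_Un_disjoint exponents_disjoint) auto
  have VH: "?V \<subseteq> HLambda lam"
    by (rule subsetI) (rule harmonics_upto_HLambda(1)[OF _ pos noninc D])
  \<comment> \<open>A monomial need not itself belong to \<open>?V\<close>. It is replaced by an
    element of \<open>?V\<close> with the same values on the sphere, so that combinations fall under
    the Bernstein-type estimate.\<close>
  have "\<exists>v\<in>?V. \<forall>x\<in>sphere 0 1. mono_eval \<alpha> x = v x" if "\<alpha> \<in> ?J" for \<alpha>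
  proof -
    obtain j where j: "\<alpha> \<in> exponents j" "j \<le> Suc k"
    proof (cases "\<alpha> \<in> exponents k")
      case True
      then show thesis by (rule that) simp
    next
      case False
      then show thesis using \<open>\<alpha> \<in> ?J\<close> by (intro that[of "Suc k"]) auto
    qed
    from hom_poly_on_sphere[OF mono_eval_hom_poly[OF j(1)]]
    obtain v where "v \<in> harmonics_upto j" "\<forall>x\<in>sphere 0 1. mono_eval \<alpha> x = v x" ..
    then show ?thesis using harmonics_upto_mono[OF _ j(2)] by (intro bexI[of _ v]) auto
  qed
  then obtain v where v: "\<And>\<alpha>. \<alpha> \<in> ?J \<Longrightarrow> v \<alpha> \<in> ?V" "\<And>\<alpha> x. \<alpha> \<in> ?J \<Longrightarrow> x \<in> sphere 0 1 \<Longrightarrow> mono_eval \<alpha> x = v \<alpha> x"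
    by metis
  have "card {..<n} < card ?J" using n cJ by simp
  \<comment> \<open>The \<open>n\<close> equations say that each \<open>L i\<close> vanishes on the
    combination; the unknowns are its coefficients, more than \<open>n\<close> in number.\<close>
  from homogeneous_system_nontrivial_solution[OF finite_lessThan _ this, of "\<lambda>i \<alpha>. L i (v \<alpha>)"]
  obtain c where c: "\<exists>\<alpha>\<in>?J. c \<alpha> \<noteq> 0" "\<And>i. i < n \<Longrightarrow> (\<Sum>\<alpha>\<in>?J. L i (v \<alpha>) * c \<alpha>) = 0" by auto
  define F where "F = (\<lambda>x. \<Sum>\<alpha>\<in>?J. c \<alpha> * v \<alpha> x)"
  have FV: "F \<in> ?V" unfolding F_def
    by (rule fun_subspace_sum[OF harmonics_upto_subspace]) (use v in auto)
  then have Fl: "F \<in> l2 sphere_measure" using harmonics_upto_l2 by blast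
  \<comment> \<open>A null \<open>F\<close> vanishes everywhere on the sphere by continuity, and
    independence of the monomials there forces all of \<open>c\<close> to be 0.\<close>
  have "ip sphere_measure F F \<noteq> 0"
  proof
    assume "ip sphere_measure F F = 0"
    then have "AE x in sphere_measure. F x = 0" using ip_eq_0_AE[OF Fl] by simp
    then have "F x = 0" if "x \<in> sphere 0 1" for x
      using continuous_AE_sphere_zero[OF harmonics_upto_continuous[OF FV], of x] that by simp
    then have "(\<Sum>\<alpha>\<in>?J. c \<alpha> * mono_eval \<alpha> x) = 0" if "x \<in> sphere 0 1" for x
      using that v(2) unfolding F_def by simp
    then have "c \<alpha> = 0" if "\<alpha> \<in> ?J" for \<alpha> using sphere_monomials_independent[of c k] that by blast
    then show False using c(1) by blast
  qed
  then have Fpos: "ip sphere_measure F F > 0" using ip_nonneg[of sphere_measure F] by simp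
  \<comment> \<open>Scales \<open>F\<close> to L_2 norm \<open>lam (Suc k)\<close>, so that
    \<open>harmonics_upto_HLambda\<close> puts it into the unit ball of H^Lambda.\<close>
  define s where "s = lam (Suc k) / sqrt (ip sphere_measure F F)"
  define f where "f = (\<lambda>x. \<Sum>\<alpha>\<in>?J. (s * c \<alpha>) * v \<alpha> x)"
  have fF: "f = (\<lambda>x. s * F x)" by (auto simp: f_def F_def sum_distrib_left mult_ac)
  have fV: "f \<in> ?V" unfolding f_def
    by (rule fun_subspace_sum[OF harmonics_upto_subspace]) (use v in auto)
  have "ip sphere_measure f f = s\<^sup>2 * ip sphere_measure F F"
    by (simp add: fF ip_scale_left ip_scale_right l2_scale Fl power2_eq_square)
  also have "\<dots> = (lam (Suc k))\<^sup>2" using Fpos by (simp add: s_def power_divide)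
  finally have nf: "L2_norm_sphere f = lam (Suc k)"
    using pos[of "Suc k"] by (simp add: L2_norm_sphere_eq)
  have Lf: "L i f = 0" if "i < n" for i
  proof -
    have "L i \<in> HLambda_dual lam" using adm that by (simp add: admissible_def)
    then have "L i f = (\<Sum>\<alpha>\<in>?J. (s * c \<alpha>) * L i (v \<alpha>))"
      unfolding f_def by (rule HLambda_dual_sum[OF _ harmonics_upto_subspace VH]) (use v in auto)
    also have "\<dots> = s * (\<Sum>\<alpha>\<in>?J. L i (v \<alpha>) * c \<alpha>)" by (simp add: sum_distrib_left mult_ac)
    finally show ?thesis using c(2)[OF that] by simp
  qed
  have "f \<in> {f \<in> HLambda lam. HLambda_norm lam f \<le> 1}"
    using harmonics_upto_HLambda[OF fV pos noninc D] nf pos[of "Suc k"] by simp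
  moreover have "lam (Suc k) \<le> L2_norm_sphere (\<lambda>x. f x - (\<Sum>i<n. L i f * g i x))"
    using nf Lf by simp
  ultimately show "lam (Suc k) \<le> y"
    unfolding y approx_error_def by (rule cSUP_upper2[OF approx_error_bdd_above[OF adm pos noninc D]])
qed

section \<open>Counting and asymptotics\<close>

text \<open>Induction on the number of variables: one exponent is fixed to \<open>k - j\<close>, the
  others have total \<open>j\<close>, and the counts add up by the hockey-stick identity.\<close>

lemma card_bounded_exponents:
  assumes "finite B" "card B = Suc m"
  shows "card {\<alpha> :: 'i \<Rightarrow> nat. (\<forall>i. i \<notin> B \<longrightarrow> \<alpha> i = 0) \<and> sum \<alpha> B = k} = (m + k) choose k"
  using assms
proof (induction m arbitrary: B k)
  case 0
  then obtain b where "B = {b}" by (auto simp: card_Suc_eq)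
  then have "{\<alpha> :: 'i \<Rightarrow> nat. (\<forall>i. i \<notin> B \<longrightarrow> \<alpha> i = 0) \<and> sum \<alpha> B = k} = {\<lambda>i. if i = b then k else 0}"
    by auto
  then show ?case by simp
next
  case (Suc m)
  define E where "E C j = {\<alpha> :: 'i \<Rightarrow> nat. (\<forall>i. i \<notin> C \<longrightarrow> \<alpha> i = 0) \<and> sum \<alpha> C = j}" for C j
  obtain b C where B: "B = insert b C" "b \<notin> C" "card C = Suc m" "finite C"
    using Suc.prems by (metis card_Suc_eq finite_insert)
  have finE: "finite (E C j)" for j
  proof (rule finite_subset)
    show "E C j \<subseteq> {\<alpha>. \<forall>i. (i \<in> C \<longrightarrow> \<alpha> i \<in> {..j}) \<and> (i \<notin> C \<longrightarrow> \<alpha> i = 0)}"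
      using B(4) by (auto simp: E_def intro: member_le_sum)
  qed (rule finite_set_of_finite_funs, use B(4) in auto)
  have upd: "sum (\<alpha>(b := y)) C = sum \<alpha> C" for \<alpha> :: "'i \<Rightarrow> nat" and y
    using B(2) by (intro sum.cong) auto
  have "E B k = (\<Union>j\<le>k. (\<lambda>\<alpha>. \<alpha>(b := k - j)) ` E C j)"
  proof (intro equalityI subsetI)
    fix \<alpha> assume \<alpha>: "\<alpha> \<in> E B k"
    then have s: "\<alpha> b + sum \<alpha> C = k" using B by (simp add: E_def)
    have "\<alpha>(b := 0) \<in> E C (sum \<alpha> C)" using \<alpha> B(1) upd by (auto simp: E_def)
    moreover have "\<alpha> = (\<alpha>(b := 0))(b := k - sum \<alpha> C)" using s by auto
    moreover have "sum \<alpha> C \<le> k" using s by simp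
    ultimately show "\<alpha> \<in> (\<Union>j\<le>k. (\<lambda>\<alpha>. \<alpha>(b := k - j)) ` E C j)" by blast
  qed (use B upd in \<open>auto simp: E_def\<close>)
  moreover have "card (\<Union>j\<le>k. (\<lambda>\<alpha>. \<alpha>(b := k - j)) ` E C j) = (\<Sum>j\<le>k. card ((\<lambda>\<alpha>. \<alpha>(b := k - j)) ` E C j))"
  proof (rule card_UN_disjoint)
    show "\<forall>i\<in>{..k}. \<forall>j\<in>{..k}. i \<noteq> j \<longrightarrow>
        (\<lambda>\<alpha>. \<alpha>(b := k - i)) ` E C i \<inter> (\<lambda>\<alpha>. \<alpha>(b := k - j)) ` E C j = {}"
    proof (intro ballI impI, rule ccontr)
      fix i j assume ij: "i \<in> {..k}" "j \<in> {..k}" "i \<noteq> j"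
        "(\<lambda>\<alpha>. \<alpha>(b := k - i)) ` E C i \<inter> (\<lambda>\<alpha>. \<alpha>(b := k - j)) ` E C j \<noteq> {}"
      then obtain \<alpha> \<alpha>' :: "'i \<Rightarrow> nat" where "\<alpha>(b := k - i) = \<alpha>'(b := k - j)" by auto
      then have "k - i = k - j" by (metis fun_upd_same)
      then show False using ij by auto
    qed
  qed (use finE in auto)
  moreover have "card ((\<lambda>\<alpha>. \<alpha>(b := k - j)) ` E C j) = (m + j) choose j" for j
  proof -
    have "inj_on (\<lambda>\<alpha>. \<alpha>(b := k - j)) (E C j)"
    proof (rule inj_onI, rule ext)
      fix \<alpha> \<alpha>' i assume *: "\<alpha> \<in> E C j" "\<alpha>' \<in> E C j" "\<alpha>(b := k - j) = \<alpha>'(b := k - j)"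
      show "\<alpha> i = \<alpha>' i"
      proof (cases "i = b")
        case True
        then show ?thesis using * B(2) by (simp add: E_def)
      next
        case False
        then show ?thesis using *(3) by (metis fun_upd_other)
      qed
    qed
    then show ?thesis using Suc.IH[OF B(4,3), of j] by (simp add: card_image E_def)
  qed
  ultimately have "card (E B k) = (\<Sum>j\<le>k. (m + j) choose j)" by simp
  also have "\<dots> = Suc (m + k) choose k" by (rule sum_choose_lower)
  finally show ?case by (simp add: E_def)
qed

lemma card_exponents:
  assumes "DIM('a::euclidean_space) = d + 1"
  shows "card (exponents k :: ('a \<Rightarrow> nat) set) = (d + k) choose d"
  using card_bounded_exponents[of "Basis :: 'a set" d k] assms
    binomial_symmetric[of k "d + k"]
  by (simp add: exponents_def)

text \<open>Going from d to d+1 multiplies the binomial by (d + k + 1)/(d + 1), which is k times (1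
  + (d + 1)/k)/(d + 1).\<close>

lemma binomial_asymptotics:
  "(\<lambda>k. real ((d + k) choose d) / real k ^ d) \<longlonglongrightarrow> 1 / fact d"
proof (induction d)
  case 0
  show ?case by simp
next
  case (Suc d)
  have lim: "(\<lambda>k. (1 + (real d + 1) * inverse (real k)) / (real d + 1)) \<longlonglongrightarrow> (1 + (real d + 1) * 0) / (real d + 1)"
    by (intro tendsto_intros lim_inverse_n) auto
  have "(\<lambda>k. real ((d + k) choose d) / real k ^ d * ((1 + (real d + 1) * inverse (real k)) / (real d + 1)))
      \<longlonglongrightarrow> 1 / fact d * ((1 + (real d + 1) * 0) / (real d + 1))"
    by (intro tendsto_mult Suc lim)
  moreover have "\<forall>\<^sub>F k in sequentially. real ((d + k) choose d) / real k ^ d *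
      ((1 + (real d + 1) * inverse (real k)) / (real d + 1)) = real ((Suc d + k) choose Suc d) / real k ^ Suc d"
    using eventually_gt_at_top[of 0]
  proof eventually_elim
    case (elim k)
    have "Suc d * (Suc (d + k) choose Suc d) = Suc (d + k) * ((d + k) choose d)"
      by (rule Suc_times_binomial)
    then have "real (Suc d) * real ((Suc d + k) choose Suc d) = real (Suc (d + k)) * real ((d + k) choose d)"
      by (metis add_Suc of_nat_mult)
    then have Y: "real ((Suc d + k) choose Suc d) = (real d + real k + 1) * real ((d + k) choose d) / (real d + 1)"
      by (simp add: nonzero_eq_divide_eq mult.commute add_ac del: binomial_Suc_Suc)
    show ?case unfolding Y using elim by (simp add: field_simps)
  qed
  ultimately have "(\<lambda>k. real ((Suc d + k) choose Suc d) / real k ^ Suc d)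
      \<longlonglongrightarrow> 1 / fact d * ((1 + (real d + 1) * 0) / (real d + 1))"
    by (rule Lim_transform_eventually)
  moreover have "1 / fact d * ((1 + (real d + 1) * 0) / (real d + 1)) = (1 / fact (Suc d) :: real)"
    by (simp add: algebra_simps)
  ultimately show ?case by (simp only:)
qed

text \<open>Inverts the counting function: if K is the step on which n lies, then n ~ c K^d, so
  n^(\<alpha>/d) ~ c^(\<alpha>/d) K^\<alpha> and ln n ~ d ln K. These two ratios produce the two
  factors of the limit.\<close>

lemma asymptotics_from_counting:
  fixes N :: "nat \<Rightarrow> nat" and lam a :: "nat \<Rightarrow> real" and \<alpha> \<beta> c :: real
  assumes d: "d > 0" and c: "c > 0"
    and N: "(\<lambda>k. real (N k) / real k ^ d) \<longlonglongrightarrow> c"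
    and asym: "(\<lambda>l. lam l * real l powr \<alpha> * ln (real l) powr \<beta>) \<longlonglongrightarrow> 1"
    and a: "\<And>n k. k > 0 \<Longrightarrow> N k \<le> n \<Longrightarrow> n < N (Suc k) \<Longrightarrow> a n = lam (Suc k)"
  shows "(\<lambda>n. real n powr (\<alpha> / real d) * ln (real n) powr \<beta> * a n) \<longlonglongrightarrow> c powr (\<alpha> / real d) * real d powr \<beta>"
proof -
  have "filterlim (\<lambda>k. real (N k)) at_top sequentially"
  proof -
    have "filterlim (\<lambda>k. (real (N k) / real k ^ d) * real k ^ d) at_top sequentially"
      using N c d by (intro filterlim_tendsto_pos_mult_at_top[OF N c] filterlim_pow_at_top filterlim_real_sequentially) auto
    moreover have "\<forall>\<^sub>F k in sequentially. (real (N k) / real k ^ d) * real k ^ d = real (N k)"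
      using eventually_gt_at_top[of 0] by eventually_elim simp
    ultimately show ?thesis by (simp add: filterlim_cong[OF refl refl])
  qed
  then have Nlim: "filterlim N at_top sequentially" by (simp add: filterlim_sequentially_iff_filterlim_real)
  have ex: "\<exists>k. n < N k" for n
  proof -
    have "\<forall>\<^sub>F k in sequentially. Suc n \<le> N k" using Nlim by (auto simp: filterlim_at_top)
    then obtain k where "Suc n \<le> N k" unfolding eventually_sequentially by blast
    then show ?thesis by (intro exI[of _ k]) simp
  qed
  \<comment> \<open>By minimality \<open>N (K n - 1) \<le> n < N (K n)\<close> as soon as
    \<open>K n > 0\<close>, so \<open>a n = lam (K n)\<close> for large \<open>n\<close>.\<close>
  define K where "K n = (LEAST k. n < N k)" for n
  have K1: "n < N (K n)" for n unfolding K_def using ex by (rule LeastI_ex)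
  have K2: "N k \<le> n" if "k < K n" for n k 
    using not_less_Least that unfolding K_def by (metis not_less)
  have Klim: "filterlim K at_top sequentially"
    unfolding filterlim_at_top
  proof
    fix Z
    \<comment> \<open>If \<open>K n\<close> were below \<open>Z\<close>, the value
      \<open>N (K n)\<close> would be one of finitely many numbers bounded by \<open>n\<close>,
      against \<open>n < N (K n)\<close>.\<close>
    have "K n \<ge> Z" if "n \<ge> Max (N ` {..Z})" for n
    proof (rule ccontr)
      assume "\<not> K n \<ge> Z"
      then have "N (K n) \<le> Max (N ` {..Z})" by (intro Max_ge) auto
      then show False using K1[of n] that by simp
    qed
    then show "\<forall>\<^sub>F n in sequentially. Z \<le> K n" unfolding eventually_sequentially by blast
  qed
  \<comment> \<open>From 2 on, \<open>K n - 1\<close> is positive, as the hypothesis on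
    \<open>a\<close> demands, and \<open>ln (K n)\<close> is positive, so that division by it is
    safe.\<close>
  have evK: "\<forall>\<^sub>F n in sequentially. K n \<ge> 2" using Klim by (auto simp: filterlim_at_top)
  have ratio: "(\<lambda>n. real n / real (K n) ^ d) \<longlonglongrightarrow> c"
  proof (rule tendsto_sandwich)
    have "(\<lambda>k. (real (N k) / real k ^ d) * (real k / real (Suc k)) ^ d) \<longlonglongrightarrow> c * 1 ^ d"
      by (intro tendsto_intros N LIMSEQ_n_over_Suc_n)
    moreover have "\<forall>\<^sub>F k in sequentially. (real (N k) / real k ^ d) * (real k / real (Suc k)) ^ d = real (N k) / real (Suc k) ^ d"
      using eventually_gt_at_top[of 0] by eventually_elim (simp add: power_divide)
    ultimately have "(\<lambda>k. real (N k) / real (Suc k) ^ d) \<longlonglongrightarrow> c" by (simp add: tendsto_cong)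
    moreover have "filterlim (\<lambda>n. K n - 1) sequentially sequentially"
      using Klim by (intro filterlim_compose[OF filterlim_minus_const_nat_at_top])
    ultimately show "(\<lambda>n. real (N (K n - 1)) / real (Suc (K n - 1)) ^ d) \<longlonglongrightarrow> c" by (rule filterlim_compose)
    show "(\<lambda>n. real (N (K n)) / real (K n) ^ d) \<longlonglongrightarrow> c" using N Klim by (rule filterlim_compose)
    show "\<forall>\<^sub>F n in sequentially. real (N (K n - 1)) / real (Suc (K n - 1)) ^ d \<le> real n / real (K n) ^ d"
      using evK
    proof eventually_elim
      case (elim n)
      then have "N (K n - 1) \<le> n" "Suc (K n - 1) = K n" by (auto intro: K2)
      then show ?case by (simp add: divide_right_mono)
    qed
    show "\<forall>\<^sub>F n in sequentially. real n / real (K n) ^ d \<le> real (N (K n)) / real (K n) ^ d"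
      by (intro always_eventually allI divide_right_mono of_nat_mono less_imp_le[OF K1]) simp
  qed
  have lnK: "filterlim (\<lambda>n. ln (real (K n))) at_top sequentially"
    by (intro filterlim_compose[OF ln_at_top] filterlim_compose[OF filterlim_real_sequentially] Klim)
  have lnratio: "(\<lambda>n. ln (real n) / ln (real (K n))) \<longlonglongrightarrow> real d"
  proof -
    \<comment> \<open>ln n = ln (n/K^d) + d ln K; the first term converges to ln c and vanishes
      after division by ln K.\<close>
    have "(\<lambda>n. ln (real n / real (K n) ^ d) / ln (real (K n)) + real d) \<longlonglongrightarrow> 0 + real d"
      using ratio c by (intro tendsto_add tendsto_const tendsto_divide_0[OF tendsto_ln] filterlim_at_top_imp_at_infinity lnK) auto
    moreover have "\<forall>\<^sub>F n in sequentially. ln (real n / real (K n) ^ d) / ln (real (K n)) + real d = ln (real n) / ln (real (K n))"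
      using evK eventually_gt_at_top[of 0]
    proof eventually_elim
      case (elim n)
      then have "ln (real (K n)) > 0" by simp
      then show ?case using elim by (simp add: ln_div ln_realpow diff_divide_distrib)
    qed
    ultimately show ?thesis by (simp add: tendsto_cong)
  qed
  \<comment> \<open>The powers of \<open>K n\<close> and of its logarithm cancel between the three
    factors, leaving the expression in \<open>n\<close>.\<close>
  have "(\<lambda>n. (real n / real (K n) ^ d) powr (\<alpha> / real d) * (ln (real n) / ln (real (K n))) powr \<beta>
      * (lam (K n) * real (K n) powr \<alpha> * ln (real (K n)) powr \<beta>))
      \<longlonglongrightarrow> c powr (\<alpha> / real d) * real d powr \<beta> * 1"
    using c d by (intro tendsto_mult tendsto_powr ratio lnratio tendsto_const filterlim_compose[OF asym Klim]) auto
  moreover have "\<forall>\<^sub>F n in sequentially. (real n / real (K n) ^ d) powr (\<alpha> / real d) * (ln (real n) / ln (real (K n))) powr \<beta>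
      * (lam (K n) * real (K n) powr \<alpha> * ln (real (K n)) powr \<beta>)
      = real n powr (\<alpha> / real d) * ln (real n) powr \<beta> * a n"
    using evK eventually_gt_at_top[of 1]
  proof eventually_elim
    case (elim n)
    then obtain k where k: "K n = Suc k" by (cases "K n") auto
    have "a n = lam (K n)" unfolding k by (rule a) (use K2[of k n] K1[of n] k elim in auto)
    moreover have "(real n / real (K n) ^ d) powr (\<alpha> / real d) = real n powr (\<alpha> / real d) / real (K n) powr \<alpha>"
    proof -
      have "(real (K n) ^ d) powr (\<alpha> / real d) = real (K n) powr \<alpha>"
        using elim d by (simp add: powr_realpow[symmetric] powr_powr)
      then show ?thesis using elim by (simp add: powr_divide)
    qed
    moreover have "(ln (real n) / ln (real (K n))) powr \<beta> = ln (real n) powr \<beta> / ln (real (K n)) powr \<beta>"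
      using elim by (simp add: powr_divide)
    moreover have "real (K n) powr \<alpha> > 0" "ln (real (K n)) powr \<beta> > 0" using elim by auto
    ultimately show ?case by simp
  qed
  ultimately show ?thesis by (simp add: tendsto_cong)
qed

theorem theorem3p1:
  fixes d :: nat and \<alpha> \<beta> :: real and lam :: "nat \<Rightarrow> real"
  assumes dim: "DIM('a::euclidean_space) = d + 1"
    and d2: "d \<ge> 2"
    and alpha: "\<alpha> > 0"
    and pos: "\<And>l. lam l > 0"
    and noninc: "decseq lam"
    and asym: "(\<lambda>l. lam l * real l powr \<alpha> * ln (real l) powr \<beta>) \<longlonglongrightarrow> 1"
  shows "(\<lambda>n. real n powr (\<alpha> / real d) * ln (real n) powr \<beta> * approx_num TYPE('a) lam n)
           \<longlonglongrightarrow> (2 / fact d) powr (\<alpha> / real d) * real d powr \<beta>"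
proof (rule asymptotics_from_counting[OF _ _ _ asym,
      where N = "\<lambda>k. card (exponents k :: ('a \<Rightarrow> nat) set) + card (exponents (k - 1) :: ('a \<Rightarrow> nat) set)"])
  have D: "DIM('a) \<ge> 3" using dim d2 by simp
  \<comment> \<open>For \<open>k > 0\<close> the number \<open>N k\<close> is the dimension of V_k.
    At \<open>k = 0\<close> the index \<open>k - 1\<close> truncates and the constants are counted
    twice, which the condition \<open>k > 0\<close> excludes.\<close>
  show "approx_num TYPE('a) lam n = lam (Suc k)"
    if k: "k > 0" and n1: "card (exponents k :: ('a \<Rightarrow> nat) set) + card (exponents (k - 1) :: ('a \<Rightarrow> nat) set) \<le> n"
      and n2: "n < card (exponents (Suc k) :: ('a \<Rightarrow> nat) set) + card (exponents (Suc k - 1) :: ('a \<Rightarrow> nat) set)"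
    for n k
  proof (rule antisym)
    obtain j where j: "k = Suc j" using k by (cases k) auto
    show "approx_num TYPE('a) lam n \<le> lam (Suc k)"
      unfolding j by (rule approx_num_upper[OF pos noninc D]) (use n1 j in simp)
    show "lam (Suc k) \<le> approx_num TYPE('a) lam n"
      by (rule approx_num_lower[OF pos noninc D]) (use n2 in simp)
  qed
  define q where "q k = real ((d + k) choose d) / real k ^ d" for k
  have q: "q \<longlonglongrightarrow> 1 / fact d" unfolding q_def[abs_def] by (rule binomial_asymptotics)
  \<comment> \<open>Shifting the index by one resolves the truncated \<open>k - 1\<close>. Each of
    the two degrees contributes 1/d!, the lower one after comparing k^d with (k+1)^d.\<close>
  have "(\<lambda>k. q (Suc k) + q k * (real k / real (Suc k)) ^ d) \<longlonglongrightarrow> 1 / fact d + 1 / fact d * 1 ^ d"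
    by (intro tendsto_intros LIMSEQ_Suc[OF q] q LIMSEQ_n_over_Suc_n)
  moreover have "\<forall>\<^sub>F k in sequentially. q (Suc k) + q k * (real k / real (Suc k)) ^ d
      = real (card (exponents (Suc k) :: ('a \<Rightarrow> nat) set) + card (exponents (Suc k - 1) :: ('a \<Rightarrow> nat) set)) / real (Suc k) ^ d"
    using eventually_gt_at_top[of 0]
  proof eventually_elim
    case (elim k)
    then have "q k * (real k / real (Suc k)) ^ d = real ((d + k) choose d) / real (Suc k) ^ d"
      by (simp add: q_def power_divide)
    then show ?case unfolding card_exponents[OF dim] q_def
      by (simp add: add_divide_distrib del: binomial_Suc_Suc)
  qed
  ultimately have "(\<lambda>k. real (card (exponents (Suc k) :: ('a \<Rightarrow> nat) set) + card (exponents (Suc k - 1) :: ('a \<Rightarrow> nat) set))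
      / real (Suc k) ^ d) \<longlonglongrightarrow> 1 / fact d + 1 / fact d * 1 ^ d"
    by (rule Lim_transform_eventually)
  moreover have "1 / fact d + 1 / fact d * 1 ^ d = (2 / fact d :: real)" by simp
  ultimately show "(\<lambda>k. real (card (exponents k :: ('a \<Rightarrow> nat) set) + card (exponents (k - 1) :: ('a \<Rightarrow> nat) set)) / real k ^ d)
      \<longlonglongrightarrow> 2 / fact d"
    by (simp only: filterlim_sequentially_Suc[of "\<lambda>k. real (card (exponents k :: ('a \<Rightarrow> nat) set)
      + card (exponents (k - 1) :: ('a \<Rightarrow> nat) set)) / real k ^ d", symmetric])
qed (use d2 in auto)

end
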